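(* Let $n\geq 1$ and $m>0$. There exists a constant $C > 0$ depending on $m$ and $n$ such that, for all initial data $[u_0,u_1]\in(H^{1}(\mathbf{R}^n) \cap L^{1,1}(\mathbf{R}^n))\times(L^{2}(\mathbf{R}^n)\cap L^{1,1}(\mathbf{R}^n))$, the weak solution $u \in C([0,\infty);H^{1}(\mathbf{R}^{n})) \cap C^{1}([0,\infty);L^{2}(\mathbf{R}^{n}))$ of the Cauchy problem $$u_{tt} - \Delta u + m^{2}u - \Delta u_{t} = 0 \ \text{ in } (0,\infty)\times\mathbf{R}^{n}, \qquad u(0,x)=u_{0}(x),\quad u_{t}(0,x)=u_{1}(x),$$ satisfies $$C^{-1}(\vert P_{0}\vert + \vert P_{1}\vert)\,t^{-\frac{n}{4}} \leq \Vert u(t,\cdot)\Vert \leq C\,t^{-\frac{n}{4}}\left(\Vert u_{0}\Vert_{1} + \Vert u_{1}\Vert_{1} + \Vert u_{0}\Vert_{H^{1}} + \Vert u_{1}\Vert\right)$$ for all sufficiently large $t$ (that is, for all $t\ge t_{0}$ for some $t_0>0$, which may depend on the data), where $P_{j} := \int_{\mathbf{R}^{n}}u_{j}(x)\,dx$ for $j=0,1$.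
   Context: $\Vert\cdot\Vert_{q}$ denotes the $L^{q}(\mathbf{R}^{n})$-norm, and $\Vert\cdot\Vert$ denotes the $L^{2}(\mathbf{R}^{n})$-norm. The weighted space $L^{1,1}(\mathbf{R}^{n})$ consists of all $f\in L^{1}(\mathbf{R}^{n})$ with $\Vert f\Vert_{1,1} := \int_{\mathbf{R}^{n}}(1+\vert x\vert)\vert f(x)\vert\, dx < +\infty$. For $[u_{0},u_{1}] \in H^{1}(\mathbf{R}^{n}) \times L^{2}(\mathbf{R}^{n})$ it is known that the Cauchy problem has a unique weak solution $u \in C([0,\infty);H^{1}(\mathbf{R}^{n})) \cap C^{1}([0,\infty);L^{2}(\mathbf{R}^{n}))$. Its Fourier transform in $x$, $\hat{u}(t,\xi)$, solves for (almost) every $\xi$ the ordinary differential equation $\hat{u}_{tt}+|\xi|^{2}\hat{u}_{t}+(|\xi|^{2}+m^{2})\hat{u}=0$ with $\hat{u}(0,\xi)=\hat{u}_{0}(\xi)$, $\hat{u}_{t}(0,\xi)=\hat{u}_{1}(\xi)$. *)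

theory Defs
  imports "HOL-Analysis.Analysis"
begin

text \<open>
  Elements of Lebesgue and Sobolev spaces are represented by complex-valued functions on the whole
  space, measurable for the completed Lebesgue measure; almost-everywhere equal functions are not
  identified, so the norms below are seminorms on representatives.
\<close>

definition L2 :: "('a::euclidean_space \<Rightarrow> complex) set" where
  "L2 = {f \<in> borel_measurable lebesgue. integrable lebesgue (\<lambda>x. (norm (f x))\<^sup>2)}"

definition L2_norm :: "('a::euclidean_space \<Rightarrow> complex) \<Rightarrow> real" where
  "L2_norm f = sqrt (LINT x|lebesgue. (norm (f x))\<^sup>2)"

definition L1_norm :: "('a::euclidean_space \<Rightarrow> complex) \<Rightarrow> real" where
  "L1_norm f = (LINT x|lebesgue. norm (f x))"

definition L11 :: "('a::euclidean_space \<Rightarrow> complex) set" where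
  "L11 = {f. integrable lebesgue f \<and> integrable lebesgue (\<lambda>x. (1 + norm x) * norm (f x))}"

definition dir_deriv :: "'a::euclidean_space \<Rightarrow> ('a \<Rightarrow> real) \<Rightarrow> 'a \<Rightarrow> real" where
  "dir_deriv b f x = frechet_derivative f (at x) b"

primrec Ck :: "nat \<Rightarrow> ('a::euclidean_space \<Rightarrow> real) \<Rightarrow> bool" where
  "Ck 0 f \<longleftrightarrow> continuous_on UNIV f"
| "Ck (Suc k) f \<longleftrightarrow> (\<forall>x. f differentiable (at x)) \<and> (\<forall>b\<in>Basis. Ck k (dir_deriv b f))"

text \<open>The space $C_c^\infty(\Omega)$; its elements are extended by zero outside $\Omega$.\<close>

definition test_functions :: "'a::euclidean_space set \<Rightarrow> ('a \<Rightarrow> real) set" where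
  "test_functions \<Omega> = {\<phi>. (\<forall>k. Ck k \<phi>) \<and>
     compact (closure {x. \<phi> x \<noteq> 0}) \<and> closure {x. \<phi> x \<noteq> 0} \<subseteq> \<Omega>}"

definition is_weak_deriv ::
  "'a::euclidean_space \<Rightarrow> ('a \<Rightarrow> complex) \<Rightarrow> ('a \<Rightarrow> complex) \<Rightarrow> bool" where
  "is_weak_deriv b f g \<longleftrightarrow> (\<forall>\<phi>\<in>test_functions UNIV.
     (LINT x|lebesgue. dir_deriv b \<phi> x *\<^sub>R f x) = - (LINT x|lebesgue. \<phi> x *\<^sub>R g x))"

definition H1 :: "('a::euclidean_space \<Rightarrow> complex) set" where
  "H1 = {f \<in> L2. \<forall>b\<in>Basis. \<exists>g\<in>L2. is_weak_deriv b f g}"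

text \<open>For $f \in H^1$ the choice below is unique up to a null set.\<close>

definition weak_deriv :: "'a::euclidean_space \<Rightarrow> ('a \<Rightarrow> complex) \<Rightarrow> 'a \<Rightarrow> complex" where
  "weak_deriv b f = (SOME g. g \<in> L2 \<and> is_weak_deriv b f g)"

definition H1_norm :: "('a::euclidean_space \<Rightarrow> complex) \<Rightarrow> real" where
  "H1_norm f = sqrt ((L2_norm f)\<^sup>2 + (\<Sum>b\<in>Basis. (L2_norm (weak_deriv b f))\<^sup>2))"

text \<open>Curves in $C([0,\infty);X)$, where $X$ is a function space with (semi)norm $N$. Values at
  negative times are irrelevant.\<close>

definition continuous_curve ::
  "('a \<Rightarrow> complex) set \<Rightarrow> (('a \<Rightarrow> complex) \<Rightarrow> real) \<Rightarrow> (real \<Rightarrow> 'a \<Rightarrow> complex) \<Rightarrow> bool" where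
  "continuous_curve X N u \<longleftrightarrow> (\<forall>t\<ge>0. u t \<in> X) \<and>
     (\<forall>t\<ge>0. ((\<lambda>s. N (\<lambda>x. u s x - u t x)) \<longlongrightarrow> 0) (at t within {0..}))"

text \<open>\<open>v\<close> is the derivative of \<open>u\<close> on $[0,\infty)$ as an $L^2$-valued function (one-sided at 0).\<close>

definition L2_curve_deriv ::
  "(real \<Rightarrow> 'a::euclidean_space \<Rightarrow> complex) \<Rightarrow> (real \<Rightarrow> 'a \<Rightarrow> complex) \<Rightarrow> bool" where
  "L2_curve_deriv u v \<longleftrightarrow> (\<forall>t\<ge>0.
     ((\<lambda>s. L2_norm (\<lambda>x. (u s x - u t x) /\<^sub>R (s - t) - v t x)) \<longlongrightarrow> 0) (at t within {0..}))"

text \<open>Time derivative and spatial Laplacian of functions of $(t,x)$.\<close>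

definition dt :: "(real \<times> 'a::euclidean_space \<Rightarrow> real) \<Rightarrow> real \<times> 'a \<Rightarrow> real" where
  "dt \<phi> = dir_deriv (1, 0) \<phi>"

definition laplacian :: "(real \<times> 'a::euclidean_space \<Rightarrow> real) \<Rightarrow> real \<times> 'a \<Rightarrow> real" where
  "laplacian \<phi> z = (\<Sum>b\<in>Basis. dir_deriv (0, b) (dir_deriv (0, b) \<phi>) z)"

text \<open>
  $u_{tt} - \Delta u + m^2 u - \Delta u_t = 0$ in the sense of distributions on
  $(0,\infty) \times \mathbf{R}^n$: all derivatives are moved to the test function, and the third-order
  term changes sign. The integral is iterated because \<open>u\<close> is only a curve of representatives,
  which need not be jointly measurable in $(t,x)$.
\<close>

definition distributional_solution ::
  "real \<Rightarrow> (real \<Rightarrow> 'a::euclidean_space \<Rightarrow> complex) \<Rightarrow> bool" where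
  "distributional_solution m u \<longleftrightarrow> (\<forall>\<phi>\<in>test_functions ({0<..} \<times> UNIV).
     (LINT t:{0<..}|lebesgue. LINT x|lebesgue.
        (dt (dt \<phi>) (t, x) - laplacian \<phi> (t, x) + m\<^sup>2 * \<phi> (t, x) + laplacian (dt \<phi>) (t, x))
          *\<^sub>R u t x) = 0)"

definition weak_solution ::
  "real \<Rightarrow> ('a::euclidean_space \<Rightarrow> complex) \<Rightarrow> ('a \<Rightarrow> complex) \<Rightarrow> (real \<Rightarrow> 'a \<Rightarrow> complex) \<Rightarrow> bool" where
  "weak_solution m u\<^sub>0 u\<^sub>1 u \<longleftrightarrow>
     continuous_curve H1 H1_norm u \<and>
     (\<exists>v. continuous_curve L2 L2_norm v \<and> L2_curve_deriv u v \<and>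
        (AE x in lebesgue. u 0 x = u\<^sub>0 x) \<and> (AE x in lebesgue. v 0 x = u\<^sub>1 x)) \<and>
     distributional_solution m u"

end

theory Submission
  imports Defs "HOL-Probability.Characteristic_Functions"
begin

text \<open>
  For a cutoff $\phi_R(x) = \eta(x/R)$ the Fourier transform $w(t,\xi)$ of $\phi_R u(t)$ exists
  pointwise, and the weak formulation, tested with $\theta(t) \phi_R(x) \cos(x\cdot\xi)$ and
  $\theta(t) \phi_R(x) \sin(x\cdot\xi)$, says that
  $w'' + |\xi|^2 w' + (|\xi|^2 + m^2) w$ equals a commutator term $f_R$ in which derivatives fall on
  the cutoff. By Plancherel's theorem $\int |f_R|^2 / (|\xi|^2 + m^2)\, d\xi = O(R^{-2})$ on bounded
  time intervals, so $f_R$ disappears as $R \to \infty$ once estimates for the ordinary differential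
  equation are integrated in $\xi$.

  A modified energy decays like $e^{-ct\min(1, |\xi|^2)}$. Low frequencies are controlled by
  $|\hat u_j| \le \Vert u_j \Vert_1$ and a Gaussian integral, high frequencies by Plancherel, which
  gives the upper bound. For the lower bound $w$ is compared, at frequencies $|\xi|^2 = O(1/t)$, with
  the exact solution of the ordinary differential equation with constant data $P_0$, $P_1$; by the
  first moments of the data the error is $O(t^{-1/2})$. Up to a bounded factor that solution is
  $P_0 \cos\tau + (P_1/m) \sin\tau$ with $\tau \approx mt + t|\xi|^2/(2m)$. On two balls of radius
  proportional to $t^{-1/2}$ these phases differ by $\pi/2$, so that the two squared moduli add up to
  $|P_0|^2 + |P_1/m|^2$ and no cancellation can occur.
\<close>

section \<open>Smooth functions and test functions\<close>

text \<open>A weak solution is a curve of L^2 classes whose representatives are chosen independently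
  at each time, so nothing is known about t \<mapsto> u(t, x) at a fixed x. Pairing with a fixed L^2
  function is insensitive to this choice. The cutoff turns each frequency into such a pairing, which
  makes the transform differentiable in t and jointly continuous in (t, \<xi>); Fubini relies on the
  latter. T is held fixed while R tends to infinity, so the constant in O(R^{-2}) may depend on T
  and on the solution. The weight |\<xi>|^2 + m^2 is the coefficient of |w|^2 in the energy, and it
  outweighs the factor \<xi> that remains when only one derivative falls on the cutoff. The decay
  rate is geometric: squared norms are governed by a frequency region of radius T^{-1/2} and volume
  T^{-n/2}. The threshold time depends on the data only in the lower bound, where squared errors of
  size 1/T times squared first moments have to drop below a multiple of |P_0|^2 + |P_1/m|^2.\<close>

lemma dir_deriv_eq:
  assumes "(f has_derivative f') (at x)"
  shows "dir_deriv b f x = f' b"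
  using frechet_derivative_at[OF assms] by (simp add: dir_deriv_def)

lemma has_derivative_dir_deriv:
  assumes "f differentiable (at x)"
  shows "(f has_derivative (\<lambda>h. dir_deriv h f x)) (at x)"
  using assms frechet_derivative_works unfolding dir_deriv_def by blast

lemma Ck_continuous: "Ck k f \<Longrightarrow> continuous_on UNIV f"
  by (cases k) (auto simp: differentiable_imp_continuous_within continuous_on_eq_continuous_within)

lemma Ck_Suc_imp: "Ck (Suc k) f \<Longrightarrow> Ck k f"
proof (induction k arbitrary: f)
  case 0
  then show ?case using Ck_continuous by (metis Ck.simps(1))
next
  case (Suc k)
  then show ?case by (metis Ck.simps(2))
qed

lemma Ck_const: "Ck k (\<lambda>x. c)"
proof (induction k arbitrary: c)
  case (Suc k)
  have "dir_deriv b (\<lambda>x::'a. c) = (\<lambda>x. 0)" for b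
    by (rule ext, rule dir_deriv_eq) simp
  with Suc show ?case by simp
qed simp

lemma Ck_add: "Ck k f \<Longrightarrow> Ck k g \<Longrightarrow> Ck k (\<lambda>x. f x + g x)"
proof (induction k arbitrary: f g)
  case (Suc k)
  have "dir_deriv b (\<lambda>x. f x + g x) = (\<lambda>x. dir_deriv b f x + dir_deriv b g x)" for b
    by (rule ext, rule dir_deriv_eq)
      (use Suc.prems in \<open>auto intro!: derivative_intros has_derivative_dir_deriv\<close>)
  with Suc show ?case by (auto intro: differentiable_add)
qed (auto intro: continuous_intros)

lemma Ck_mult: "Ck k f \<Longrightarrow> Ck k g \<Longrightarrow> Ck k (\<lambda>x. f x * g x)"
proof (induction k arbitrary: f g)
  case (Suc k)
  have *: "dir_deriv b (\<lambda>x. f x * g x) = (\<lambda>x. f x * dir_deriv b g x + dir_deriv b f x * g x)" for b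
    by (rule ext, rule dir_deriv_eq[THEN trans, OF has_derivative_mult])
      (use Suc.prems in \<open>auto intro!: has_derivative_dir_deriv\<close>)
  have "Ck k f" "Ck k g"
    using Suc.prems Ck_Suc_imp by blast+
  with Suc show ?case by (auto simp: * intro!: Ck_add differentiable_mult)
qed (auto intro: continuous_intros)

lemma Ck_sum: "finite A \<Longrightarrow> (\<And>i. i \<in> A \<Longrightarrow> Ck k (f i)) \<Longrightarrow> Ck k (\<lambda>x. \<Sum>i\<in>A. f i x)"
  by (induction A rule: finite_induct) (auto intro: Ck_const Ck_add)

text \<open>\<open>Ck\<close> speaks only of directions in \<open>Basis\<close>; linearity of the
  derivative extends its information to all directions, as the chain rule requires.\<close>

lemma dir_deriv_basis_sum:
  assumes "f differentiable (at x)"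
  shows "dir_deriv h f x = (\<Sum>b\<in>Basis. (h \<bullet> b) * dir_deriv b f x)"
proof -
  interpret linear "\<lambda>h. dir_deriv h f x"
    using has_derivative_dir_deriv[OF assms] has_derivative_linear by blast
  show ?thesis
    by (subst euclidean_representation[symmetric, of h]) (simp only: sum scaleR real_scaleR_def)
qed

text \<open>A directional derivative of f o L is a linear combination of derivatives of f composed
  with the same L, so the induction varies f and keeps L.\<close>

lemma Ck_compose_linear:
  fixes L :: "'a::euclidean_space \<Rightarrow> 'b::euclidean_space"
  assumes L: "bounded_linear L"
  shows "Ck k f \<Longrightarrow> Ck k (\<lambda>x. f (L x))"
proof (induction k arbitrary: f)
  case 0
  then show ?case
    using continuous_on_compose2[of UNIV f UNIV L] linear_continuous_on[OF L] by simp
next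
  case (Suc k)
  have d: "((\<lambda>x. f (L x)) has_derivative (\<lambda>h. dir_deriv (L h) f (L x))) (at x)" for x
    by (rule has_derivative_compose[OF bounded_linear_imp_has_derivative[OF L]])
      (rule has_derivative_dir_deriv, use Suc.prems in simp)
  have "dir_deriv b (\<lambda>x. f (L x)) = (\<lambda>x. \<Sum>c\<in>Basis. (L b \<bullet> c) * dir_deriv c f (L x))" for b
  proof
    fix x
    have "f differentiable (at (L x))" using Suc.prems by simp
    then show "dir_deriv b (\<lambda>x. f (L x)) x = (\<Sum>c\<in>Basis. (L b \<bullet> c) * dir_deriv c f (L x))"
      by (subst dir_deriv_eq[OF d]) (rule dir_deriv_basis_sum)
  qed
  with Suc d show ?case
    by (auto simp: differentiable_def intro!: Ck_sum Ck_mult Ck_const)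
qed

lemma dir_deriv_compose_real:
  fixes f :: "real \<Rightarrow> real"
  assumes "f differentiable (at (g x))" "g differentiable (at x)"
  shows "dir_deriv b (\<lambda>x. f (g x)) x = dir_deriv 1 f (g x) * dir_deriv b g x"
proof -
  have "((\<lambda>x. f (g x)) has_derivative (\<lambda>h. dir_deriv (dir_deriv h g x) f (g x))) (at x)"
    using assms by (intro has_derivative_compose[of g _ _ _ f]) (auto intro: has_derivative_dir_deriv)
  from dir_deriv_eq[OF this] show ?thesis
    using dir_deriv_basis_sum[OF assms(1), of "dir_deriv b g x"] by simp
qed

lemma Ck_compose_real:
  fixes f :: "real \<Rightarrow> real"
  shows "Ck k f \<Longrightarrow> Ck k g \<Longrightarrow> Ck k (\<lambda>x. f (g x))"
proof (induction k arbitrary: f)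
  case 0
  then show ?case by (auto intro: continuous_on_compose2[of UNIV f UNIV])
next
  case (Suc k)
  have "dir_deriv b (\<lambda>x. f (g x)) = (\<lambda>x. dir_deriv 1 f (g x) * dir_deriv b g x)" for b
    using Suc.prems by (auto intro!: dir_deriv_compose_real)
  moreover have "(\<lambda>x. f (g x)) differentiable (at x)" for x
    using differentiable_chain_at[of g x f] Suc.prems by (auto simp: o_def)
  moreover have "Ck k g"
    using Suc.prems(2) Ck_Suc_imp by blast
  ultimately show ?case
    using Suc by (auto intro!: Ck_mult)
qed

lemma dir_deriv_real:
  assumes "(f has_real_derivative D) (at x)"
  shows "dir_deriv 1 f x = D"
  using dir_deriv_eq[of f "(*) D" x 1] assms by (simp add: has_field_derivative_def)

lemma Ck_Suc_real:
  assumes "\<And>x. (f has_real_derivative f' x) (at x)" "Ck k f'"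
  shows "Ck (Suc k) f"
proof -
  have "dir_deriv 1 f = f'" using assms(1) by (auto intro!: dir_deriv_real)
  moreover have "f differentiable (at x)" for x
    using assms(1) real_differentiable_def by blast
  ultimately show ?thesis using assms(2) by simp
qed

text \<open>The span of cosine and sine is closed under differentiation, so one induction over
  arbitrary coefficients settles both functions.\<close>

lemma Ck_cos_sin: "Ck k (\<lambda>x::real. c * cos x + d * sin x)"
proof (induction k arbitrary: c d)
  case (Suc k)
  show ?case
    by (rule Ck_Suc_real[OF _ Suc[of d "- c"]]) (auto intro!: derivative_eq_intros)
qed (auto intro!: continuous_intros)

lemma Ck_cos: "Ck k (cos :: real \<Rightarrow> real)" and Ck_sin: "Ck k (sin :: real \<Rightarrow> real)"
  using Ck_cos_sin[of k 1 0] Ck_cos_sin[of k 0 1] by simp_all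

lemma Ck_ident: "Ck k (\<lambda>x::real. x)"
proof (cases k)
  case (Suc j)
  show ?thesis
    unfolding Suc by (rule Ck_Suc_real[of _ "\<lambda>_. 1"]) (auto intro: Ck_const)
qed simp

lemma Ck_linear:
  fixes L :: "'a::euclidean_space \<Rightarrow> real"
  shows "bounded_linear L \<Longrightarrow> Ck k L"
  using Ck_compose_linear[OF _ Ck_ident] .

text \<open>The class of all $p(1/x) e^{-1/x}$, extended by zero, is closed under differentiation.\<close>

definition exp_bump :: "real poly \<Rightarrow> real \<Rightarrow> real" where
  "exp_bump p x = (if x > 0 then poly p (1 / x) * exp (- (1 / x)) else 0)"

lemma poly_exp_tendsto_0: "((\<lambda>x::real. poly p x * exp (- x)) \<longlongrightarrow> 0) at_top"
proof (induction p)
  case 0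
  then show ?case by simp
next
  case (pCons a p)
  have "((\<lambda>x::real. x ^ k / exp x) \<longlongrightarrow> 0) at_top" for k
    by (rule tendsto_power_div_exp_0)
  have *: "((\<lambda>x::real. x ^ k * exp (- x)) \<longlongrightarrow> 0) at_top" for k
    using tendsto_power_div_exp_0[of k] by (simp add: exp_minus divide_inverse)
  have "((\<lambda>x::real. \<Sum>i\<le>degree (pCons a p). coeff (pCons a p) i * (x ^ i * exp (- x))) \<longlongrightarrow> (\<Sum>i\<le>degree (pCons a p). coeff (pCons a p) i * 0)) at_top"
    by (intro tendsto_sum tendsto_mult tendsto_const *)
  then show ?case
    by (simp add: poly_altdef sum_distrib_right mult.assoc del: coeff_pCons_Suc coeff_pCons)
qed

lemma exp_bump_tendsto_0: "((\<lambda>x. poly p (1 / x) * exp (- (1 / x))) \<longlongrightarrow> 0) (at_right (0::real))"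
proof -
  have "filterlim (\<lambda>x::real. 1 / x) at_top (at_right 0)"
    using filterlim_inverse_at_top_right by (simp add: inverse_eq_divide)
  from filterlim_compose[OF poly_exp_tendsto_0 this] show ?thesis .
qed

text \<open>The chain rule turns p(1/x) e^{-1/x} into x^{-2} (p - p')(1/x) e^{-1/x}; the monomial
  \<open>[:0, 0, 1:]\<close> is the factor x^{-2} as a polynomial in 1/x. At 0 both one-sided
  derivatives vanish.\<close>

lemma exp_bump_deriv:
  "(exp_bump p has_real_derivative exp_bump ([:0, 0, 1:] * (p - pderiv p)) x) (at x)"
proof -
  consider "x > 0" | "x < 0" | "x = 0" by linarith
  then show ?thesis
  proof cases
    case 1
    have "((\<lambda>x. poly p (1 / x) * exp (- (1 / x))) has_real_derivative
        exp_bump ([:0, 0, 1:] * (p - pderiv p)) x) (at x)"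
      using 1 by (auto intro!: derivative_eq_intros DERIV_chain'[of "\<lambda>x. 1 / x" _ _ _ "poly p"] poly_DERIV
          simp: exp_bump_def power2_eq_square field_simps)
    then show ?thesis
      by (rule has_field_derivative_transform_within_open[of _ _ _ "{0<..}"]) (use 1 in \<open>auto simp: exp_bump_def\<close>)
  next
    case 2
    have "((\<lambda>x. 0) has_real_derivative exp_bump ([:0, 0, 1:] * (p - pderiv p)) x) (at x)"
      using 2 by (simp add: exp_bump_def)
    then show ?thesis
      by (rule has_field_derivative_transform_within_open[of _ _ _ "{..<0}"]) (use 2 in \<open>auto simp: exp_bump_def\<close>)
  next
    case 3
    \<comment> \<open>From the right, the difference quotient is again of the form q(1/x) e^{-1/x}:
      the extra factor 1/x is moved into the polynomial.\<close>
    have "((\<lambda>x. (exp_bump p x - exp_bump p 0) / (x - 0)) \<longlongrightarrow> 0) (at_right 0)"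
      using exp_bump_tendsto_0[of "[:0, 1:] * p"]
      by (rule Lim_transform_eventually) (auto simp: exp_bump_def eventually_at_filter)
    moreover have "((\<lambda>x. (exp_bump p x - exp_bump p 0) / (x - 0)) \<longlongrightarrow> 0) (at_left 0)"
      by (rule tendsto_eventually) (auto simp: exp_bump_def eventually_at_filter)
    ultimately show ?thesis
      unfolding has_field_derivative_iff 3 by (simp add: filterlim_split_at exp_bump_def)
  qed
qed

lemma Ck_exp_bump: "Ck k (exp_bump p)"
proof (induction k arbitrary: p)
  case 0
  show ?case
    using exp_bump_deriv[THEN DERIV_isCont] by (simp add: continuous_on_eq_continuous_at del: mult_pCons_left)
next
  case (Suc k)
  show ?case by (rule Ck_Suc_real[OF exp_bump_deriv Suc])
qed

section \<open>The Laplacian and operations on test functions\<close>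

definition lap :: "('a::euclidean_space \<Rightarrow> real) \<Rightarrow> 'a \<Rightarrow> real" where
  "lap \<psi> x = (\<Sum>b\<in>Basis. dir_deriv b (dir_deriv b \<psi>) x)"

lemma test_functionsD:
  assumes "\<phi> \<in> test_functions \<Omega>"
  shows "Ck k \<phi>" "compact (closure {x. \<phi> x \<noteq> 0})" "closure {x. \<phi> x \<noteq> 0} \<subseteq> \<Omega>"
  using assms by (auto simp: test_functions_def)

lemma support_0: "x \<notin> closure {x. f x \<noteq> 0} \<Longrightarrow> f x = 0"
  by (metis (mono_tags, lifting) closure_subset mem_Collect_eq subsetD)

lemma test_functionsI:
  assumes "\<And>k. Ck k \<phi>" "compact K" "K \<subseteq> \<Omega>" "\<And>x. x \<notin> K \<Longrightarrow> \<phi> x = 0"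
  shows "\<phi> \<in> test_functions \<Omega>"
proof -
  have "closure {x. \<phi> x \<noteq> 0} \<subseteq> K"
    using assms by (intro closure_minimal compact_imp_closed) auto
  then show ?thesis
    using assms(1,3) compact_Int_closed[OF assms(2) closed_closure, of "{x. \<phi> x \<noteq> 0}"]
    unfolding test_functions_def by (auto simp: Int_absorb1)
qed

lemma Ck_all_dir_deriv:
  assumes "\<And>k. Ck k f"
  shows "Ck k (dir_deriv b f)"
proof -
  have d: "f differentiable (at x)" for x using assms[of "Suc 0"] by simp
  have "dir_deriv b f = (\<lambda>x. \<Sum>c\<in>Basis. (b \<bullet> c) * dir_deriv c f x)"
    by (rule ext) (rule dir_deriv_basis_sum[OF d])
  then show ?thesis using assms[of "Suc k"] by (auto intro!: Ck_sum Ck_mult Ck_const)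
qed

lemma dir_deriv_eq_0:
  assumes "open U" "x \<in> U" "\<And>y. y \<in> U \<Longrightarrow> f y = 0"
  shows "dir_deriv b f x = 0"
  by (rule dir_deriv_eq[where f' = "\<lambda>_. 0"],
      rule has_derivative_transform_within_open[OF has_derivative_const[of 0] assms(1,2)])
    (simp add: assms(3))

lemma test_functions_dir_deriv:
  assumes \<phi>: "\<phi> \<in> test_functions \<Omega>"
  shows "dir_deriv b \<phi> \<in> test_functions \<Omega>"
proof (rule test_functionsI[OF _ test_functionsD(2,3)[OF \<phi>]])
  show "Ck k (dir_deriv b \<phi>)" for k
    by (intro Ck_all_dir_deriv test_functionsD(1)[OF \<phi>])
  show "dir_deriv b \<phi> x = 0" if "x \<notin> closure {x. \<phi> x \<noteq> 0}" for x
    by (rule dir_deriv_eq_0[of "- closure {x. \<phi> x \<noteq> 0}"])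
      (use that support_0 in auto)
qed

lemma test_functions_add:
  assumes "\<phi> \<in> test_functions \<Omega>" "\<psi> \<in> test_functions \<Omega>"
  shows "(\<lambda>x. \<phi> x + \<psi> x) \<in> test_functions \<Omega>"
proof (rule test_functionsI[of _ "closure {x. \<phi> x \<noteq> 0} \<union> closure {x. \<psi> x \<noteq> 0}"])
  show "compact (closure {x. \<phi> x \<noteq> 0} \<union> closure {x. \<psi> x \<noteq> 0})"
    using assms[THEN test_functionsD(2)] by (rule compact_Un)
  show "\<phi> x + \<psi> x = 0" if "x \<notin> closure {x. \<phi> x \<noteq> 0} \<union> closure {x. \<psi> x \<noteq> 0}" for x
    using that support_0[of x \<phi>] support_0[of x \<psi>] by auto
  show "Ck k (\<lambda>x. \<phi> x + \<psi> x)" for k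
    by (intro Ck_add test_functionsD(1)[OF assms(1)] test_functionsD(1)[OF assms(2)])
qed (use assms in \<open>auto simp: test_functions_def\<close>)

lemma test_functions_lap:
  assumes \<phi>: "\<phi> \<in> test_functions \<Omega>"
  shows "lap \<phi> \<in> test_functions \<Omega>"
proof -
  have [simp]: "(\<lambda>x. 0) \<in> test_functions \<Omega>"
    by (auto simp: test_functions_def intro: Ck_const)
  have "(\<lambda>x. \<Sum>b\<in>B. dir_deriv b (dir_deriv b \<phi>) x) \<in> test_functions \<Omega>" if "finite B" for B
    using that by induction (auto intro!: test_functions_add test_functions_dir_deriv \<phi>)
  then show ?thesis
    unfolding lap_def by simp
qed

lemma test_functions_product:
  fixes \<theta> :: "real \<Rightarrow> real" and \<psi> :: "'a::euclidean_space \<Rightarrow> real"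
  assumes \<theta>: "\<theta> \<in> test_functions {0<..}" and \<psi>: "\<psi> \<in> test_functions UNIV"
  shows "(\<lambda>z. \<theta> (fst z) * \<psi> (snd z)) \<in> test_functions ({0<..} \<times> UNIV)"
proof (rule test_functionsI[of _ "closure {x. \<theta> x \<noteq> 0} \<times> closure {x. \<psi> x \<noteq> 0}"])
  show "Ck k (\<lambda>z. \<theta> (fst z) * \<psi> (snd z))" for k
    by (intro Ck_mult Ck_compose_linear[OF bounded_linear_fst] Ck_compose_linear[OF bounded_linear_snd]
        test_functionsD(1)[OF \<theta>] test_functionsD(1)[OF \<psi>])
  show "compact (closure {x. \<theta> x \<noteq> 0} \<times> closure {x. \<psi> x \<noteq> 0})"
    by (intro compact_Times test_functionsD(2)[OF \<theta>] test_functionsD(2)[OF \<psi>])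
  show "(\<theta> (fst z) * \<psi> (snd z)) = 0" if "z \<notin> closure {x. \<theta> x \<noteq> 0} \<times> closure {x. \<psi> x \<noteq> 0}" for z
    using that support_0[of "fst z" \<theta>] support_0[of "snd z" \<psi>] by (cases z) auto
qed (use \<theta> in \<open>auto simp: test_functions_def\<close>)

lemma dir_deriv_product:
  assumes \<theta>: "\<And>t. \<theta> differentiable (at t)" and \<psi>: "\<And>x. \<psi> differentiable (at x)"
  shows "dir_deriv (h, k) (\<lambda>z. \<theta> (fst z) * \<psi> (snd z)) =
    (\<lambda>z. \<theta> (fst z) * dir_deriv k \<psi> (snd z) + dir_deriv h \<theta> (fst z) * \<psi> (snd z))"
proof
  fix z :: "'a \<times> 'b"
  have "((\<lambda>z. \<theta> (fst z)) has_derivative (\<lambda>h. dir_deriv (fst h) \<theta> (fst z))) (at z)"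
    by (intro has_derivative_compose[OF has_derivative_fst[OF has_derivative_ident]]
        has_derivative_dir_deriv \<theta>)
  moreover have "((\<lambda>z. \<psi> (snd z)) has_derivative (\<lambda>h. dir_deriv (snd h) \<psi> (snd z))) (at z)"
    by (intro has_derivative_compose[OF has_derivative_snd[OF has_derivative_ident]]
        has_derivative_dir_deriv \<psi>)
  ultimately have "((\<lambda>z. \<theta> (fst z) * \<psi> (snd z)) has_derivative
      (\<lambda>h. \<theta> (fst z) * dir_deriv (snd h) \<psi> (snd z) + dir_deriv (fst h) \<theta> (fst z) * \<psi> (snd z))) (at z)"
    by (rule has_derivative_mult)
  from dir_deriv_eq[OF this] show "dir_deriv (h, k) (\<lambda>z. \<theta> (fst z) * \<psi> (snd z)) z =
    \<theta> (fst z) * dir_deriv k \<psi> (snd z) + dir_deriv h \<theta> (fst z) * \<psi> (snd z)"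
    by simp
qed

lemma dir_deriv_0:
  assumes "f differentiable (at x)"
  shows "dir_deriv 0 f x = 0"
  using has_derivative_linear[OF has_derivative_dir_deriv[OF assms]] linear_0 by blast

text \<open>On a product \<theta>(t) \<psi>(x) the operator of
  \<open>distributional_solution\<close> separates, so the spatial integral reduces to pairings of
  u(t) with \<psi> and \<open>lap \<psi>\<close>.\<close>

lemma
  assumes \<theta>: "\<And>k. Ck k \<theta>" and \<psi>: "\<And>k. Ck k \<psi>"
  shows dt_product: "dt (\<lambda>z. \<theta> (fst z) * \<psi> (snd z)) = (\<lambda>z. dir_deriv 1 \<theta> (fst z) * \<psi> (snd z))"
    and laplacian_product: "laplacian (\<lambda>z. \<theta> (fst z) * \<psi> (snd z)) = (\<lambda>z. \<theta> (fst z) * lap \<psi> (snd z))"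
proof -
  have d: "f differentiable (at x)" if "\<And>k. Ck k f" for f :: "'c::euclidean_space \<Rightarrow> real" and x
    using that[of "Suc 0"] by simp
  show "dt (\<lambda>z. \<theta> (fst z) * \<psi> (snd z)) = (\<lambda>z. dir_deriv 1 \<theta> (fst z) * \<psi> (snd z))"
    unfolding dt_def by (simp add: dir_deriv_product d \<theta> \<psi> dir_deriv_0)
  have "dir_deriv (0, b) (\<lambda>z. \<theta> (fst z) * \<psi> (snd z)) = (\<lambda>z. \<theta> (fst z) * dir_deriv b \<psi> (snd z))"
    if "\<And>k. Ck k \<psi>" for b \<psi>
    by (simp add: dir_deriv_product d \<theta> that dir_deriv_0)
  from this[OF Ck_all_dir_deriv[OF \<psi>]] this[OF \<psi>]
  show "laplacian (\<lambda>z. \<theta> (fst z) * \<psi> (snd z)) = (\<lambda>z. \<theta> (fst z) * lap \<psi> (snd z))"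
    by (auto simp: laplacian_def lap_def sum_distrib_left)
qed

lemma test_functions_mult:
  assumes \<phi>: "\<phi> \<in> test_functions \<Omega>" and f: "\<And>k. Ck k f"
  shows "(\<lambda>x. \<phi> x * f x) \<in> test_functions \<Omega>"
proof (rule test_functionsI[OF _ test_functionsD(2,3)[OF \<phi>]])
  show "Ck k (\<lambda>x. \<phi> x * f x)" for k
    by (intro Ck_mult test_functionsD(1)[OF \<phi>] f)
  show "\<phi> x * f x = 0" if "x \<notin> closure {x. \<phi> x \<noteq> 0}" for x
    using that support_0[of x \<phi>] by auto
qed

text \<open>A single K bounds the values and the radius of the support, the form in which
  \<open>L2_continuous_bounded_support\<close> uses it.\<close>

lemma test_functions_bounded:
  assumes \<phi>: "\<phi> \<in> test_functions \<Omega>"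
  shows "\<exists>K>0. \<forall>x. \<bar>\<phi> x\<bar> \<le> K \<and> (\<phi> x \<noteq> 0 \<longrightarrow> norm x \<le> K)"
proof -
  let ?S = "closure {x. \<phi> x \<noteq> 0}"
  have "bounded (\<phi> ` ?S)"
    using test_functionsD(2)[OF \<phi>] continuous_on_subset[OF Ck_continuous[OF test_functionsD(1)[OF \<phi>]]]
    by (intro compact_imp_bounded compact_continuous_image) auto
  then obtain K1 where K1: "K1 > 0" "\<And>x. x \<in> ?S \<Longrightarrow> \<bar>\<phi> x\<bar> \<le> K1"
    by (auto simp: bounded_pos)
  obtain K2 where K2: "K2 > 0" "\<And>x. x \<in> ?S \<Longrightarrow> norm x \<le> K2"
    using compact_imp_bounded[OF test_functionsD(2)[OF \<phi>]] unfolding bounded_pos by blast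
  have "x \<in> ?S" if "\<phi> x \<noteq> 0" for x
    using that support_0[of x \<phi>] by auto
  with K1 K2 have "\<bar>\<phi> x\<bar> \<le> max K1 K2" "\<phi> x \<noteq> 0 \<Longrightarrow> norm x \<le> max K1 K2" for x
    by (cases "\<phi> x = 0"; force simp: max_def)+
  then show ?thesis using K1(1) by (intro exI[of _ "max K1 K2"]) auto
qed

section \<open>Cutoffs, scaling and trigonometric factors\<close>

lemma cutoff_exists:
  "\<exists>\<eta> :: 'a::euclidean_space \<Rightarrow> real. \<eta> \<in> test_functions UNIV \<and> (\<forall>x. 0 \<le> \<eta> x \<and> \<eta> x \<le> 1) \<and> \<eta> 0 = 1 \<and>
    (\<forall>x. norm x \<ge> 1 \<longrightarrow> \<eta> x = 0)"
proof -
  \<comment> \<open>The factor e normalises \<eta>(0) = 1. Writing 1 - |x|^2 through products of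
    coordinates brings it within the closure rules for \<open>Ck\<close>.\<close>
  define \<eta> :: "'a \<Rightarrow> real" where "\<eta> x = exp 1 * exp_bump 1 (1 + - 1 * (\<Sum>b\<in>Basis. (x \<bullet> b) * (x \<bullet> b)))" for x
  have eq: "\<eta> x = exp 1 * exp_bump 1 (1 - (norm x)\<^sup>2)" for x
    unfolding \<eta>_def by (subst power2_norm_eq_inner) (subst euclidean_inner, simp)
  have Ck: "Ck k \<eta>" for k
    unfolding \<eta>_def
    by (intro Ck_mult Ck_const Ck_compose_real[OF Ck_exp_bump] Ck_add Ck_sum Ck_linear finite_Basis
        bounded_linear_inner_left)
  have 0: "\<eta> x = 0" if "norm x \<ge> 1" for x
    using that by (auto simp: eq exp_bump_def abs_square_less_1 not_less)
  have 1: "0 \<le> \<eta> x" "\<eta> x \<le> 1" for x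
  proof -
    show "0 \<le> \<eta> x" by (auto simp: eq exp_bump_def)
    have "1 \<le> 1 / (1 - (norm x)\<^sup>2)" if "(norm x)\<^sup>2 < 1" using that by (simp add: field_simps)
    then have "exp (1 - 1 / (1 - (norm x)\<^sup>2)) \<le> 1" if "(norm x)\<^sup>2 < 1" using that by simp
    then show "\<eta> x \<le> 1" by (auto simp: eq exp_bump_def exp_diff exp_minus field_simps)
  qed
  have "\<eta> \<in> test_functions UNIV"
    by (rule test_functionsI[of _ "cball 0 1"]) (auto simp: Ck 0)
  moreover have "\<eta> 0 = 1" by (simp add: eq exp_bump_def exp_minus)
  ultimately show ?thesis using 0 1 by blast
qed

text \<open>Each derivative that falls on a function of x / R gains a factor 1 / R; the smallness of
  the commutator stems from this.\<close>

lemma dir_deriv_scaled: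
  assumes "\<And>x. f differentiable (at x)"
  shows "dir_deriv b (\<lambda>x. f (x /\<^sub>R R)) = (\<lambda>x. dir_deriv b f (x /\<^sub>R R) / R)"
proof
  fix x
  have "bounded_linear (\<lambda>x::'a. x /\<^sub>R R)" by (rule bounded_linear_scaleR_right)
  then have "((\<lambda>x. f (x /\<^sub>R R)) has_derivative (\<lambda>h. dir_deriv (h /\<^sub>R R) f (x /\<^sub>R R))) (at x)"
    by (rule has_derivative_compose[where f = "\<lambda>x. x /\<^sub>R R" and g = f,
          OF bounded_linear_imp_has_derivative has_derivative_dir_deriv[OF assms]])
  then have "dir_deriv b (\<lambda>x. f (x /\<^sub>R R)) x = dir_deriv (b /\<^sub>R R) f (x /\<^sub>R R)"
    by (rule dir_deriv_eq)
  also have "\<dots> = dir_deriv b f (x /\<^sub>R R) /\<^sub>R R"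
    using has_derivative_linear[OF has_derivative_dir_deriv[OF assms]] linear_scale by blast
  finally show "dir_deriv b (\<lambda>x. f (x /\<^sub>R R)) x = dir_deriv b f (x /\<^sub>R R) / R"
    by (simp add: divide_inverse mult.commute)
qed

lemma test_functions_scaled:
  assumes \<phi>: "\<phi> \<in> test_functions UNIV" and R: "R > 0"
  shows "(\<lambda>x. \<phi> (x /\<^sub>R R)) \<in> test_functions UNIV"
proof -
  obtain K where K: "\<And>x. \<phi> x \<noteq> 0 \<Longrightarrow> norm x \<le> K"
    using test_functions_bounded[OF \<phi>] by blast
  show ?thesis
  proof (rule test_functionsI[of _ "cball 0 (R * K)"])
    show "Ck k (\<lambda>x. \<phi> (x /\<^sub>R R))" for k
      by (intro Ck_compose_linear[OF bounded_linear_scaleR_right] test_functionsD(1)[OF \<phi>])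
    show "\<phi> (x /\<^sub>R R) = 0" if "x \<notin> cball 0 (R * K)" for x
    proof (rule ccontr)
      assume "\<phi> (x /\<^sub>R R) \<noteq> 0"
      from K[OF this] that R show False by (simp add: field_simps)
    qed
  qed auto
qed

lemma lap_scaled:
  assumes "\<And>k. Ck k f"
  shows "lap (\<lambda>x. f (x /\<^sub>R R)) = (\<lambda>x. lap f (x /\<^sub>R R) / R\<^sup>2)"
proof -
  have d: "g differentiable (at x)" if "\<And>k. Ck k g" for g :: "'a \<Rightarrow> real" and x
    using that[of "Suc 0"] by simp
  have "dir_deriv b (\<lambda>x. dir_deriv b f (x /\<^sub>R R) / R) x = dir_deriv b (dir_deriv b f) (x /\<^sub>R R) / R / R" for b x
  proof -
    have "(\<lambda>x. dir_deriv b f (x /\<^sub>R R)) differentiable (at x)"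
      by (rule d) (intro Ck_compose_linear[OF bounded_linear_scaleR_right] Ck_all_dir_deriv assms)
    from has_derivative_mult_right[OF has_derivative_dir_deriv[OF this], of "1 / R"]
    have "((\<lambda>x. dir_deriv b f (x /\<^sub>R R) / R) has_derivative
        (\<lambda>h. dir_deriv h (\<lambda>x. dir_deriv b f (x /\<^sub>R R)) x / R)) (at x)"
      by simp
    from dir_deriv_eq[OF this] show ?thesis
      by (simp add: dir_deriv_scaled[OF d[OF Ck_all_dir_deriv[OF assms]]])
  qed
  then show ?thesis
    by (auto simp: lap_def dir_deriv_scaled d assms sum_divide_distrib power2_eq_square)
qed

lemma dir_deriv_mult:
  assumes "f differentiable (at x)" "g differentiable (at x)"
  shows "dir_deriv b (\<lambda>x. f x * g x) x = f x * dir_deriv b g x + dir_deriv b f x * g x"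
  by (rule dir_deriv_eq[OF has_derivative_mult]) (intro has_derivative_dir_deriv assms)+

lemma lap_mult:
  assumes f: "\<And>k. Ck k f" and g: "\<And>k. Ck k g"
  shows "lap (\<lambda>x. f x * g x) x =
    f x * lap g x + 2 * (\<Sum>b\<in>Basis. dir_deriv b f x * dir_deriv b g x) + lap f x * g x"
proof -
  have d: "g differentiable (at x)" if "\<And>k. Ck k g" for g :: "'a \<Rightarrow> real" and x
    using that[of "Suc 0"] by simp
  note ds = d[OF f] d[OF g] d[OF Ck_all_dir_deriv, OF f] d[OF Ck_all_dir_deriv, OF g]
  have "dir_deriv b (dir_deriv b (\<lambda>x. f x * g x)) x =
      f x * dir_deriv b (dir_deriv b g) x + 2 * (dir_deriv b f x * dir_deriv b g x)
        + dir_deriv b (dir_deriv b f) x * g x" for b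
  proof -
    have "dir_deriv b (\<lambda>x. f x * g x) = (\<lambda>x. f x * dir_deriv b g x + dir_deriv b f x * g x)"
      by (auto intro!: dir_deriv_mult ds)
    moreover have "dir_deriv b (\<lambda>x. f x * dir_deriv b g x + dir_deriv b f x * g x) x =
        (f x * dir_deriv b (dir_deriv b g) x + dir_deriv b f x * dir_deriv b g x) +
        (dir_deriv b f x * dir_deriv b g x + dir_deriv b (dir_deriv b f) x * g x)"
      by (rule dir_deriv_eq[OF has_derivative_add[OF has_derivative_mult has_derivative_mult]])
        (intro has_derivative_dir_deriv ds)+
    ultimately show ?thesis by simp
  qed
  then show ?thesis
    by (simp add: lap_def sum.distrib sum_distrib_left sum_distrib_right)
qed

lemma dir_deriv_trig:
  "dir_deriv b (\<lambda>x. cos (x \<bullet> \<xi>)) = (\<lambda>x. - (b \<bullet> \<xi>) * sin (x \<bullet> \<xi>))"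
  "dir_deriv b (\<lambda>x. sin (x \<bullet> \<xi>)) = (\<lambda>x. (b \<bullet> \<xi>) * cos (x \<bullet> \<xi>))"
  by (rule ext, rule dir_deriv_eq[THEN trans], (rule derivative_intros | simp)+)+

lemma Ck_trig: "Ck k (\<lambda>x. cos (x \<bullet> \<xi>))" "Ck k (\<lambda>x. sin (x \<bullet> \<xi>))"
  by (intro Ck_compose_real[OF Ck_cos] Ck_compose_real[OF Ck_sin] Ck_linear bounded_linear_inner_left)+

lemma lap_trig:
  "lap (\<lambda>x. cos (x \<bullet> \<xi>)) x = - (norm \<xi>)\<^sup>2 * cos (x \<bullet> \<xi>)"
  "lap (\<lambda>x. sin (x \<bullet> \<xi>)) x = - (norm \<xi>)\<^sup>2 * sin (x \<bullet> \<xi>)"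
proof -
  have d: "g differentiable (at x)" if "Ck (Suc 0) g" for g :: "'a \<Rightarrow> real" and x
    using that by simp
  have c: "dir_deriv b (\<lambda>x. c * g x) x = c * dir_deriv b g x" if "Ck (Suc 0) g" for b c x and g :: "'a \<Rightarrow> real"
    by (rule dir_deriv_eq) (intro has_derivative_mult_right has_derivative_dir_deriv d that)
  have n: "(norm \<xi>)\<^sup>2 = (\<Sum>b\<in>Basis. (b \<bullet> \<xi>) * (b \<bullet> \<xi>))"
    by (subst power2_norm_eq_inner, subst euclidean_inner) (simp add: inner_commute)
  show "lap (\<lambda>x. cos (x \<bullet> \<xi>)) x = - (norm \<xi>)\<^sup>2 * cos (x \<bullet> \<xi>)"
    "lap (\<lambda>x. sin (x \<bullet> \<xi>)) x = - (norm \<xi>)\<^sup>2 * sin (x \<bullet> \<xi>)"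
    unfolding lap_def dir_deriv_trig n
    by (simp_all only: c[OF Ck_trig(1)] c[OF Ck_trig(2)] dir_deriv_trig)
      (simp_all add: sum_distrib_right sum_negf mult.assoc)
qed

section \<open>Plancherel's theorem\<close>

lemma norm_add_power2_le: "(norm (a + b :: complex))\<^sup>2 \<le> 2 * (norm a)\<^sup>2 + 2 * (norm b)\<^sup>2"
proof -
  have "(norm (a + b))\<^sup>2 \<le> (norm a + norm b)\<^sup>2"
    by (intro power_mono norm_triangle_ineq norm_ge_zero)
  also have "\<dots> \<le> 2 * (norm a)\<^sup>2 + 2 * (norm b)\<^sup>2"
    using zero_le_power2[of "norm a - norm b"] by (simp add: power2_sum power2_diff)
  finally show ?thesis .
qed

lemma continuous_borel_measurable_lebesgue:
  "continuous_on UNIV f \<Longrightarrow> f \<in> borel_measurable lebesgue"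
  by (intro measurable_completion) (simp add: borel_measurable_continuous_onI)

lemma L2D: "f \<in> L2 \<Longrightarrow> f \<in> borel_measurable lebesgue"
  "f \<in> L2 \<Longrightarrow> integrable lebesgue (\<lambda>x. (norm (f x))\<^sup>2)"
  by (auto simp: L2_def)

lemma L2_dominated:
  assumes "f \<in> borel_measurable lebesgue" "g \<in> L2" "\<And>x. norm (f x) \<le> C * norm (g x)"
  shows "f \<in> L2"
proof -
  have "integrable lebesgue (\<lambda>x. (norm (f x))\<^sup>2)"
  proof (rule Bochner_Integration.integrable_bound)
    show "integrable lebesgue (\<lambda>x. C\<^sup>2 * (norm (g x))\<^sup>2)"
      using L2D(2)[OF assms(2)] by simp
    have "(norm (f x))\<^sup>2 \<le> C\<^sup>2 * (norm (g x))\<^sup>2" for x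
      using power_mono[OF assms(3) norm_ge_zero, of x 2] by (simp add: power_mult_distrib)
    then show "AE x in lebesgue. norm ((norm (f x))\<^sup>2) \<le> norm (C\<^sup>2 * (norm (g x))\<^sup>2)"
      by simp
    show "(\<lambda>x. (norm (f x))\<^sup>2) \<in> borel_measurable lebesgue"
      using assms(1) by measurable
  qed
  then show ?thesis using assms(1) by (simp add: L2_def)
qed

lemma L2_scale: "f \<in> L2 \<Longrightarrow> (\<lambda>x. c * f x) \<in> L2"
  by (rule L2_dominated[of _ f "norm c"]) (auto simp: norm_mult dest: L2D(1))

lemma L2_add:
  assumes f: "f \<in> L2" and g: "g \<in> L2"
  shows "(\<lambda>x. f x + g x) \<in> L2"
proof -
  note [measurable] = L2D(1)[OF f] L2D(1)[OF g]
  have "integrable lebesgue (\<lambda>x. (norm (f x + g x))\<^sup>2)"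
  proof (rule Bochner_Integration.integrable_bound)
    show "integrable lebesgue (\<lambda>x. 2 * (norm (f x))\<^sup>2 + 2 * (norm (g x))\<^sup>2)"
      using L2D(2)[OF f] L2D(2)[OF g] by simp
    show "AE x in lebesgue. norm ((norm (f x + g x))\<^sup>2) \<le> norm (2 * (norm (f x))\<^sup>2 + 2 * (norm (g x))\<^sup>2)"
      using norm_add_power2_le by auto
  qed measurable
  then show ?thesis by (simp add: L2_def)
qed

lemma L2_diff: "f \<in> L2 \<Longrightarrow> g \<in> L2 \<Longrightarrow> (\<lambda>x. f x - g x) \<in> L2"
  using L2_add[OF _ L2_scale[of g "-1"], of f] by simp

lemma L2_norm_nonneg [simp]: "0 \<le> L2_norm f"
  by (simp add: L2_norm_def)

lemma L2_norm_power2: "(L2_norm f)\<^sup>2 = (LINT x|lebesgue. (norm (f x))\<^sup>2)"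
  by (simp add: L2_norm_def)

lemma L2_mult_integrable:
  assumes f: "f \<in> L2" and g: "g \<in> L2"
  shows "integrable lebesgue (\<lambda>x. f x * g x)"
proof (rule Bochner_Integration.integrable_bound)
  show "(\<lambda>x. f x * g x) \<in> borel_measurable lebesgue"
    using L2D(1)[OF f] L2D(1)[OF g] by measurable
  show "integrable lebesgue (\<lambda>x. (norm (f x))\<^sup>2 + (norm (g x))\<^sup>2)"
    using L2D(2)[OF f] L2D(2)[OF g] by simp
  show "AE x in lebesgue. norm (f x * g x) \<le> norm ((norm (f x))\<^sup>2 + (norm (g x))\<^sup>2)"
  proof (rule AE_I2)
    fix x
    have "2 * (norm (f x) * norm (g x)) \<le> (norm (f x))\<^sup>2 + (norm (g x))\<^sup>2"
      using zero_le_power2[of "norm (f x) - norm (g x)"] by (simp add: power2_diff)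
    moreover have "0 \<le> norm (f x) * norm (g x)" by simp
    ultimately show "norm (f x * g x) \<le> norm ((norm (f x))\<^sup>2 + (norm (g x))\<^sup>2)"
      unfolding norm_mult real_norm_def by linarith
  qed
qed

lemma L2_Cauchy_Schwarz:
  assumes f: "f \<in> L2" and g: "g \<in> L2"
  shows "norm (LINT x|lebesgue. f x * g x) \<le> L2_norm f * L2_norm g"
proof -
  define A B I where "A = (LINT x|lebesgue. (norm (f x))\<^sup>2)" and "B = (LINT x|lebesgue. (norm (g x))\<^sup>2)"
    and "I = (LINT x|lebesgue. norm (f x) * norm (g x))"
  have i: "integrable lebesgue (\<lambda>x. norm (f x) * norm (g x))"
    using integrable_norm[OF L2_mult_integrable[OF f g]] by (simp add: norm_mult)
  \<comment> \<open>The classical quadratic in r. For A > 0 its minimum at r = I / A gives the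
    claim; for A = 0 it is affine and would equal -1 at r = (B + 1) / (2 I) unless I = 0.\<close>
  have q: "0 \<le> r\<^sup>2 * A - 2 * r * I + B" for r
  proof -
    have "0 \<le> (LINT x|lebesgue. (r * norm (f x) - norm (g x))\<^sup>2)" by simp
    also have "\<dots> = (LINT x|lebesgue. r\<^sup>2 * (norm (f x))\<^sup>2 - (2 * r) * (norm (f x) * norm (g x)) + (norm (g x))\<^sup>2)"
      by (intro Bochner_Integration.integral_cong) (auto simp: power2_diff power_mult_distrib)
    also have "\<dots> = r\<^sup>2 * A - 2 * r * I + B"
      using i L2D(2)[OF f] L2D(2)[OF g] by (simp add: A_def B_def I_def)
    finally show ?thesis .
  qed
  have "I\<^sup>2 \<le> A * B"
  proof (cases "A = 0")
    case True
    have "I = 0"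
    proof (rule ccontr)
      assume "I \<noteq> 0"
      then show False using q[of "(B + 1) / (2 * I)"] True by (simp add: field_simps)
    qed
    then show ?thesis using True by simp
  next
    case False
    then have "A > 0" by (simp add: A_def order_less_le)
    then show ?thesis using q[of "I / A"] by (simp add: field_simps power2_eq_square)
  qed
  then have "I \<le> sqrt (A * B)" by (rule real_le_rsqrt)
  moreover have "norm (LINT x|lebesgue. f x * g x) \<le> I"
    using integral_norm_bound[of lebesgue "\<lambda>x. f x * g x"] by (simp add: I_def norm_mult)
  ultimately show ?thesis by (simp add: A_def B_def L2_norm_def real_sqrt_mult)
qed

lemma L2_norm_triangle:
  assumes f: "f \<in> L2" and g: "g \<in> L2"
  shows "L2_norm (\<lambda>x. f x + g x) \<le> L2_norm f + L2_norm g"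
proof (rule power2_le_imp_le)
  let ?c = "\<lambda>x. cnj (g x)"
  have "?c \<in> borel_measurable lebesgue"
    by (rule measurable_compose[OF L2D(1)[OF g]]) (intro borel_measurable_continuous_onI continuous_intros)
  then have c: "?c \<in> L2" using L2D(2)[OF g] by (simp add: L2_def)
  have nc: "L2_norm ?c = L2_norm g" by (simp add: L2_norm_def)
  have "(L2_norm (\<lambda>x. f x + g x))\<^sup>2 =
      (LINT x|lebesgue. (norm (f x))\<^sup>2 + (norm (g x))\<^sup>2 + 2 * Re (f x * ?c x))"
    unfolding L2_norm_power2
    by (intro Bochner_Integration.integral_cong)
      (auto simp: cmod_power2 power2_sum algebra_simps)
  also have "\<dots> = (L2_norm f)\<^sup>2 + (L2_norm g)\<^sup>2 + 2 * Re (LINT x|lebesgue. f x * ?c x)"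
    using L2D(2)[OF f] L2D(2)[OF g] integrable_Re[OF L2_mult_integrable[OF f c]]
    by (simp only: L2_norm_power2 Bochner_Integration.integral_add Bochner_Integration.integrable_add
        integrable_mult_right integral_mult_right_zero integral_Re[OF L2_mult_integrable[OF f c], symmetric])
  also have "\<dots> \<le> (L2_norm f + L2_norm g)\<^sup>2"
    using complex_Re_le_cmod[of "LINT x|lebesgue. f x * ?c x"] L2_Cauchy_Schwarz[OF f c]
    by (simp add: nc power2_sum)
  finally show "(L2_norm (\<lambda>x. f x + g x))\<^sup>2 \<le> (L2_norm f + L2_norm g)\<^sup>2" .
qed simp

lemma L2_norm_cong_AE:
  assumes "AE x in lebesgue. f x = g x" "f \<in> borel_measurable lebesgue" "g \<in> borel_measurable lebesgue"
  shows "L2_norm f = L2_norm g"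
proof -
  note [measurable] = assms(2,3)
  have "AE x in lebesgue. (norm (f x))\<^sup>2 = (norm (g x))\<^sup>2" using assms(1) by eventually_elim simp
  then show ?thesis unfolding L2_norm_def by (subst integral_cong_AE) auto
qed

section \<open>Affine changes of variables and Gaussian integrals\<close>

lemma
  fixes f :: "'a::euclidean_space \<Rightarrow> 'b::{banach, second_countable_topology}"
  assumes c: "c \<noteq> 0" and f: "f \<in> borel_measurable borel"
  shows lborel_integral_affine: "(LINT x|lborel. f x) = \<bar>c\<bar> ^ DIM('a) *\<^sub>R (LINT x|lborel. f (t + c *\<^sub>R x))"
    and lborel_integrable_affine: "integrable lborel (\<lambda>x. f (t + c *\<^sub>R x)) \<longleftrightarrow> integrable lborel f"
proof -
  note [measurable] = f
  show "(LINT x|lborel. f x) = \<bar>c\<bar> ^ DIM('a) *\<^sub>R (LINT x|lborel. f (t + c *\<^sub>R x))"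
    by (subst lborel_affine[OF c, of t]) (simp add: integral_density integral_distr)
  show "integrable lborel (\<lambda>x. f (t + c *\<^sub>R x)) \<longleftrightarrow> integrable lborel f"
  proof -
    have "integrable lborel f \<longleftrightarrow> integrable lborel (\<lambda>x. \<bar>c\<bar> ^ DIM('a) *\<^sub>R f (t + c *\<^sub>R x))"
      by (subst lborel_affine[OF c, of t], subst integrable_density) (simp_all add: integrable_distr_eq)
    also have "\<dots> \<longleftrightarrow> integrable lborel (\<lambda>x. f (t + c *\<^sub>R x))"
      using c integrable_scaleR_right[of "inverse (\<bar>c\<bar> ^ DIM('a))" lborel "\<lambda>x. \<bar>c\<bar> ^ DIM('a) *\<^sub>R f (t + c *\<^sub>R x)"]
      by auto
    finally show ?thesis by simp
  qed
qed

lemmas lborel_integral_translation = lborel_integral_affine[of 1, simplified]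
lemmas lborel_integrable_translation = lborel_integrable_affine[of 1, simplified]

text \<open>Up to its normalising constant this is the characteristic function of the standard
  normal distribution.\<close>

lemma gaussian_fourier_real:
  shows "integrable lborel (\<lambda>x. cis (c * x) * complex_of_real (exp (- x\<^sup>2 / 2)))"
    and "(LINT x|lborel. cis (c * x) * complex_of_real (exp (- x\<^sup>2 / 2))) = sqrt (2 * pi) * exp (- c\<^sup>2 / 2)"
proof -
  have e: "cis (c * x) * complex_of_real (exp (- x\<^sup>2 / 2)) =
      complex_of_real (sqrt (2 * pi)) * (std_normal_density x *\<^sub>R iexp (c * x))" for x
    by (simp add: std_normal_density_def cis_conv_exp scaleR_conv_of_real)
  interpret real_distribution std_normal_distribution by (rule real_dist_normal_dist)
  have "integrable std_normal_distribution (\<lambda>x. iexp (c * x))"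
    by (rule integrable_iexp) auto
  then have i: "integrable lborel (\<lambda>x. std_normal_density x *\<^sub>R iexp (c * x))"
    by (subst (asm) integrable_density) auto
  then show "integrable lborel (\<lambda>x. cis (c * x) * complex_of_real (exp (- x\<^sup>2 / 2)))"
    unfolding e by (rule integrable_mult_right)
  have "(LINT x|lborel. std_normal_density x *\<^sub>R iexp (c * x)) = complex_of_real (exp (- c\<^sup>2 / 2))"
    using char_std_normal_distribution by (simp add: char_def integral_density fun_eq_iff)
  then show "(LINT x|lborel. cis (c * x) * complex_of_real (exp (- x\<^sup>2 / 2))) = sqrt (2 * pi) * exp (- c\<^sup>2 / 2)"
    by (simp only: e integral_mult_right_zero of_real_mult)
qed

text \<open>Character and Gaussian both factor over the coordinates, and \<open>lborel_eq\<close>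
  presents Lebesgue measure as the image of a product measure, so the one-dimensional case
  suffices.\<close>

lemma gaussian_fourier:
  fixes z :: "'a::euclidean_space"
  shows "integrable lborel (\<lambda>x. cis (z \<bullet> x) * complex_of_real (exp (- (norm x)\<^sup>2 / 2)))" (is ?i)
    and "(LINT x|lborel. cis (z \<bullet> x) * complex_of_real (exp (- (norm x)\<^sup>2 / 2))) =
      (sqrt (2 * pi)) ^ DIM('a) * exp (- (norm z)\<^sup>2 / 2)" (is ?e)
proof -
  interpret product_sigma_finite "\<lambda>b::'a. lborel :: real measure" ..
  let ?F = "\<lambda>x::'a. cis (z \<bullet> x) * complex_of_real (exp (- (norm x)\<^sup>2 / 2))"
  let ?f = "\<lambda>b x::real. cis ((z \<bullet> b) * x) * complex_of_real (exp (- x\<^sup>2 / 2))"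
  have n: "(norm x)\<^sup>2 = (\<Sum>b\<in>Basis. (x \<bullet> b)\<^sup>2)" for x :: 'a
    by (subst power2_norm_eq_inner, subst euclidean_inner) (simp add: power2_eq_square)
  have cis_sum: "cis (\<Sum>b\<in>B. g b) = (\<Prod>b\<in>B. cis (g b))" if "finite B" for g and B :: "'a set"
    using that by induction (simp_all flip: cis_mult)
  have F: "?F (\<Sum>b\<in>Basis. x b *\<^sub>R b) = (\<Prod>b\<in>Basis. ?f b (x b))" for x
  proof -
    have "z \<bullet> (\<Sum>b\<in>Basis. x b *\<^sub>R b) = (\<Sum>b\<in>Basis. (z \<bullet> b) * x b)"
      by (simp add: inner_sum_right mult.commute)
    moreover have "(norm (\<Sum>b\<in>Basis. x b *\<^sub>R b))\<^sup>2 = (\<Sum>b\<in>(Basis::'a set). (x b)\<^sup>2)"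
      by (simp add: n)
    ultimately show ?thesis
      by (simp add: cis_sum prod.distrib exp_sum sum_divide_distrib flip: sum_negf)
  qed
  have Fm: "?F \<in> borel_measurable borel"
    by (intro borel_measurable_continuous_onI continuous_intros) auto
  have i: "integrable (Pi\<^sub>M Basis (\<lambda>b. lborel)) (\<lambda>x. \<Prod>b\<in>Basis. ?f b (x b))"
    by (rule product_integrable_prod[OF finite_Basis gaussian_fourier_real(1)])
  show ?i
  proof -
    have "integrable lborel ?F \<longleftrightarrow> integrable (Pi\<^sub>M Basis (\<lambda>b. lborel)) (\<lambda>x. ?F (\<Sum>b\<in>Basis. x b *\<^sub>R b))"
      by (subst lborel_eq, rule integrable_distr_eq[OF _ Fm]) measurable
    then show ?thesis using i unfolding F by blast
  qed
  have "(LINT x|lborel. ?F x) = (\<Prod>b\<in>Basis. LINT x|lborel. ?f b x)"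
  proof -
    have "(LINT x|lborel. ?F x) = (LINT x|Pi\<^sub>M Basis (\<lambda>b. lborel). ?F (\<Sum>b\<in>Basis. x b *\<^sub>R b))"
      by (subst lborel_eq, rule integral_distr[OF _ Fm]) measurable
    also have "\<dots> = (\<Prod>b\<in>Basis. LINT x|lborel. ?f b x)"
      unfolding F by (rule product_integral_prod[OF finite_Basis gaussian_fourier_real(1)])
    finally show ?thesis .
  qed
  also have "\<dots> = (sqrt (2 * pi)) ^ DIM('a) * exp (- (norm z)\<^sup>2 / 2)"
    unfolding gaussian_fourier_real(2) n by (simp add: prod.distrib exp_sum sum_divide_distrib flip: sum_negf)
  finally show ?e .
qed

section \<open>Borel representatives and approximation by continuous functions\<close>

text \<open>For a Borel function f the joint expression f(h + x) is measurable on the product space.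
  Functions in \<open>L2\<close> are therefore replaced by Borel representatives before Fubini's
  theorem is used.\<close>

lemma lebesgue_borel_representative:
  fixes f :: "'a::euclidean_space \<Rightarrow> complex"
  assumes f: "f \<in> borel_measurable lebesgue"
  obtains g where "g \<in> borel_measurable borel" "AE x in lebesgue. f x = g x"
proof -
  have "\<exists>g'\<in>borel_measurable lborel. AE x in lborel. Re (f x) = g' x"
    by (rule completion_ex_borel_measurable_real) (use f in measurable)
  then obtain g1 where g1: "g1 \<in> borel_measurable borel" "AE x in lborel. Re (f x) = g1 x" by auto
  have "\<exists>g'\<in>borel_measurable lborel. AE x in lborel. Im (f x) = g' x"
    by (rule completion_ex_borel_measurable_real) (use f in measurable)
  then obtain g2 where g2: "g2 \<in> borel_measurable borel" "AE x in lborel. Im (f x) = g2 x" by auto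
  have "AE x in lebesgue. f x = Complex (g1 x) (g2 x)"
    using AE_completion[OF g1(2)] AE_completion[OF g2(2)] by eventually_elim (simp add: complex_eq_iff)
  moreover have "(\<lambda>x. Complex (g1 x) (g2 x)) \<in> borel_measurable borel"
    unfolding Complex_eq using g1(1) g2(1) by measurable
  ultimately show ?thesis using that by blast
qed

lemma integrable_indicator_cball: "integrable lebesgue (indicat_real (cball a r))"
  using lmeasurable_cball lmeasurable_iff_integrable by blast

lemma L2_continuous_bounded_support:
  fixes f :: "'a::euclidean_space \<Rightarrow> complex"
  assumes f: "continuous_on UNIV f" and K: "\<And>x. norm (f x) \<le> K" "\<And>x. norm x > K \<Longrightarrow> f x = 0"
  shows "f \<in> L2"
proof -
  have [measurable]: "f \<in> borel_measurable lebesgue" by (rule continuous_borel_measurable_lebesgue[OF f])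
  have "integrable lebesgue (\<lambda>x. (norm (f x))\<^sup>2)"
  proof (rule Bochner_Integration.integrable_bound)
    show "integrable lebesgue (\<lambda>x::'a. indicat_real (cball 0 K) x *\<^sub>R K\<^sup>2)"
      by (intro integrable_scaleR_left integrable_indicator_cball)
    show "AE x in lebesgue. norm ((norm (f x))\<^sup>2) \<le> norm (indicat_real (cball 0 K) x *\<^sub>R K\<^sup>2)"
      using K(2) power_mono[OF K(1) norm_ge_zero] by (auto simp: indicator_def not_le)
  qed measurable
  then show ?thesis by (simp add: L2_def)
qed

text \<open>Truncating in value and in space comes first: then the continuous functions that
  converge almost everywhere to the truncation can be forced to share its bounds, and dominated
  convergence applies.\<close>

lemma L2_approx_continuous:
  fixes f :: "'a::euclidean_space \<Rightarrow> complex"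
  assumes f: "f \<in> L2" and e: "e > 0"
  obtains g K where "continuous_on UNIV g" "\<And>x. norm (g x) \<le> K" "\<And>x. norm x > K \<Longrightarrow> g x = 0"
    "(LINT x|lebesgue. (norm (f x - g x))\<^sup>2) < e"
proof -
  note fm [measurable] = L2D(1)[OF f]
  define F where "F k x = (if norm (f x) \<le> real k \<and> norm x \<le> real k then f x else 0)" for k x
  have [measurable]: "(\<lambda>x::'a. x) \<in> borel_measurable lebesgue"
    by (rule continuous_borel_measurable_lebesgue) (rule continuous_on_id)
  have Fm [measurable]: "F k \<in> borel_measurable lebesgue" for k
    unfolding F_def by measurable
  have "(\<lambda>k. LINT x|lebesgue. (norm (f x - F k x))\<^sup>2) \<longlonglongrightarrow> (LINT x::'a|lebesgue. 0::real)"
  proof (rule integral_dominated_convergence)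
    show "integrable lebesgue (\<lambda>x. (norm (f x))\<^sup>2)" by (rule L2D(2)[OF f])
    show "AE x in lebesgue. norm ((norm (f x - F k x))\<^sup>2) \<le> (norm (f x))\<^sup>2" for k
      by (auto simp: F_def)
    show "AE x in lebesgue. (\<lambda>k. (norm (f x - F k x))\<^sup>2) \<longlonglongrightarrow> 0"
    proof (rule AE_I2, rule tendsto_eventually)
      fix x
      obtain k0 where "max (norm (f x)) (norm x) \<le> real k0" using real_arch_simple by blast
      then show "\<forall>\<^sub>F k in sequentially. (norm (f x - F k x))\<^sup>2 = 0"
        by (intro eventually_sequentiallyI[of k0]) (auto simp: F_def)
    qed
  qed auto
  \<comment> \<open>Each of the two errors gets e / 4, because the squared triangle inequality
    doubles both.\<close>
  then have "\<forall>\<^sub>F k in sequentially. (LINT x|lebesgue. (norm (f x - F k x))\<^sup>2) < e / 4"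
    using e by (intro order_tendstoD(2)) auto
  then obtain k where k: "(LINT x|lebesgue. (norm (f x - F k x))\<^sup>2) < e / 4"
    by (auto simp: eventually_sequentially)
  have "F k measurable_on UNIV"
    by (simp add: lebesgue_measurable_imp_measurable_on)
  then obtain N g where N: "negligible N" and g: "\<And>n. continuous_on UNIV (g n)"
    and gF: "\<And>x. x \<notin> N \<Longrightarrow> (\<lambda>n. g n x) \<longlonglongrightarrow> F k x"
    unfolding measurable_on_def by auto
  \<comment> \<open>The projection onto the disc of radius k and the spatial factor
    \<open>cut\<close> bound the approximants without moving the limit: \<open>F k\<close> takes
    values in that disc, and \<open>cut\<close> is 1 where \<open>F k\<close> is nonzero.\<close>
  define cl where "cl = closest_point (cball (0::complex) (real k))"
  define cut where "cut x = max 0 (min 1 (real k + 1 - norm x))" for x :: 'a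
  define h where "h n x = cut x *\<^sub>R cl (g n x)" for n x
  have cl: "continuous_on UNIV cl" "norm (cl z) \<le> real k" for z
    unfolding cl_def using closest_point_in_set[of "cball (0::complex) (real k)" z]
    by (auto intro!: continuous_on_closest_point)
  have hc: "continuous_on UNIV (h n)" for n
    unfolding h_def cut_def
    by (intro continuous_intros continuous_on_compose2[OF cl(1) g]) auto
  have [measurable]: "h n \<in> borel_measurable lebesgue" for n
    by (rule continuous_borel_measurable_lebesgue) (rule hc)
  have hK: "norm (h n x) \<le> real k + 1" "norm x > real k + 1 \<Longrightarrow> h n x = 0" for n x
  proof -
    have "cut x * norm (cl (g n x)) \<le> 1 * real k"
      using cl(2) by (intro mult_mono) (auto simp: cut_def)
    then show "norm (h n x) \<le> real k + 1" by (simp add: h_def cut_def)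
    show "norm x > real k + 1 \<Longrightarrow> h n x = 0" by (simp add: h_def cut_def)
  qed
  have "(\<lambda>n. LINT x|lebesgue. (norm (F k x - h n x))\<^sup>2) \<longlonglongrightarrow> (LINT x::'a|lebesgue. 0::real)"
  proof (rule integral_dominated_convergence)
    show "integrable lebesgue (\<lambda>x::'a. indicat_real (cball 0 (real k + 1)) x *\<^sub>R (2 * real k + 1)\<^sup>2)"
      by (intro integrable_scaleR_left integrable_indicator_cball)
    show "AE x in lebesgue. norm ((norm (F k x - h n x))\<^sup>2) \<le> indicat_real (cball 0 (real k + 1)) x *\<^sub>R (2 * real k + 1)\<^sup>2" for n
    proof (rule AE_I2)
      fix x
      have "norm (F k x) \<le> real k" by (simp add: F_def)
      then have "norm (F k x - h n x) \<le> 2 * real k + 1"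
        using hK(1)[of n x] norm_triangle_ineq4[of "F k x" "h n x"] by linarith
      then have "(norm (F k x - h n x))\<^sup>2 \<le> (2 * real k + 1)\<^sup>2"
        by (rule power_mono) simp
      moreover have "F k x - h n x = 0" if "norm x > real k + 1"
        using that hK(2) by (simp add: F_def)
      ultimately show "norm ((norm (F k x - h n x))\<^sup>2) \<le> indicat_real (cball 0 (real k + 1)) x *\<^sub>R (2 * real k + 1)\<^sup>2"
        by (auto simp: indicator_def)
    qed
    have "AE x in lebesgue. x \<notin> N"
      using N by (simp add: negligible_iff_null_sets AE_not_in)
    then show "AE x in lebesgue. (\<lambda>n. (norm (F k x - h n x))\<^sup>2) \<longlonglongrightarrow> 0"
    proof eventually_elim
      fix x assume "x \<notin> N"
      have "isCont cl (F k x)" using cl(1) by (simp add: continuous_on_eq_continuous_at)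
      from isCont_tendsto_compose[OF this gF[OF \<open>x \<notin> N\<close>]]
      have "(\<lambda>n. h n x) \<longlonglongrightarrow> cut x *\<^sub>R cl (F k x)"
        unfolding h_def by (intro tendsto_intros)
      moreover have "cl (F k x) = F k x"
        unfolding cl_def by (rule closest_point_self) (simp add: F_def)
      moreover have "cut x *\<^sub>R F k x = F k x"
        by (auto simp: F_def cut_def)
      ultimately have "(\<lambda>n. (norm (F k x - h n x))\<^sup>2) \<longlonglongrightarrow> (norm (F k x - F k x))\<^sup>2"
        by (intro tendsto_intros) simp
      then show "(\<lambda>n. (norm (F k x - h n x))\<^sup>2) \<longlonglongrightarrow> 0" by simp
    qed
  qed auto
  then have "\<forall>\<^sub>F n in sequentially. (LINT x|lebesgue. (norm (F k x - h n x))\<^sup>2) < e / 4"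
    using e by (intro order_tendstoD(2)) auto
  then obtain n where n: "(LINT x|lebesgue. (norm (F k x - h n x))\<^sup>2) < e / 4"
    by (auto simp: eventually_sequentially)
  have "F k \<in> L2" by (rule L2_dominated[OF _ f, of _ 1]) (auto simp: F_def)
  moreover have "h n \<in> L2" by (rule L2_continuous_bounded_support[OF hc hK])
  ultimately have i: "integrable lebesgue (\<lambda>x. (norm (f x - F k x))\<^sup>2)" "integrable lebesgue (\<lambda>x. (norm (F k x - h n x))\<^sup>2)"
    using L2D(2)[OF L2_diff] f by blast+
  have "(LINT x|lebesgue. (norm (f x - h n x))\<^sup>2) \<le>
      (LINT x|lebesgue. 2 * (norm (f x - F k x))\<^sup>2 + 2 * (norm (F k x - h n x))\<^sup>2)"
  proof (rule integral_mono')
    show "integrable lebesgue (\<lambda>x. 2 * (norm (f x - F k x))\<^sup>2 + 2 * (norm (F k x - h n x))\<^sup>2)"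
      using i by simp
    show "(norm (f x - h n x))\<^sup>2 \<le> 2 * (norm (f x - F k x))\<^sup>2 + 2 * (norm (F k x - h n x))\<^sup>2" for x
      using norm_add_power2_le[of "f x - F k x" "F k x - h n x"] by simp
  qed simp
  also have "\<dots> < e" using i k n by simp
  finally show ?thesis using that[of "h n" "real k + 1"] hc hK by blast
qed

section \<open>The Fourier transform and the autocorrelation\<close>

text \<open>No prefactor is used, so the value at 0 is the integral of f, which makes P_0 and P_1
  values of transforms; Plancherel's identity carries the factor (2\<pi>)^n instead.\<close>

definition fourier :: "('a::euclidean_space \<Rightarrow> complex) \<Rightarrow> 'a \<Rightarrow> complex" where
  "fourier f \<xi> = (LINT x|lebesgue. cis (- (x \<bullet> \<xi>)) * f x)"

definition autocorrelation :: "('a::euclidean_space \<Rightarrow> complex) \<Rightarrow> 'a \<Rightarrow> complex" where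
  "autocorrelation f h = (LINT x|lborel. f (h + x) * cnj (f x))"

lemma borel_measurable_cis_inner [measurable]:
  "(\<lambda>z. cis (- (fst z \<bullet> snd z))) \<in> borel_measurable (borel \<Otimes>\<^sub>M borel :: ('a::euclidean_space \<times> 'a) measure)"
  unfolding borel_prod by (intro borel_measurable_continuous_onI continuous_intros)

lemma borel_measurable_cis_inner_left [measurable]: "(\<lambda>x::'a::euclidean_space. cis (- (x \<bullet> \<xi>))) \<in> borel_measurable borel"
  by (intro borel_measurable_continuous_onI continuous_intros)

lemma borel_measurable_cis_inner_right [measurable]: "(\<lambda>x::'a::euclidean_space. cis (- (\<xi> \<bullet> x))) \<in> borel_measurable borel"
  by (intro borel_measurable_continuous_onI continuous_intros)

lemma borel_measurable_cnj [measurable]: "cnj \<in> borel_measurable borel"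
  by (intro borel_measurable_continuous_onI continuous_intros)

text \<open>Clear for continuous functions of bounded support, by dominated convergence. Since
  translation is an isometry of L^2, approximating f within e / 3 costs the same before and after
  the shift.\<close>

lemma L2_translation_tendsto:
  fixes f :: "'a::euclidean_space \<Rightarrow> complex"
  assumes fm [measurable]: "f \<in> borel_measurable borel" and f: "f \<in> L2"
  shows "((\<lambda>h. L2_norm (\<lambda>x. f (h + x) - f x)) \<longlongrightarrow> 0) (at 0)"
proof (rule tendstoI)
  fix e :: real assume e: "e > 0"
  obtain g K where gc: "continuous_on UNIV g" and gK: "\<And>x. norm (g x) \<le> K" "\<And>x. norm x > K \<Longrightarrow> g x = 0"
    and fg: "(LINT x|lebesgue. (norm (f x - g x))\<^sup>2) < (e / 3)\<^sup>2"
    using L2_approx_continuous[OF f, of "(e / 3)\<^sup>2"] e by auto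
  have [measurable]: "g \<in> borel_measurable borel" using gc by (rule borel_measurable_continuous_onI)
  have K0: "0 \<le> K" using order_trans[OF norm_ge_zero gK(1)] .
  have "g \<in> L2" by (rule L2_continuous_bounded_support[OF gc gK])
  have tr: "(\<lambda>x. k (h + x)) \<in> L2" "L2_norm (\<lambda>x. k (h + x)) = L2_norm k"
    if "k \<in> L2" and [measurable]: "k \<in> borel_measurable borel" for h and k :: "'a \<Rightarrow> complex"
    using L2D(2)[OF that(1)] lborel_integrable_translation[of "\<lambda>x. (norm (k x))\<^sup>2" h]
      lborel_integral_translation[of "\<lambda>x. (norm (k x))\<^sup>2" h]
    by (simp_all add: L2_def L2_norm_def measurable_completion integrable_completion integral_completion)
  have "((\<lambda>h. LINT x|lebesgue. (norm (g (h + x) - g x))\<^sup>2) \<longlongrightarrow> 0) (at 0)"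
    unfolding tendsto_at_iff_sequentially o_def
  proof (intro allI impI)
    fix X :: "nat \<Rightarrow> 'a" assume "X \<longlonglongrightarrow> 0"
    then have "Bseq X" using convergent_imp_Bseq convergentI by blast
    then obtain B where B: "B > 0" "\<And>n. norm (X n) \<le> B" unfolding Bseq_def by blast
    have "(\<lambda>n. LINT x|lebesgue. (norm (g (X n + x) - g x))\<^sup>2) \<longlonglongrightarrow> (LINT x::'a|lebesgue. 0::real)"
    proof (rule integral_dominated_convergence)
      show "integrable lebesgue (\<lambda>x::'a. indicat_real (cball 0 (K + B)) x *\<^sub>R (2 * K)\<^sup>2)"
        by (intro integrable_scaleR_left integrable_indicator_cball)
      show "AE x in lebesgue. norm ((norm (g (X n + x) - g x))\<^sup>2) \<le> indicat_real (cball 0 (K + B)) x *\<^sub>R (2 * K)\<^sup>2" for n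
      proof (rule AE_I2)
        fix x
        have "norm (g (X n + x) - g x) \<le> 2 * K"
          using gK(1)[of "X n + x"] gK(1)[of x] norm_triangle_ineq4[of "g (X n + x)" "g x"] by linarith
        then have "(norm (g (X n + x) - g x))\<^sup>2 \<le> (2 * K)\<^sup>2" by (rule power_mono) simp
        moreover have "g (X n + x) - g x = 0" if "norm x > K + B"
        proof -
          have "norm (X n + x) > K" using that B(2)[of n] norm_diff_ineq[of x "X n"] by (simp add: add.commute)
          moreover have "norm x > K" using that B(1) by simp
          ultimately show ?thesis using gK(2) by simp
        qed
        ultimately show "norm ((norm (g (X n + x) - g x))\<^sup>2) \<le> indicat_real (cball 0 (K + B)) x *\<^sub>R (2 * K)\<^sup>2"
          by (auto simp: indicator_def not_le)
      qed
      show "AE x in lebesgue. (\<lambda>n. (norm (g (X n + x) - g x))\<^sup>2) \<longlonglongrightarrow> 0"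
      proof (rule AE_I2)
        fix x
        have "isCont g (0 + x)" using gc by (simp add: continuous_on_eq_continuous_at)
        moreover have "(\<lambda>n. X n + x) \<longlonglongrightarrow> 0 + x" using \<open>X \<longlonglongrightarrow> 0\<close> by (intro tendsto_intros)
        ultimately have "(\<lambda>n. g (X n + x)) \<longlonglongrightarrow> g (0 + x)" by (rule isCont_tendsto_compose)
        then have "(\<lambda>n. (norm (g (X n + x) - g x))\<^sup>2) \<longlonglongrightarrow> (norm (g (0 + x) - g x))\<^sup>2"
          by (intro tendsto_intros)
        then show "(\<lambda>n. (norm (g (X n + x) - g x))\<^sup>2) \<longlonglongrightarrow> 0" by simp
      qed
    qed (simp_all add: measurable_completion)
    then show "(\<lambda>n. LINT x|lebesgue. (norm (g (X n + x) - g x))\<^sup>2) \<longlonglongrightarrow> 0" by simp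
  qed
  from tendsto_real_sqrt[OF this]
  have "((\<lambda>h. L2_norm (\<lambda>x. g (h + x) - g x)) \<longlongrightarrow> 0) (at 0)"
    by (simp add: L2_norm_def)
  then have "\<forall>\<^sub>F h in at 0. L2_norm (\<lambda>x. g (h + x) - g x) < e / 3"
    using e by (intro order_tendstoD(2)) auto
  then show "\<forall>\<^sub>F h in at 0. dist (L2_norm (\<lambda>x. f (h + x) - f x)) 0 < e"
  proof eventually_elim
    fix h assume h: "L2_norm (\<lambda>x. g (h + x) - g x) < e / 3"
    let ?k = "\<lambda>x. f x - g x"
    have k: "?k \<in> L2" "?k \<in> borel_measurable borel" using L2_diff[OF f \<open>g \<in> L2\<close>] by auto
    have gh: "(\<lambda>x. g (h + x) - g x) \<in> L2" using tr(1)[of g h] \<open>g \<in> L2\<close> by (auto intro: L2_diff)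
    have km: "(\<lambda>x. - 1 * ?k x) \<in> L2" by (rule L2_scale[OF k(1)])
    have "L2_norm ?k < e / 3"
      unfolding L2_norm_def using fg e by (intro real_less_lsqrt) auto
    moreover have "L2_norm (\<lambda>x. - 1 * ?k x) = L2_norm ?k"
      by (simp add: L2_norm_def norm_minus_commute)
    moreover have "L2_norm (\<lambda>x. f (h + x) - f x) = L2_norm (\<lambda>x. ?k (h + x) + ((g (h + x) - g x) + - 1 * ?k x))"
      by simp
    moreover have "L2_norm (\<lambda>x. ?k (h + x) + ((g (h + x) - g x) + - 1 * ?k x)) \<le>
        L2_norm (\<lambda>x. ?k (h + x)) + (L2_norm (\<lambda>x. g (h + x) - g x) + L2_norm (\<lambda>x. - 1 * ?k x))"
      using L2_norm_triangle[OF tr(1)[OF k, of h] L2_add[OF gh km]] L2_norm_triangle[OF gh km] by linarith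
    ultimately show "dist (L2_norm (\<lambda>x. f (h + x) - f x)) 0 < e"
      using h tr(2)[OF k, of h] by simp
  qed
qed

lemma continuous_on_fourier:
  assumes f: "integrable lebesgue f"
  shows "continuous_on UNIV (fourier f)"
  unfolding continuous_on_sequentially o_def
proof (intro ballI allI impI)
  fix X :: "nat \<Rightarrow> 'a" and \<xi> assume X: "(\<forall>n. X n \<in> UNIV) \<and> X \<longlonglongrightarrow> \<xi>"
  have [measurable]: "f \<in> borel_measurable lebesgue" using f by auto
  have [measurable]: "(\<lambda>x. cis (- (x \<bullet> \<xi>))) \<in> borel_measurable lebesgue" for \<xi> :: 'a
    by (intro measurable_completion) simp
  show "(\<lambda>n. fourier f (X n)) \<longlonglongrightarrow> fourier f \<xi>"
    unfolding fourier_def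
  proof (rule integral_dominated_convergence)
    show "integrable lebesgue (\<lambda>x. norm (f x))" using f by simp
    have "(\<lambda>n. cis (- (x \<bullet> X n)) * f x) \<longlonglongrightarrow> cis (- (x \<bullet> \<xi>)) * f x" for x
      using X by (intro tendsto_intros isCont_tendsto_compose[of _ cis] continuous_intros) auto
    then show "AE x in lebesgue. (\<lambda>n. cis (- (x \<bullet> X n)) * f x) \<longlonglongrightarrow> cis (- (x \<bullet> \<xi>)) * f x" by simp
  qed (auto simp: norm_mult)
qed

lemma borel_measurable_fourier [measurable]:
  "integrable lebesgue f \<Longrightarrow> fourier f \<in> borel_measurable borel"
  by (intro borel_measurable_continuous_onI continuous_on_fourier)

lemma norm_fourier_le: "norm (fourier f \<xi>) \<le> L1_norm f"
  unfolding fourier_def L1_norm_def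
  using integral_norm_bound[of lebesgue "\<lambda>x. cis (- (x \<bullet> \<xi>)) * f x"] by (simp add: norm_mult)

text \<open>The Fourier transform of the autocorrelation is \<open>|fourier f|\<^sup>2\<close>, so Gaussian means of
  \<open>|fourier f|\<^sup>2\<close> are Gaussian means of the autocorrelation, concentrated near 0, where its value is
  the squared norm of \<open>f\<close>.\<close>

context
  fixes f :: "'a::euclidean_space \<Rightarrow> complex"
  assumes fm [measurable]: "f \<in> borel_measurable borel"
    and f1: "integrable lborel f" and f2: "integrable lborel (\<lambda>x. (norm (f x))\<^sup>2)"
begin

lemma fourier_lborel: "fourier f \<xi> = (LINT x|lborel. cis (- (x \<bullet> \<xi>)) * f x)"
  unfolding fourier_def by (rule integral_completion) simp

lemma integrable_lebesgue_f: "integrable lebesgue f"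
  using f1 by (simp add: integrable_completion)

lemmas borel_measurable_fourier_f [measurable] = borel_measurable_fourier[OF integrable_lebesgue_f]

text \<open>By Tonelli and translation invariance, the integral of the modulus is the square of the
  L^1 norm of f.\<close>

lemma integrable_correlation:
  "integrable (lborel \<Otimes>\<^sub>M lborel) (\<lambda>(h, x). f (h + x) * cnj (f x))"
proof (subst integrable_iff_bounded, intro conjI)
  show "(\<lambda>(h, x). f (h + x) * cnj (f x)) \<in> borel_measurable (lborel \<Otimes>\<^sub>M lborel)"
    by measurable
  have n: "(\<integral>\<^sup>+ h. norm (f (h + x)) \<partial>lborel) = (\<integral>\<^sup>+ h. norm (f h) \<partial>lborel)" for x
  proof -
    have "(\<integral>\<^sup>+ h. norm (f h) \<partial>lborel) = (\<integral>\<^sup>+ h. norm (f h) \<partial>distr lborel borel ((+) x))"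
      by (simp add: lborel_distr_plus)
    also have "\<dots> = (\<integral>\<^sup>+ h. norm (f (x + h)) \<partial>lborel)"
      by (rule nn_integral_distr) auto
    finally show ?thesis by (simp add: add.commute)
  qed
  have "(\<integral>\<^sup>+ z. norm (case z of (h, x) \<Rightarrow> f (h + x) * cnj (f x)) \<partial>(lborel \<Otimes>\<^sub>M lborel)) =
      (\<integral>\<^sup>+ x. \<integral>\<^sup>+ h. norm (f (h + x) * cnj (f x)) \<partial>lborel \<partial>lborel)"
    by (subst lborel_pair.nn_integral_snd[symmetric]) (simp_all add: case_prod_beta)
  also have "\<dots> = (\<integral>\<^sup>+ x. (\<integral>\<^sup>+ h. norm (f h) \<partial>lborel) * norm (f x) \<partial>lborel)"
    by (simp add: norm_mult ennreal_mult nn_integral_multc n)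
  also have "\<dots> = (\<integral>\<^sup>+ h. norm (f h) \<partial>lborel) * (\<integral>\<^sup>+ h. norm (f h) \<partial>lborel)"
    by (simp add: nn_integral_cmult)
  also have "\<dots> < \<infinity>"
    using f1 by (auto simp: integrable_iff_bounded ennreal_mult_less_top)
  finally show "(\<integral>\<^sup>+ z. norm (case z of (h, x) \<Rightarrow> f (h + x) * cnj (f x)) \<partial>(lborel \<Otimes>\<^sub>M lborel)) < \<infinity>" .
qed

lemma borel_measurable_autocorrelation [measurable]: "autocorrelation f \<in> borel_measurable borel"
  unfolding autocorrelation_def[abs_def] by measurable

lemma integrable_autocorrelation: "integrable lborel (autocorrelation f)"
  using lborel_pair.integrable_fst'[OF integrable_correlation]
  by (simp add: autocorrelation_def[abs_def])

text \<open>The character is multiplicative, e(h) = e(x + h) times the conjugate of e(x), so after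
  Fubini the double integral splits into the transform of f and its conjugate.\<close>

lemma fourier_autocorrelation:
  "complex_of_real ((norm (fourier f \<xi>))\<^sup>2) = (LINT h|lborel. cis (- (h \<bullet> \<xi>)) * autocorrelation f h)"
proof -
  let ?e = "\<lambda>h. cis (- (h \<bullet> \<xi>))"
  have inner: "(LINT h|lborel. ?e h * (f (h + x) * cnj (f x))) = fourier f \<xi> * cnj (?e x * f x)" for x
  proof -
    have e: "?e h = ?e (x + h) * cnj (?e x)" for h
      by (simp add: inner_add_left cis_cnj cis_mult)
    have "?e h * (f (h + x) * cnj (f x)) = ?e (x + h) * f (x + h) * cnj (?e x * f x)" for h
      unfolding e[of h] by (simp add: add.commute)
    then have "(LINT h|lborel. ?e h * (f (h + x) * cnj (f x))) =
        (LINT h|lborel. ?e (x + h) * f (x + h) * cnj (?e x * f x))"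
      by (simp only:)
    also have "\<dots> = (LINT h|lborel. ?e (x + h) * f (x + h)) * cnj (?e x * f x)"
      by (rule integral_mult_left_zero)
    also have "(LINT h|lborel. ?e (x + h) * f (x + h)) = fourier f \<xi>"
      unfolding fourier_lborel by (rule lborel_integral_translation[symmetric]) simp
    finally show ?thesis .
  qed
  have "integrable (lborel \<Otimes>\<^sub>M lborel) (\<lambda>(h, x). ?e h * (f (h + x) * cnj (f x)))"
    by (rule Bochner_Integration.integrable_bound[OF integrable_norm[OF integrable_correlation]])
      (auto simp: norm_mult)
  then have "(LINT h|lborel. LINT x|lborel. ?e h * (f (h + x) * cnj (f x))) =
      (LINT x|lborel. LINT h|lborel. ?e h * (f (h + x) * cnj (f x)))"
    by (rule lborel_pair.Fubini_integral[symmetric])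
  also have "\<dots> = (LINT x|lborel. fourier f \<xi> * cnj (?e x * f x))"
    by (simp only: inner)
  also have "(LINT x|lborel. fourier f \<xi> * cnj (?e x * f x)) = fourier f \<xi> * cnj (fourier f \<xi>)"
    by (simp only: integral_mult_right_zero fourier_lborel) (simp only: Bochner_Integration.integral_cnj)
  finally show ?thesis
    unfolding autocorrelation_def complex_norm_square by (simp only: integral_mult_right_zero)
qed

lemma autocorrelation_bound: "norm (autocorrelation f h) \<le> (LINT x|lborel. (norm (f x))\<^sup>2)"
proof -
  have t: "integrable lborel (\<lambda>x. (norm (f (h + x)))\<^sup>2)"
    "(LINT x|lborel. (norm (f (h + x)))\<^sup>2) = (LINT x|lborel. (norm (f x))\<^sup>2)"
    using f2 lborel_integrable_translation[of "\<lambda>x. (norm (f x))\<^sup>2" h]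
      lborel_integral_translation[of "\<lambda>x. (norm (f x))\<^sup>2" h] by simp_all
  have yg: "norm (f (h + x) * cnj (f x)) \<le> ((norm (f (h + x)))\<^sup>2 + (norm (f x))\<^sup>2) / 2" for x
    using zero_le_power2[of "norm (f (h + x)) - norm (f x)"] by (simp add: norm_mult power2_diff)
  have "norm (autocorrelation f h) \<le> (LINT x|lborel. norm (f (h + x) * cnj (f x)))"
    unfolding autocorrelation_def by (rule integral_norm_bound)
  also have "\<dots> \<le> (LINT x|lborel. ((norm (f (h + x)))\<^sup>2 + (norm (f x))\<^sup>2) / 2)"
    by (rule integral_mono'[OF _ yg]) (use t(1) f2 in auto)
  also have "\<dots> = (LINT x|lborel. (norm (f x))\<^sup>2)"
    using t f2 by simp
  finally show ?thesis .
qed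

lemma autocorrelation_tendsto:
  "(autocorrelation f \<longlongrightarrow> complex_of_real (LINT x|lborel. (norm (f x))\<^sup>2)) (at 0)"
proof (rule LIM_zero_cancel, rule Lim_null_comparison)
  have f: "f \<in> L2" using f2 by (simp add: L2_def measurable_completion integrable_completion)
  have fh: "(\<lambda>x. f (h + x)) \<in> L2" for h
    using f2 lborel_integrable_translation[of "\<lambda>x. (norm (f x))\<^sup>2" h]
    by (simp add: L2_def measurable_completion integrable_completion)
  have fc: "(\<lambda>x. cnj (f x)) \<in> L2" using f2 by (simp add: L2_def measurable_completion integrable_completion)
  have "norm (autocorrelation f h - complex_of_real (LINT x|lborel. (norm (f x))\<^sup>2))
      \<le> L2_norm (\<lambda>x. f (h + x) - f x) * L2_norm (\<lambda>x. cnj (f x))" for h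
  proof -
    have "autocorrelation f h = (LINT x|lebesgue. f (h + x) * cnj (f x))"
      unfolding autocorrelation_def by (rule integral_completion[symmetric]) simp
    moreover have "(LINT x|lebesgue. f x * cnj (f x)) = (LINT x|lborel. f x * cnj (f x))"
      by (rule integral_completion) simp
    moreover have "(LINT x|lborel. f x * cnj (f x)) = complex_of_real (LINT x|lborel. (norm (f x))\<^sup>2)"
      unfolding complex_norm_square[symmetric] by (rule integral_complex_of_real)
    ultimately have "autocorrelation f h - complex_of_real (LINT x|lborel. (norm (f x))\<^sup>2) =
        (LINT x|lebesgue. (f (h + x) - f x) * cnj (f x))"
      using L2_mult_integrable[OF fh fc, of h] L2_mult_integrable[OF f fc] by (simp add: left_diff_distrib)
    then show ?thesis using L2_Cauchy_Schwarz[OF L2_diff[OF fh f] fc] by simp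
  qed
  then show "\<forall>\<^sub>F h in at 0. norm (autocorrelation f h - complex_of_real (LINT x|lborel. (norm (f x))\<^sup>2))
      \<le> L2_norm (\<lambda>x. f (h + x) - f x) * L2_norm (\<lambda>x. cnj (f x))"
    by simp
  show "((\<lambda>h. L2_norm (\<lambda>x. f (h + x) - f x) * L2_norm (\<lambda>x. cnj (f x))) \<longlongrightarrow> 0) (at 0)"
    using tendsto_mult_left_zero[OF L2_translation_tendsto[OF fm f]] .
qed

lemma gaussian_mean_fourier:
  assumes s: "s > 0"
  shows "integrable lborel (\<lambda>\<xi>. exp (- (norm (s *\<^sub>R \<xi>))\<^sup>2 / 2) * (norm (fourier f \<xi>))\<^sup>2)"
    and "complex_of_real (LINT \<xi>|lborel. exp (- (norm (s *\<^sub>R \<xi>))\<^sup>2 / 2) * (norm (fourier f \<xi>))\<^sup>2) =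
      sqrt (2 * pi) ^ DIM('a) * (LINT w|lborel. complex_of_real (exp (- (norm w)\<^sup>2 / 2)) * autocorrelation f (s *\<^sub>R w))"
proof -
  let ?G = "\<lambda>\<xi>::'a. exp (- (norm (s *\<^sub>R \<xi>))\<^sup>2 / 2)"
  have Gi: "integrable lborel (\<lambda>\<xi>. complex_of_real (?G \<xi>))"
    using gaussian_fourier(1)[of "0::'a"] s lborel_integrable_affine[of s "\<lambda>x::'a. complex_of_real (exp (- (norm x)\<^sup>2 / 2))" 0]
    by simp
  \<comment> \<open>The transform of the wide Gaussian of scale 1 / s is a narrow one of scale
    s.\<close>
  have K: "(LINT \<xi>|lborel. cis (- (h \<bullet> \<xi>)) * complex_of_real (?G \<xi>)) =
      inverse s ^ DIM('a) * (sqrt (2 * pi) ^ DIM('a) * exp (- (norm (h /\<^sub>R s))\<^sup>2 / 2))" for h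
  proof -
    have "(LINT \<xi>|lborel. cis (- (h \<bullet> \<xi>)) * complex_of_real (?G \<xi>)) =
        \<bar>inverse s\<bar> ^ DIM('a) *\<^sub>R (LINT \<xi>|lborel. cis (- (h \<bullet> (0 + inverse s *\<^sub>R \<xi>))) * complex_of_real (?G (0 + inverse s *\<^sub>R \<xi>)))"
      by (rule lborel_integral_affine) (use s in simp_all)
    also have "(\<lambda>\<xi>. cis (- (h \<bullet> (0 + inverse s *\<^sub>R \<xi>))) * complex_of_real (?G (0 + inverse s *\<^sub>R \<xi>)))
        = (\<lambda>\<xi>. cis ((- (h /\<^sub>R s)) \<bullet> \<xi>) * complex_of_real (exp (- (norm \<xi>)\<^sup>2 / 2)))"
      using s by auto
    finally show ?thesis
      unfolding gaussian_fourier(2) using s by (simp add: scaleR_conv_of_real)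
  qed
  show "integrable lborel (\<lambda>\<xi>. ?G \<xi> * (norm (fourier f \<xi>))\<^sup>2)"
  proof (rule Bochner_Integration.integrable_bound)
    show "integrable lborel (\<lambda>\<xi>. ?G \<xi> * (L1_norm f)\<^sup>2)"
      using integrable_Re[OF Gi] by simp
    show "AE \<xi> in lborel. norm (?G \<xi> * (norm (fourier f \<xi>))\<^sup>2) \<le> norm (?G \<xi> * (L1_norm f)\<^sup>2)"
      by (intro AE_I2) (auto simp: abs_mult intro!: mult_left_mono power_mono norm_fourier_le)
  qed measurable
  let ?H = "\<lambda>h. complex_of_real (exp (- (norm (h /\<^sub>R s))\<^sup>2 / 2)) * autocorrelation f h"
  have "complex_of_real (LINT \<xi>|lborel. ?G \<xi> * (norm (fourier f \<xi>))\<^sup>2) =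
      (LINT \<xi>|lborel. complex_of_real (?G \<xi>) * complex_of_real ((norm (fourier f \<xi>))\<^sup>2))"
    by (simp only: integral_complex_of_real[symmetric] of_real_mult)
  also have "\<dots> = (LINT \<xi>|lborel. LINT h|lborel. complex_of_real (?G \<xi>) * (cis (- (h \<bullet> \<xi>)) * autocorrelation f h))"
    unfolding fourier_autocorrelation by (simp only: integral_mult_right_zero)
  also have "\<dots> = (LINT h|lborel. LINT \<xi>|lborel. complex_of_real (?G \<xi>) * (cis (- (h \<bullet> \<xi>)) * autocorrelation f h))"
  proof (rule lborel_pair.Fubini_integral[symmetric])
    have "integrable (lborel \<Otimes>\<^sub>M lborel) (\<lambda>(\<xi>, h). complex_of_real (?G \<xi>) * autocorrelation f h)"
    proof (rule lborel_pair.Fubini_integrable)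
      have "integrable lborel (\<lambda>x. norm (complex_of_real (?G x)) * (LINT y|lborel. norm (autocorrelation f y)))"
        using integrable_norm[OF Gi] by (rule integrable_mult_left)
      then show "integrable lborel (\<lambda>x. LINT y|lborel. norm (case (x, y) of (\<xi>, h) \<Rightarrow> complex_of_real (?G \<xi>) * autocorrelation f h))"
        by (simp add: norm_mult)
    qed (use integrable_autocorrelation in auto)
    then show "integrable (lborel \<Otimes>\<^sub>M lborel) (\<lambda>(\<xi>, h). complex_of_real (?G \<xi>) * (cis (- (h \<bullet> \<xi>)) * autocorrelation f h))"
      by (rule Bochner_Integration.integrable_bound) (auto simp: norm_mult inner_commute)
  qed
  also have "\<dots> = (LINT h|lborel. (LINT \<xi>|lborel. cis (- (h \<bullet> \<xi>)) * complex_of_real (?G \<xi>)) * autocorrelation f h)"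
  proof -
    have "(LINT \<xi>|lborel. complex_of_real (?G \<xi>) * (cis (- (h \<bullet> \<xi>)) * autocorrelation f h)) =
        (LINT \<xi>|lborel. cis (- (h \<bullet> \<xi>)) * complex_of_real (?G \<xi>)) * autocorrelation f h" for h
      by (subst integral_mult_left_zero[symmetric]) (simp only: mult_ac)
    then show ?thesis by (simp only:)
  qed
  also have "\<dots> = (LINT h|lborel. complex_of_real (inverse s ^ DIM('a) * sqrt (2 * pi) ^ DIM('a)) * ?H h)"
    by (simp only: K of_real_mult mult_ac)
  also have "\<dots> = complex_of_real (inverse s ^ DIM('a) * sqrt (2 * pi) ^ DIM('a)) * (LINT h|lborel. ?H h)"
    by (rule integral_mult_right_zero)
  \<comment> \<open>With h = s w the Gaussian no longer depends on s, the Jacobian cancels the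
    factor s^{-n}, and s survives only in the argument of the autocorrelation.\<close>
  also have "(LINT h|lborel. ?H h) = \<bar>s\<bar> ^ DIM('a) *\<^sub>R (LINT w|lborel. ?H (0 + s *\<^sub>R w))"
    by (rule lborel_integral_affine) (use s in simp_all)
  also have "(\<lambda>w. ?H (0 + s *\<^sub>R w)) = (\<lambda>w. complex_of_real (exp (- (norm w)\<^sup>2 / 2)) * autocorrelation f (s *\<^sub>R w))"
    using s by simp
  finally show "complex_of_real (LINT \<xi>|lborel. exp (- (norm (s *\<^sub>R \<xi>))\<^sup>2 / 2) * (norm (fourier f \<xi>))\<^sup>2) =
      sqrt (2 * pi) ^ DIM('a) * (LINT w|lborel. complex_of_real (exp (- (norm w)\<^sup>2 / 2)) * autocorrelation f (s *\<^sub>R w))"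
    using s by (simp add: scaleR_conv_of_real field_simps)
qed

text \<open>Let s tend to 0 in \<open>gaussian_mean_fourier\<close>. The autocorrelation side
  converges by dominated convergence; the frequency side increases, so monotone convergence yields
  integrability together with the value.\<close>

lemma plancherel_borel:
  "integrable lborel (\<lambda>\<xi>. (norm (fourier f \<xi>))\<^sup>2)"
  "(LINT \<xi>|lborel. (norm (fourier f \<xi>))\<^sup>2) = (2 * pi) ^ DIM('a) * (LINT x|lborel. (norm (f x))\<^sup>2)"
proof -
  define N where "N = (LINT x|lborel. (norm (f x))\<^sup>2)"
  define s where "s k = 1 / real (Suc k)" for k
  have s: "s k > 0" "s k \<noteq> 0" "s k \<ge> 0" for k by (simp_all add: s_def)
  have s0: "s \<longlonglongrightarrow> 0"
    unfolding s_def by (rule lim_1_over_n[THEN LIMSEQ_Suc])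
  have gi: "integrable lborel (\<lambda>w::'a. complex_of_real (exp (- (norm w)\<^sup>2 / 2)))"
    "(LINT w|lborel. complex_of_real (exp (- (norm (w::'a))\<^sup>2 / 2))) = sqrt (2 * pi) ^ DIM('a)"
    using gaussian_fourier[of "0::'a"] by simp_all
  have "(\<lambda>k. LINT w|lborel. complex_of_real (exp (- (norm w)\<^sup>2 / 2)) * autocorrelation f (s k *\<^sub>R w))
      \<longlonglongrightarrow> (LINT w::'a|lborel. complex_of_real (exp (- (norm w)\<^sup>2 / 2)) * complex_of_real N)"
  proof (rule integral_dominated_convergence)
    show "integrable lborel (\<lambda>w::'a. exp (- (norm w)\<^sup>2 / 2) * N)"
      using integrable_Re[OF gi(1)] by simp
    show "AE w in lborel. norm (complex_of_real (exp (- (norm w)\<^sup>2 / 2)) * autocorrelation f (s k *\<^sub>R w)) \<le> exp (- (norm w)\<^sup>2 / 2) * N" for k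
      using autocorrelation_bound by (auto simp: norm_mult N_def intro!: mult_left_mono)
    \<comment> \<open>\<open>autocorrelation_tendsto\<close> is a limit over a punctured
      neighbourhood, hence the null set {0} is excluded.\<close>
    show "AE w in lborel. (\<lambda>k. complex_of_real (exp (- (norm w)\<^sup>2 / 2)) * autocorrelation f (s k *\<^sub>R w))
        \<longlonglongrightarrow> complex_of_real (exp (- (norm w)\<^sup>2 / 2)) * complex_of_real N"
      using AE_lborel_singleton[of "0::'a"]
    proof eventually_elim
      fix w :: 'a assume "w \<noteq> 0"
      have "filterlim (\<lambda>k. s k *\<^sub>R w) (at 0) sequentially"
        unfolding filterlim_at using \<open>w \<noteq> 0\<close> s(2) tendsto_scaleR[OF s0 tendsto_const[of w]] by auto
      from filterlim_compose[OF autocorrelation_tendsto this]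
      show "(\<lambda>k. complex_of_real (exp (- (norm w)\<^sup>2 / 2)) * autocorrelation f (s k *\<^sub>R w))
        \<longlonglongrightarrow> complex_of_real (exp (- (norm w)\<^sup>2 / 2)) * complex_of_real N"
        unfolding N_def by (intro tendsto_intros)
    qed
  qed auto
  then have "(\<lambda>k. complex_of_real (LINT \<xi>|lborel. exp (- (norm (s k *\<^sub>R \<xi>))\<^sup>2 / 2) * (norm (fourier f \<xi>))\<^sup>2))
      \<longlonglongrightarrow> sqrt (2 * pi) ^ DIM('a) * (sqrt (2 * pi) ^ DIM('a) * N)"
    unfolding gaussian_mean_fourier(2)[OF s(1)] integral_mult_left_zero gi(2) of_real_mult
    by (rule tendsto_mult_left)
  from tendsto_Re[OF this]
  have lim0: "(\<lambda>k. Re (complex_of_real (LINT \<xi>|lborel. exp (- (norm (s k *\<^sub>R \<xi>))\<^sup>2 / 2) * (norm (fourier f \<xi>))\<^sup>2)))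
      \<longlonglongrightarrow> Re (sqrt (2 * pi) ^ DIM('a) * (sqrt (2 * pi) ^ DIM('a) * N))" .
  have "sqrt (2 * pi) ^ DIM('a) * sqrt (2 * pi) ^ DIM('a) = (2 * pi) ^ DIM('a)"
    by (subst power_mult_distrib[symmetric]) simp
  then have eq: "sqrt (2 * pi) ^ DIM('a) * (sqrt (2 * pi) ^ DIM('a) * N) = (2 * pi) ^ DIM('a) * N"
    by (metis mult.assoc)
  have lim: "(\<lambda>k. LINT \<xi>|lborel. exp (- (norm (s k *\<^sub>R \<xi>))\<^sup>2 / 2) * (norm (fourier f \<xi>))\<^sup>2)
      \<longlonglongrightarrow> (2 * pi) ^ DIM('a) * N"
    using lim0 by (simp only: eq of_real_mult[symmetric] Re_complex_of_real)
  have mono: "AE \<xi> in lborel. mono (\<lambda>k. exp (- (norm (s k *\<^sub>R \<xi>))\<^sup>2 / 2) * (norm (fourier f \<xi>))\<^sup>2)"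
  proof (rule AE_I2, rule monoI)
    fix \<xi> :: 'a and j k :: nat assume "j \<le> k"
    then have "s k \<le> s j" by (simp add: s_def field_simps)
    then have "(norm (s k *\<^sub>R \<xi>))\<^sup>2 \<le> (norm (s j *\<^sub>R \<xi>))\<^sup>2"
      using s(3) by (intro power_mono) (auto intro: mult_right_mono)
    then show "exp (- (norm (s j *\<^sub>R \<xi>))\<^sup>2 / 2) * (norm (fourier f \<xi>))\<^sup>2 \<le> exp (- (norm (s k *\<^sub>R \<xi>))\<^sup>2 / 2) * (norm (fourier f \<xi>))\<^sup>2"
      by (intro mult_right_mono) auto
  qed
  have conv: "AE \<xi> in lborel. (\<lambda>k. exp (- (norm (s k *\<^sub>R \<xi>))\<^sup>2 / 2) * (norm (fourier f \<xi>))\<^sup>2) \<longlonglongrightarrow> (norm (fourier f \<xi>))\<^sup>2"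
  proof (rule AE_I2)
    fix \<xi>
    have "(\<lambda>k. exp (- (norm (s k *\<^sub>R \<xi>))\<^sup>2 / 2) * (norm (fourier f \<xi>))\<^sup>2) \<longlonglongrightarrow>
        exp (- (norm (0 *\<^sub>R \<xi>))\<^sup>2 / 2) * (norm (fourier f \<xi>))\<^sup>2"
      by (intro tendsto_intros s0) simp
    then show "(\<lambda>k. exp (- (norm (s k *\<^sub>R \<xi>))\<^sup>2 / 2) * (norm (fourier f \<xi>))\<^sup>2) \<longlonglongrightarrow> (norm (fourier f \<xi>))\<^sup>2"
      by simp
  qed
  show "integrable lborel (\<lambda>\<xi>. (norm (fourier f \<xi>))\<^sup>2)"
    by (rule integral_monotone_convergence_nonneg(1)[OF gaussian_mean_fourier(1)[OF s(1)] mono _ conv lim]) simp_all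
  show "(LINT \<xi>|lborel. (norm (fourier f \<xi>))\<^sup>2) = (2 * pi) ^ DIM('a) * (LINT x|lborel. (norm (f x))\<^sup>2)"
    unfolding N_def[symmetric]
    by (rule integral_monotone_convergence_nonneg(2)[OF gaussian_mean_fourier(1)[OF s(1)] mono _ conv lim]) simp_all
qed

end

text \<open>Passing to a Borel representative leaves the norms alone and does not change the
  transform at any frequency.\<close>

theorem plancherel:
  fixes f :: "'a::euclidean_space \<Rightarrow> complex"
  assumes f1: "integrable lebesgue f" and f2: "f \<in> L2"
  shows "fourier f \<in> L2" "(L2_norm (fourier f))\<^sup>2 = (2 * pi) ^ DIM('a) * (L2_norm f)\<^sup>2"
proof -
  note [measurable] = L2D(1)[OF f2]
  obtain g where g [measurable]: "g \<in> borel_measurable borel" and fg: "AE x in lebesgue. f x = g x"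
    using lebesgue_borel_representative[OF L2D(1)[OF f2]] .
  have gl [measurable]: "g \<in> borel_measurable lebesgue" by (rule measurable_completion) simp
  have "integrable lebesgue g" using f1 fg by (subst integrable_cong_AE[of g _ f]) auto
  then have g1: "integrable lborel g" by (simp add: integrable_completion)
  have "AE x in lebesgue. (norm (g x))\<^sup>2 = (norm (f x))\<^sup>2" using fg by eventually_elim simp
  then have "integrable lebesgue (\<lambda>x. (norm (g x))\<^sup>2)"
    using L2D(2)[OF f2] by (subst integrable_cong_AE[of _ _ "\<lambda>x. (norm (f x))\<^sup>2"]) auto
  then have g2: "integrable lborel (\<lambda>x. (norm (g x))\<^sup>2)" by (simp add: integrable_completion)
  have [measurable]: "(\<lambda>x. cis (- (x \<bullet> \<xi>))) \<in> borel_measurable lebesgue" for \<xi> :: 'a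
    by (intro measurable_completion) simp
  have "AE x in lebesgue. cis (- (x \<bullet> \<xi>)) * f x = cis (- (x \<bullet> \<xi>)) * g x" for \<xi>
    using fg by eventually_elim simp
  then have F: "fourier f = fourier g"
    unfolding fourier_def[abs_def] by (auto intro!: integral_cong_AE)
  have [measurable]: "fourier g \<in> borel_measurable borel" using g1 by (simp add: integrable_completion)
  show "fourier f \<in> L2"
    unfolding F using plancherel_borel(1)[OF g g1 g2] by (simp add: L2_def measurable_completion integrable_completion)
  show "(L2_norm (fourier f))\<^sup>2 = (2 * pi) ^ DIM('a) * (L2_norm f)\<^sup>2"
    unfolding F L2_norm_cong_AE[OF fg L2D(1)[OF f2] gl]
    using plancherel_borel(2)[OF g g1 g2] by (simp add: L2_norm_power2 integral_completion)
qed

section \<open>From the weak formulation to an ordinary differential equation\<close>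

lemma test_function_L2:
  assumes "\<psi> \<in> test_functions UNIV"
  shows "(\<lambda>x. complex_of_real (\<psi> x)) \<in> L2"
proof -
  obtain K where K: "\<And>x. \<bar>\<psi> x\<bar> \<le> K" "\<And>x. \<psi> x \<noteq> 0 \<Longrightarrow> norm x \<le> K"
    using test_functions_bounded[OF assms] by blast
  show ?thesis
  proof (rule L2_continuous_bounded_support)
    show "continuous_on UNIV (\<lambda>x. complex_of_real (\<psi> x))"
      by (intro continuous_intros Ck_continuous[OF test_functionsD(1)[OF assms]])
    show "norm (complex_of_real (\<psi> x)) \<le> K" for x using K(1) by simp
    show "complex_of_real (\<psi> x) = 0" if "norm x > K" for x using K(2)[of x] that by auto
  qed
qed

lemma has_vector_derivative_integral_halfline:
  fixes j :: "real \<Rightarrow> complex"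
  assumes "continuous_on {0..} j" "t \<ge> 0"
  shows "((\<lambda>t. integral {0..t} j) has_vector_derivative j t) (at t within {0..})"
proof -
  have "((\<lambda>t. integral {0..t} j) has_vector_derivative j t) (at t within {0..t+1})"
    using assms by (intro integral_has_vector_derivative continuous_on_subset[OF assms(1)]) auto
  moreover have "at t within {0..t+1} = at t within {0..}"
    by (rule at_within_nhd[of t "{..<t+1}"]) auto
  ultimately show ?thesis by simp
qed

lemma has_vector_derivative_within_at:
  fixes t :: real
  shows "(f has_vector_derivative f') (at t within {0..}) \<Longrightarrow> t > 0 \<Longrightarrow> (f has_vector_derivative f') (at t)"
  by (subst (asm) at_within_interior) auto

text \<open>Integration by parts moves one derivative from \<theta>'' p to q and one from j to its
  primitive J. What remains is that \<theta>' annihilates q + J - r.\<close>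

lemma weak_equation_test:
  fixes p q r j J :: "real \<Rightarrow> complex"
  assumes \<theta>: "\<theta> \<in> test_functions {0<..}"
    and supp: "0 < \<alpha>" "\<alpha> < \<alpha>'" "\<beta>' < \<beta>" "\<alpha> \<le> \<beta>" "\<And>t. t \<notin> {\<alpha>'..\<beta>'} \<Longrightarrow> \<theta> t = 0"
    and p: "\<And>t. t \<ge> 0 \<Longrightarrow> (p has_vector_derivative q t) (at t within {0..})"
    and J: "\<And>t. t \<ge> 0 \<Longrightarrow> (J has_vector_derivative j t) (at t within {0..})"
    and cont: "continuous_on {0..} q" "continuous_on {0..} r" "continuous_on {0..} j"
    and eq: "(LINT t:{0<..}|lebesgue. dir_deriv 1 (dir_deriv 1 \<theta>) t *\<^sub>R p t + dir_deriv 1 \<theta> t *\<^sub>R r t + \<theta> t *\<^sub>R j t) = 0"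
  shows "integral {\<alpha>..\<beta>} (\<lambda>t. dir_deriv 1 \<theta> t *\<^sub>R (q t + J t - r t)) = 0"
proof -
  define \<theta>1 \<theta>2 where "\<theta>1 = dir_deriv 1 \<theta>" and "\<theta>2 = dir_deriv 1 \<theta>1"
  have z: "\<theta> t = 0" "\<theta>1 t = 0" "\<theta>2 t = 0" if "t \<notin> {\<alpha>'..\<beta>'}" for t
  proof -
    show "\<theta> t = 0" using supp(5) that .
    have z1: "\<theta>1 s = 0" if "s \<notin> {\<alpha>'..\<beta>'}" for s
      unfolding \<theta>1_def by (rule dir_deriv_eq_0[of "- {\<alpha>'..\<beta>'}"]) (use that supp(5) in auto)
    then show "\<theta>1 t = 0" using that .
    show "\<theta>2 t = 0"
      unfolding \<theta>2_def by (rule dir_deriv_eq_0[of "- {\<alpha>'..\<beta>'}"]) (use that z1 in auto)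
  qed
  have Ck: "Ck k \<theta>" "Ck k \<theta>1" "Ck k \<theta>2" for k
    using test_functionsD(1)[OF \<theta>] test_functionsD(1)[OF test_functions_dir_deriv[OF \<theta>]]
      test_functionsD(1)[OF test_functions_dir_deriv[OF test_functions_dir_deriv[OF \<theta>]]]
    by (simp_all add: \<theta>1_def \<theta>2_def)
  have d: "(f has_real_derivative dir_deriv 1 f t) (at t)" if "\<And>k. Ck k f" for f :: "real \<Rightarrow> real" and t
  proof -
    have "f differentiable (at t)" using that[of "Suc 0"] by simp
    then have "(\<lambda>h. dir_deriv h f t) = (*) (dir_deriv 1 f t)"
      by (intro ext) (subst dir_deriv_basis_sum, simp_all)
    with has_derivative_dir_deriv[OF \<open>f differentiable (at t)\<close>] show ?thesis
      unfolding has_field_derivative_def by (simp only:)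
  qed
  have sub: "{\<alpha>..\<beta>} \<subseteq> {0..}" "{\<alpha>..\<beta>} \<subseteq> {0<..}" using supp by auto
  note cont' = cont[THEN continuous_on_subset, OF sub(1)]
  have c\<theta>: "continuous_on {\<alpha>..\<beta>} \<theta>" "continuous_on {\<alpha>..\<beta>} \<theta>1" "continuous_on {\<alpha>..\<beta>} \<theta>2"
    using continuous_on_subset[OF Ck_continuous[OF Ck(1)] subset_UNIV]
      continuous_on_subset[OF Ck_continuous[OF Ck(2)] subset_UNIV]
      continuous_on_subset[OF Ck_continuous[OF Ck(3)] subset_UNIV] by simp_all
  have "continuous_on {0..} p" "continuous_on {0..} J"
    using continuous_on_vector_derivative[of "{0..}" p q] continuous_on_vector_derivative[of "{0..}" J j] p J
    by simp_all
  then have cp: "continuous_on {\<alpha>..\<beta>} p" "continuous_on {\<alpha>..\<beta>} J"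
    using sub(1) by (auto intro: continuous_on_subset)
  let ?F = "\<lambda>t. \<theta>2 t *\<^sub>R p t + \<theta>1 t *\<^sub>R r t + \<theta> t *\<^sub>R j t"
  have "(LINT t:{0<..}|lebesgue. ?F t) = (LINT t:{\<alpha>..\<beta>}|lebesgue. ?F t)"
    unfolding set_lebesgue_integral_def
    by (intro Bochner_Integration.integral_cong) (use supp z in \<open>auto simp: indicator_def not_le not_less\<close>)
  also have "\<dots> = integral {\<alpha>..\<beta>} ?F"
    by (intro set_lebesgue_integral_eq_integral absolutely_integrable_continuous_real continuous_intros c\<theta> cp cont')
  finally have F: "integral {\<alpha>..\<beta>} ?F = 0" using eq by (simp add: \<theta>1_def \<theta>2_def)
  \<comment> \<open>The integrand is the derivative of \<theta>' p + \<theta> J. Boundary terms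
    vanish because \<alpha> and \<beta> lie strictly outside the interval that carries
    \<theta>.\<close>
  have "((\<lambda>t. \<theta>2 t *\<^sub>R p t + \<theta>1 t *\<^sub>R q t + (\<theta>1 t *\<^sub>R J t + \<theta> t *\<^sub>R j t)) has_integral
      (\<theta>1 \<beta> *\<^sub>R p \<beta> + \<theta> \<beta> *\<^sub>R J \<beta>) - (\<theta>1 \<alpha> *\<^sub>R p \<alpha> + \<theta> \<alpha> *\<^sub>R J \<alpha>)) {\<alpha>..\<beta>}"
  proof (rule fundamental_theorem_of_calculus[OF supp(4)])
    fix t assume "t \<in> {\<alpha>..\<beta>}"
    then have t: "t > 0" "t \<ge> 0" using supp by auto
    note pd = has_vector_derivative_within_at[OF p[OF t(2)] t(1)] and Jd = has_vector_derivative_within_at[OF J[OF t(2)] t(1)]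
    have "((\<lambda>t. \<theta>1 t *\<^sub>R p t + \<theta> t *\<^sub>R J t) has_vector_derivative
        (\<theta>1 t *\<^sub>R q t + \<theta>2 t *\<^sub>R p t) + (\<theta> t *\<^sub>R j t + \<theta>1 t *\<^sub>R J t)) (at t)"
      unfolding \<theta>2_def using d[OF Ck(1), of t, folded \<theta>1_def] d[OF Ck(2), of t]
      by (rule has_vector_derivative_add[OF has_vector_derivative_scaleR[OF _ pd] has_vector_derivative_scaleR[OF _ Jd], rotated])
    then show "((\<lambda>t. \<theta>1 t *\<^sub>R p t + \<theta> t *\<^sub>R J t) has_vector_derivative
        \<theta>2 t *\<^sub>R p t + \<theta>1 t *\<^sub>R q t + (\<theta>1 t *\<^sub>R J t + \<theta> t *\<^sub>R j t)) (at t within {\<alpha>..\<beta>})"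
      by (rule has_vector_derivative_at_within[THEN has_vector_derivative_eq_rhs]) (simp add: add_ac)
  qed
  then have "((\<lambda>t. \<theta>2 t *\<^sub>R p t + \<theta>1 t *\<^sub>R q t + (\<theta>1 t *\<^sub>R J t + \<theta> t *\<^sub>R j t)) has_integral 0) {\<alpha>..\<beta>}"
    using supp z by simp
  moreover have "(?F has_integral 0) {\<alpha>..\<beta>}"
    unfolding F[symmetric]
    by (intro integrable_integral integrable_continuous_real continuous_intros c\<theta> cp cont')
  ultimately have "((\<lambda>t. \<theta>2 t *\<^sub>R p t + \<theta>1 t *\<^sub>R q t + (\<theta>1 t *\<^sub>R J t + \<theta> t *\<^sub>R j t) - ?F t) has_integral 0 - 0) {\<alpha>..\<beta>}"
    by (rule has_integral_diff)
  then have "((\<lambda>t. \<theta>1 t *\<^sub>R (q t + J t - r t)) has_integral 0) {\<alpha>..\<beta>}"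
    by (simp add: algebra_simps)
  then show ?thesis unfolding \<theta>1_def by (rule integral_unique)
qed

text \<open>The difference of two shifted copies of the step N has compact support, and its
  derivative is a difference of two mollifiers \<eta>; such functions are tested with in
  \<open>weak_equation_constant\<close>.\<close>

lemma smooth_step_exists:
  "\<exists>N \<eta> :: real \<Rightarrow> real. (\<forall>k. Ck k N) \<and> (\<forall>x. (N has_real_derivative \<eta> x) (at x)) \<and>
    (\<forall>x. \<bar>x\<bar> \<ge> 1 \<longrightarrow> \<eta> x = 0) \<and> (\<forall>x\<le>-1. N x = 0) \<and> (\<forall>x\<ge>1. N x = 1) \<and>
    continuous_on UNIV \<eta> \<and> integral\<^sup>L lborel \<eta> = 1 \<and> integrable lborel \<eta>"
proof -
  obtain \<phi> :: "real \<Rightarrow> real" where \<phi>: "\<phi> \<in> test_functions UNIV" "\<And>x. 0 \<le> \<phi> x" "\<phi> 0 = 1" "\<And>x. norm x \<ge> 1 \<Longrightarrow> \<phi> x = 0"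
    using cutoff_exists[where 'a = real] by blast
  have c: "continuous_on S \<phi>" for S
    using Ck_continuous[OF test_functionsD(1)[OF \<phi>(1)]] continuous_on_subset by blast
  \<comment> \<open>The base point -2 lies to the left of the support of \<phi>, so M is a primitive
    on the whole line although the integral is taken from a finite point.\<close>
  define M where "M x = integral {-2..x} \<phi>" for x
  have M0: "M x = 0" if "x \<le> -1" for x
    unfolding M_def using \<phi>(4) that by (intro integral_unique has_integral_is_0) auto
  have Md: "(M has_real_derivative \<phi> x) (at x)" for x
  proof (cases "x > -2")
    case True
    have "(M has_real_derivative \<phi> x) (at x within {-2..x+1})"
      unfolding M_def[abs_def] using True by (intro integral_has_real_derivative c) auto
    then show ?thesis using True by (subst (asm) at_within_interior) auto
  next
    case False
    have "((\<lambda>_. 0) has_real_derivative \<phi> x) (at x)" using \<phi>(4)[of x] False by simp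
    then show ?thesis
      by (rule has_field_derivative_transform_within_open[of _ _ _ "{..<-1}"]) (use False M0 in auto)
  qed
  have M1: "M x = M 1" if "x \<ge> 1" for x
  proof -
    have "integral {1..x} \<phi> = 0"
      using \<phi>(4) by (intro integral_unique has_integral_is_0) auto
    moreover have "integral {-2..1} \<phi> + integral {1..x} \<phi> = integral {-2..x} \<phi>"
      using that by (intro Henstock_Kurzweil_Integration.integral_combine integrable_continuous_real c) auto
    ultimately show ?thesis by (simp add: M_def)
  qed
  have i: "integrable lborel \<phi>" "integral\<^sup>L lborel \<phi> = M 1"
  proof -
    have eq: "(\<lambda>x. indicator {-2..1} x *\<^sub>R \<phi> x) = \<phi>" by (rule ext, rename_tac x, case_tac "x \<in> {-2..1}") (use \<phi>(4) in auto)
    have "set_integrable lborel {-2..1} \<phi>" by (rule borel_integrable_atLeastAtMost'[OF c])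
    then show "integrable lborel \<phi>" by (simp only: set_integrable_def eq)
    have "(LINT x:{-2..1}|lborel. \<phi> x) = M 1"
      unfolding M_def by (rule set_borel_integral_eq_integral(2)) fact
    then show "integral\<^sup>L lborel \<phi> = M 1" by (simp only: set_lebesgue_integral_def eq)
  qed
  have "M 1 > 0"
  proof -
    have "M 1 \<noteq> 0"
    proof
      assume "M 1 = 0"
      then have "\<forall>x\<in>{-2..1}. \<phi> x = 0"
        unfolding M_def using \<phi>(2) by (subst (asm) integral_eq_0_iff) (auto intro: c)
      then show False using \<phi>(3) by auto
    qed
    moreover have "M 1 \<ge> 0" unfolding i(2)[symmetric] using \<phi>(2) by simp
    ultimately show ?thesis by simp
  qed
  define N \<eta> where "N x = inverse (M 1) * M x" and "\<eta> x = inverse (M 1) * \<phi> x" for x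
  show ?thesis
  proof (rule exI[of _ N], rule exI[of _ \<eta>], intro conjI allI impI)
    have "Ck (Suc k) M" for k by (rule Ck_Suc_real[OF Md test_functionsD(1)[OF \<phi>(1)]])
    then have "Ck k M" for k by (rule Ck_Suc_imp)
    then show "Ck k N" for k unfolding N_def by (intro Ck_mult Ck_const)
    show "(N has_real_derivative \<eta> x) (at x)" for x
      unfolding N_def[abs_def] \<eta>_def by (intro DERIV_cmult Md)
    show "N x = 1" if "1 \<le> x" for x
      unfolding N_def M1[OF that] using \<open>M 1 > 0\<close> by simp
    show "N x = 0" if "x \<le> -1" for x using M0[OF that] by (simp add: N_def)
    show "\<eta> x = 0" if "\<bar>x\<bar> \<ge> 1" for x using \<phi>(4) that by (simp add: \<eta>_def)
    show "continuous_on UNIV \<eta>" unfolding \<eta>_def by (intro continuous_intros c)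
    show "integral\<^sup>L lborel \<eta> = 1" "integrable lborel \<eta>"
      unfolding \<eta>_def using i \<open>M 1 > 0\<close> by simp_all
  qed
qed

text \<open>A du Bois-Reymond argument: \<open>\<theta>'\<close> runs through differences of mollifiers at \<open>a\<close> and \<open>b\<close>.\<close>

lemma weak_equation_constant:
  fixes p q r j J :: "real \<Rightarrow> complex"
  assumes p: "\<And>t. t \<ge> 0 \<Longrightarrow> (p has_vector_derivative q t) (at t within {0..})"
    and J: "\<And>t. t \<ge> 0 \<Longrightarrow> (J has_vector_derivative j t) (at t within {0..})"
    and cont: "continuous_on {0..} q" "continuous_on {0..} r" "continuous_on {0..} j"
    and eq: "\<And>\<theta>. \<theta> \<in> test_functions {0<..} \<Longrightarrow>
      (LINT t:{0<..}|lebesgue. dir_deriv 1 (dir_deriv 1 \<theta>) t *\<^sub>R p t + dir_deriv 1 \<theta> t *\<^sub>R r t + \<theta> t *\<^sub>R j t) = 0"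
    and ab: "0 < a" "a < b"
  shows "q a + J a - r a = q b + J b - r b"
proof -
  obtain N \<eta> :: "real \<Rightarrow> real" where N: "\<And>k. Ck k N" "\<And>x. (N has_real_derivative \<eta> x) (at x)"
      "\<And>x. \<bar>x\<bar> \<ge> 1 \<Longrightarrow> \<eta> x = 0" "\<And>x. x \<le> -1 \<Longrightarrow> N x = 0" "\<And>x. x \<ge> 1 \<Longrightarrow> N x = 1"
    and \<eta>: "continuous_on UNIV \<eta>" "integral\<^sup>L lborel \<eta> = 1" "integrable lborel \<eta>"
    using smooth_step_exists by blast
  \<comment> \<open>Freezing K at negative times makes it continuous on the whole line.\<close>
  define K where "K t = q (max 0 t) + J (max 0 t) - r (max 0 t)" for t
  have cJ: "continuous_on {0..} J"
    by (rule continuous_on_vector_derivative[of _ _ j]) (use J in auto)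
  have cK: "continuous_on S K" for S
    unfolding K_def using cont cJ
    by (intro continuous_intros continuous_on_compose2[of "{0..}" _ S "\<lambda>t. max 0 t"]) auto
  have [measurable]: "\<eta> \<in> borel_measurable borel" "K \<in> borel_measurable borel"
    using \<eta>(1) cK by (auto intro: borel_measurable_continuous_onI)
  \<comment> \<open>The bound \<delta> < a / 2 keeps the slightly enlarged interval from a -
    2\<delta> to b + 2\<delta> within positive times.\<close>
  have key: "(LINT s|lborel. \<eta> s *\<^sub>R K (a + \<delta> * s)) = (LINT s|lborel. \<eta> s *\<^sub>R K (b + \<delta> * s))"
    if \<delta>: "0 < \<delta>" "\<delta> < a / 2" for \<delta>
  proof -
    define \<theta> where "\<theta> t = N (inverse \<delta> * t + (- (a / \<delta>))) + - 1 * N (inverse \<delta> * t + (- (b / \<delta>)))" for t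
    have Ck: "Ck k \<theta>" for k
      unfolding \<theta>_def by (intro Ck_add Ck_mult Ck_const Ck_compose_real[OF N(1)] Ck_ident)
    have \<theta>': "dir_deriv 1 \<theta> t = inverse \<delta> * (\<eta> ((t - a) / \<delta>) - \<eta> ((t - b) / \<delta>))" for t
    proof (rule dir_deriv_real)
      have e: "inverse \<delta> * t + - (c / \<delta>) = (t - c) / \<delta>" for c t using \<delta> by (simp add: field_simps)
      have "((\<lambda>t. N ((t - c) / \<delta>)) has_real_derivative \<eta> ((t - c) / \<delta>) * inverse \<delta>) (at t)" for c
        by (rule DERIV_chain2[OF N(2)]) (use \<delta> in \<open>auto intro!: derivative_eq_intros simp: field_simps\<close>)
      from DERIV_diff[OF this[of a] this[of b]]
      show "(\<theta> has_real_derivative inverse \<delta> * (\<eta> ((t - a) / \<delta>) - \<eta> ((t - b) / \<delta>))) (at t)"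
        unfolding \<theta>_def[abs_def] e by (simp add: algebra_simps)
    qed
    let ?A = "a - \<delta>" and ?B = "b + \<delta>"
    have z: "\<theta> t = 0" if "t \<notin> {?A..?B}" for t
    proof -
      have e: "inverse \<delta> * t + - (c / \<delta>) = (t - c) / \<delta>" for c using \<delta> by (simp add: field_simps)
      from that consider "t < ?A" | "t > ?B" by force
      then show ?thesis
      proof cases
        case 1
        then have "(t - a) / \<delta> \<le> -1" "(t - b) / \<delta> \<le> -1" using \<delta> ab by (auto simp: field_simps)
        then show ?thesis unfolding \<theta>_def e by (simp add: N(4))
      next
        case 2
        then have "(t - a) / \<delta> \<ge> 1" "(t - b) / \<delta> \<ge> 1" using \<delta> ab by (auto simp: field_simps)
        then show ?thesis unfolding \<theta>_def e by (simp add: N(5))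
      qed
    qed
    have \<theta>: "\<theta> \<in> test_functions {0<..}"
      by (rule test_functionsI[of _ "{?A..?B}"]) (use Ck \<delta> ab z in auto)
    have I0: "integral {a - 2 * \<delta>..b + 2 * \<delta>} (\<lambda>t. dir_deriv 1 \<theta> t *\<^sub>R (q t + J t - r t)) = 0"
      by (rule weak_equation_test[OF \<theta> _ _ _ _ z p J cont eq[OF \<theta>]]) (use \<delta> ab in auto)
    have int: "integrable lborel (\<lambda>t. (inverse \<delta> * \<eta> ((t - c) / \<delta>)) *\<^sub>R K t)" for c
    proof -
      have "set_integrable lborel {c - \<delta>..c + \<delta>} (\<lambda>t. (inverse \<delta> * \<eta> ((t - c) / \<delta>)) *\<^sub>R K t)"
        by (rule borel_integrable_atLeastAtMost')
          (use \<delta> in \<open>intro continuous_intros cK continuous_on_compose2[OF \<eta>(1)], auto\<close>)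
      moreover have "(\<lambda>t. indicat_real {c - \<delta>..c + \<delta>} t *\<^sub>R (inverse \<delta> * \<eta> ((t - c) / \<delta>)) *\<^sub>R K t)
          = (\<lambda>t. (inverse \<delta> * \<eta> ((t - c) / \<delta>)) *\<^sub>R K t)"
      proof
        fix t
        have "\<bar>(t - c) / \<delta>\<bar> \<ge> 1" if "t \<notin> {c - \<delta>..c + \<delta>}"
          using that \<delta> by (auto simp: abs_if field_simps)
        then show "indicat_real {c - \<delta>..c + \<delta>} t *\<^sub>R (inverse \<delta> * \<eta> ((t - c) / \<delta>)) *\<^sub>R K t
          = (inverse \<delta> * \<eta> ((t - c) / \<delta>)) *\<^sub>R K t"
          using N(3) by (cases "t \<in> {c - \<delta>..c + \<delta>}") auto
      qed
      ultimately show "integrable lborel (\<lambda>t. (inverse \<delta> * \<eta> ((t - c) / \<delta>)) *\<^sub>R K t)"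
        by (simp only: set_integrable_def)
    qed
    have aff: "(LINT t|lborel. (inverse \<delta> * \<eta> ((t - c) / \<delta>)) *\<^sub>R K t) = (LINT s|lborel. \<eta> s *\<^sub>R K (c + \<delta> * s))" for c
    proof -
      have "(LINT t|lborel. (inverse \<delta> * \<eta> ((t - c) / \<delta>)) *\<^sub>R K t) =
          \<bar>\<delta>\<bar> *\<^sub>R (LINT s|lborel. (inverse \<delta> * \<eta> ((c + \<delta> * s - c) / \<delta>)) *\<^sub>R K (c + \<delta> * s))"
        by (rule lborel_integral_real_affine) (use \<delta> in auto)
      also have "\<dots> = \<bar>\<delta>\<bar> *\<^sub>R (LINT s|lborel. inverse \<delta> *\<^sub>R (\<eta> s *\<^sub>R K (c + \<delta> * s)))"
        using \<delta> by (simp only: scaleR_scaleR) simp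
      also have "\<dots> = (LINT s|lborel. \<eta> s *\<^sub>R K (c + \<delta> * s))"
        using \<delta> by (simp only: integral_scaleR_right) simp
      finally show ?thesis .
    qed
    have "integral {a - 2 * \<delta>..b + 2 * \<delta>} (\<lambda>t. dir_deriv 1 \<theta> t *\<^sub>R (q t + J t - r t)) =
        integral {a - 2 * \<delta>..b + 2 * \<delta>} (\<lambda>t. dir_deriv 1 \<theta> t *\<^sub>R K t)"
      by (rule integral_cong) (use \<delta> in \<open>auto simp: K_def max_def\<close>)
    also have "\<dots> = (LINT t:{a - 2 * \<delta>..b + 2 * \<delta>}|lborel. dir_deriv 1 \<theta> t *\<^sub>R K t)"
      by (rule set_borel_integral_eq_integral(2)[symmetric], rule borel_integrable_atLeastAtMost')
        (intro continuous_intros cK continuous_on_subset[OF Ck_continuous[OF test_functionsD(1)[OF test_functions_dir_deriv[OF \<theta>]]]] subset_UNIV)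
    also have "\<dots> = (LINT t|lborel. (inverse \<delta> * \<eta> ((t - a) / \<delta>)) *\<^sub>R K t - (inverse \<delta> * \<eta> ((t - b) / \<delta>)) *\<^sub>R K t)"
      unfolding set_lebesgue_integral_def
    proof (intro Bochner_Integration.integral_cong refl)
      fix t
      have "\<eta> ((t - a) / \<delta>) = 0 \<and> \<eta> ((t - b) / \<delta>) = 0" if "t \<notin> {a - 2 * \<delta>..b + 2 * \<delta>}"
      proof -
        from that consider "t < ?A" | "t > ?B" using \<delta> by force
        then have "\<bar>(t - a) / \<delta>\<bar> \<ge> 1 \<and> \<bar>(t - b) / \<delta>\<bar> \<ge> 1"
          by cases (use \<delta> ab in \<open>auto simp: field_simps\<close>)
        then show ?thesis using N(3) by blast
      qed
      then show "indicat_real {a - 2 * \<delta>..b + 2 * \<delta>} t *\<^sub>R dir_deriv 1 \<theta> t *\<^sub>R K t =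
          (inverse \<delta> * \<eta> ((t - a) / \<delta>)) *\<^sub>R K t - (inverse \<delta> * \<eta> ((t - b) / \<delta>)) *\<^sub>R K t"
        by (auto simp: \<theta>' indicator_def algebra_simps)
    qed
    also have "\<dots> = (LINT t|lborel. (inverse \<delta> * \<eta> ((t - a) / \<delta>)) *\<^sub>R K t) - (LINT t|lborel. (inverse \<delta> * \<eta> ((t - b) / \<delta>)) *\<^sub>R K t)"
      by (rule Bochner_Integration.integral_diff[OF int int])
    also have "\<dots> = (LINT s|lborel. \<eta> s *\<^sub>R K (a + \<delta> * s)) - (LINT s|lborel. \<eta> s *\<^sub>R K (b + \<delta> * s))"
      by (simp only: aff)
    finally show ?thesis using I0 by simp
  qed
  \<comment> \<open>Admissible values of \<delta> tending to 0.\<close>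
  define s where "s k = (a / 4) * (1 / real (Suc k))" for k
  have s: "0 < s k" "s k < a / 2" "s k \<le> a" for k
  proof -
    show "0 < s k" using ab by (simp add: s_def)
    have "s k \<le> (a / 4) * 1" unfolding s_def using ab by (intro mult_left_mono) auto
    then show "s k < a / 2" "s k \<le> a" using ab by linarith+
  qed
  have s0: "s \<longlonglongrightarrow> 0"
    unfolding s_def by (intro tendsto_mult_right_zero lim_1_over_n[THEN LIMSEQ_Suc])
  have lim: "(\<lambda>k. LINT t|lborel. \<eta> t *\<^sub>R K (c + s k * t)) \<longlonglongrightarrow> K c" for c
  proof -
    have "compact (K ` {c - a..c + a})" by (intro compact_continuous_image cK) simp
    then obtain B where B: "\<And>t. t \<in> {c - a..c + a} \<Longrightarrow> norm (K t) \<le> B"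
      using compact_imp_bounded bounded_iff by (metis imageI)
    have "(\<lambda>k. LINT t|lborel. \<eta> t *\<^sub>R K (c + s k * t)) \<longlonglongrightarrow> (LINT t|lborel. \<eta> t *\<^sub>R K c)"
    proof (rule integral_dominated_convergence)
      show "integrable lborel (\<lambda>t. norm (\<eta> t) * B)" using \<eta>(3) by simp
      show "AE t in lborel. norm (\<eta> t *\<^sub>R K (c + s k * t)) \<le> norm (\<eta> t) * B" for k
      proof (rule AE_I2)
        fix t
        show "norm (\<eta> t *\<^sub>R K (c + s k * t)) \<le> norm (\<eta> t) * B"
        proof (cases "\<bar>t\<bar> \<ge> 1")
          case False
          then have "\<bar>s k * t\<bar> \<le> a * 1" unfolding abs_mult using s[of k] by (intro mult_mono) auto
          then have "c + s k * t \<in> {c - a..c + a}" by auto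
          then show ?thesis using B by (simp add: mult_left_mono)
        qed (simp add: N(3))
      qed
      show "AE t in lborel. (\<lambda>k. \<eta> t *\<^sub>R K (c + s k * t)) \<longlonglongrightarrow> \<eta> t *\<^sub>R K c"
      proof (rule AE_I2)
        fix t
        have "(\<lambda>k. c + s k * t) \<longlonglongrightarrow> c + 0 * t" by (intro tendsto_intros s0)
        moreover have "isCont K (c + 0 * t)" using cK[of UNIV] by (simp add: continuous_on_eq_continuous_at)
        ultimately have "(\<lambda>k. K (c + s k * t)) \<longlonglongrightarrow> K (c + 0 * t)" by (rule isCont_tendsto_compose[rotated])
        then show "(\<lambda>k. \<eta> t *\<^sub>R K (c + s k * t)) \<longlonglongrightarrow> \<eta> t *\<^sub>R K c" by (intro tendsto_intros) simp
      qed
    qed auto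
    also have "(LINT t|lborel. \<eta> t *\<^sub>R K c) = K c"
      using \<eta>(2,3) by (subst integral_scaleR_left) auto
    finally show ?thesis .
  qed
  have "K a = K b"
    using LIMSEQ_unique[OF lim[of a]] lim[of b] by (simp only: key[OF s(1,2)])
  then show ?thesis using ab by (simp add: K_def)
qed

text \<open>Since q + J - r is constant, q equals a constant plus r - J. The right-hand side is
  differentiable, so q, a priori only continuous, is differentiable as well.\<close>

lemma weak_equation_derivative:
  fixes p q r r' j :: "real \<Rightarrow> complex"
  assumes p: "\<And>t. t \<ge> 0 \<Longrightarrow> (p has_vector_derivative q t) (at t within {0..})"
    and r: "\<And>t. t \<ge> 0 \<Longrightarrow> (r has_vector_derivative r' t) (at t within {0..})"
    and cont: "continuous_on {0..} q" "continuous_on {0..} j"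
    and eq: "\<And>\<theta>. \<theta> \<in> test_functions {0<..} \<Longrightarrow>
      (LINT t:{0<..}|lebesgue. dir_deriv 1 (dir_deriv 1 \<theta>) t *\<^sub>R p t + dir_deriv 1 \<theta> t *\<^sub>R r t + \<theta> t *\<^sub>R j t) = 0"
    and t: "t \<ge> 0"
  shows "(q has_vector_derivative r' t - j t) (at t within {0..})"
proof -
  define J where "J t = integral {0..t} j" for t
  have J: "(J has_vector_derivative j t) (at t within {0..})" if "t \<ge> 0" for t
    unfolding J_def using that by (intro has_vector_derivative_integral_halfline cont)
  define K where "K t = q t + J t - r t" for t
  have cr: "continuous_on {0..} r" "continuous_on {0..} J"
    using continuous_on_vector_derivative[of "{0..}" r r'] continuous_on_vector_derivative[of "{0..}" J j] r J by auto
  have cK: "continuous_on {0..} K" unfolding K_def by (intro continuous_intros cont cr)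
  have K1: "K s = K 1" if "s > 0" for s
  proof -
    have c: "K a = K b" if "0 < a" "a < b" for a b
      unfolding K_def
      by (rule weak_equation_constant[where p = p and j = j]) (erule p J eq | rule cont cr that)+
    show ?thesis
      by (metis c that zero_less_one linorder_less_linear)
  qed
  \<comment> \<open>Test functions see positive times only; continuity carries the constant to t =
    0, where the initial data are read off.\<close>
  have "K 0 = K 1"
  proof -
    have "(K \<longlongrightarrow> K 0) (at 0 within {0..})" using cK by (simp add: continuous_on_def)
    then have "(K \<longlongrightarrow> K 0) (at 0 within {0<..})" by (rule tendsto_within_subset) auto
    moreover have "(K \<longlongrightarrow> K 1) (at 0 within {0<..})"
      by (rule tendsto_eventually, unfold eventually_at_filter, rule always_eventually)
        (use K1 greaterThan_iff in blast)
    ultimately show ?thesis by (rule tendsto_unique[rotated]) simp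
  qed
  then have q: "q s = K 1 + r s - J s" if "s \<ge> 0" for s
    using K1[of s] that unfolding K_def by (cases "s = 0") (simp_all add: algebra_simps)
  have "((\<lambda>s. K 1 + r s - J s) has_vector_derivative 0 + r' t - j t) (at t within {0..})"
    by (intro has_vector_derivative_diff has_vector_derivative_add has_vector_derivative_const r J t)
  then have "((\<lambda>s. K 1 + r s - J s) has_vector_derivative r' t - j t) (at t within {0..})" by simp
  then show ?thesis
    by (rule has_vector_derivative_transform[rotated 2]) (use q t in auto)
qed

section \<open>Pairings of the solution with test functions\<close>

text \<open>Bilinear, without a conjugate, since the first argument will be a real test
  function.\<close>

definition pairing :: "('a::euclidean_space \<Rightarrow> complex) \<Rightarrow> ('a \<Rightarrow> complex) \<Rightarrow> complex" where
  "pairing K g = (LINT x|lebesgue. K x * g x)"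

lemma pairing_diff:
  assumes "K \<in> L2" "f \<in> L2" "g \<in> L2"
  shows "pairing K f - pairing K g = pairing K (\<lambda>x. f x - g x)"
  using L2_mult_integrable[OF assms(1,2)] L2_mult_integrable[OF assms(1,3)]
  by (simp add: pairing_def right_diff_distrib)

lemma norm_pairing_le: "K \<in> L2 \<Longrightarrow> g \<in> L2 \<Longrightarrow> norm (pairing K g) \<le> L2_norm K * L2_norm g"
  unfolding pairing_def by (rule L2_Cauchy_Schwarz)

lemma continuous_on_pairing:
  assumes K: "K \<in> L2" and g: "continuous_curve L2 L2_norm g"
  shows "continuous_on {0..} (\<lambda>t. pairing K (g t))"
  unfolding continuous_on_def
proof
  fix t :: real assume t: "t \<in> {0..}"
  have gL: "g s \<in> L2" if "s \<ge> 0" for s using g that by (simp add: continuous_curve_def)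
  have L: "((\<lambda>s. L2_norm K * L2_norm (\<lambda>x. g s x - g t x)) \<longlongrightarrow> L2_norm K * 0) (at t within {0..})"
    using g t by (intro tendsto_mult_left) (simp add: continuous_curve_def)
  have "((\<lambda>s. pairing K (g s) - pairing K (g t)) \<longlongrightarrow> 0) (at t within {0..})"
  proof (rule Lim_null_comparison)
    show "((\<lambda>s. L2_norm K * L2_norm (\<lambda>x. g s x - g t x)) \<longlongrightarrow> 0) (at t within {0..})" using L by simp
    have "norm (pairing K (g s) - pairing K (g t)) \<le> L2_norm K * L2_norm (\<lambda>x. g s x - g t x)" if "s \<ge> 0" for s
      using that t K gL by (simp add: pairing_diff norm_pairing_le L2_diff)
    then show "\<forall>\<^sub>F s in at t within {0..}. norm (pairing K (g s) - pairing K (g t)) \<le> L2_norm K * L2_norm (\<lambda>x. g s x - g t x)"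
      by (simp add: eventually_at_filter)
  qed
  then show "((\<lambda>s. pairing K (g s)) \<longlongrightarrow> pairing K (g t)) (at t within {0..})"
    by (rule LIM_zero_cancel)
qed

text \<open>\<open>L2_curve_deriv\<close> is phrased through difference quotients; this is the
  passage to the form used by the differentiation rules.\<close>

lemma has_vector_derivative_quotient:
  fixes t :: real
  assumes "((\<lambda>s. (f s - f t) /\<^sub>R (s - t) - D) \<longlongrightarrow> 0) (at t within S)"
  shows "(f has_vector_derivative D) (at t within S)"
  unfolding has_vector_derivative_def has_derivative_within
proof (intro conjI)
  show "bounded_linear (\<lambda>x. x *\<^sub>R D)" by (rule bounded_linear_scaleR_left)
  have "norm ((f s - f t) /\<^sub>R (s - t) - D) = norm ((1 / norm (s - t)) *\<^sub>R (f s - (f t + (s - t) *\<^sub>R D)))" if "s \<noteq> t" for s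
  proof -
    have "(1 / norm (s - t)) *\<^sub>R (f s - (f t + (s - t) *\<^sub>R D)) =
        (\<bar>s - t\<bar> / (s - t)) *\<^sub>R ((f s - f t) /\<^sub>R (s - t) - D)"
    proof -
      have "f s - (f t + (s - t) *\<^sub>R D) = (s - t) *\<^sub>R ((f s - f t) /\<^sub>R (s - t) - D)"
        using that by (simp add: scaleR_diff_right)
      moreover have "(s - t) / \<bar>s - t\<bar> = \<bar>s - t\<bar> / (s - t)"
        using that by (simp add: divide_eq_eq eq_divide_eq abs_mult_self_eq)
      ultimately show ?thesis by simp
    qed
    then show ?thesis using that by simp
  qed
  then have "\<forall>\<^sub>F s in at t within S. norm ((f s - f t) /\<^sub>R (s - t) - D) = norm ((1 / norm (s - t)) *\<^sub>R (f s - (f t + (s - t) *\<^sub>R D)))"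
    by (simp add: eventually_at_filter)
  with tendsto_norm_zero[OF assms]
  have "((\<lambda>s. norm ((1 / norm (s - t)) *\<^sub>R (f s - (f t + (s - t) *\<^sub>R D)))) \<longlongrightarrow> 0) (at t within S)"
    by (rule Lim_transform_eventually)
  then show "((\<lambda>s. (1 / norm (s - t)) *\<^sub>R (f s - (f t + (s - t) *\<^sub>R D))) \<longlongrightarrow> 0) (at t within S)"
    by (rule tendsto_norm_zero_cancel)
qed

text \<open>By Cauchy-Schwarz, pairing with a fixed L^2 function is a bounded functional, so it
  carries an L^2 derivative over to scalars.\<close>

lemma pairing_has_derivative:
  assumes K: "K \<in> L2" and u: "\<And>t. t \<ge> 0 \<Longrightarrow> u t \<in> L2" and v: "\<And>t. t \<ge> 0 \<Longrightarrow> v t \<in> L2"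
    and d: "L2_curve_deriv u v" and t: "t \<ge> 0"
  shows "((\<lambda>t. pairing K (u t)) has_vector_derivative pairing K (v t)) (at t within {0..})"
proof -
  have L: "((\<lambda>s. L2_norm K * L2_norm (\<lambda>x. (u s x - u t x) /\<^sub>R (s - t) - v t x)) \<longlongrightarrow> L2_norm K * 0) (at t within {0..})"
    using d t by (intro tendsto_mult_left) (simp add: L2_curve_deriv_def)
  have "((\<lambda>s. (pairing K (u s) - pairing K (u t)) /\<^sub>R (s - t) - pairing K (v t)) \<longlongrightarrow> 0) (at t within {0..})"
  proof (rule Lim_null_comparison)
    show "((\<lambda>s. L2_norm K * L2_norm (\<lambda>x. (u s x - u t x) /\<^sub>R (s - t) - v t x)) \<longlongrightarrow> 0) (at t within {0..})" using L by simp
    have "norm ((pairing K (u s) - pairing K (u t)) /\<^sub>R (s - t) - pairing K (v t)) \<le>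
        L2_norm K * L2_norm (\<lambda>x. (u s x - u t x) /\<^sub>R (s - t) - v t x)" if "s \<ge> 0" for s
    proof -
      let ?c = "complex_of_real (inverse (s - t))"
      have us: "u s \<in> L2" and ut: "u t \<in> L2" and vt: "v t \<in> L2" using that t u v by auto
      note D = L2_scale[OF L2_diff[OF us ut], of ?c]
      have "(pairing K (u s) - pairing K (u t)) /\<^sub>R (s - t) = ?c * pairing K (\<lambda>x. u s x - u t x)"
        by (simp add: pairing_diff[OF K us ut] scaleR_conv_of_real)
      also have "\<dots> = pairing K (\<lambda>x. ?c * (u s x - u t x))"
        unfolding pairing_def by (subst integral_mult_right_zero[symmetric]) (simp only: mult_ac)
      finally have "(pairing K (u s) - pairing K (u t)) /\<^sub>R (s - t) - pairing K (v t) =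
          pairing K (\<lambda>x. ?c * (u s x - u t x) - v t x)"
        by (simp only: pairing_diff[OF K D vt])
      also have "norm \<dots> \<le> L2_norm K * L2_norm (\<lambda>x. ?c * (u s x - u t x) - v t x)"
        by (rule norm_pairing_le[OF K L2_diff[OF D vt]])
      finally show ?thesis by (simp add: scaleR_conv_of_real)
    qed
    then show "\<forall>\<^sub>F s in at t within {0..}. norm ((pairing K (u s) - pairing K (u t)) /\<^sub>R (s - t) - pairing K (v t)) \<le>
        L2_norm K * L2_norm (\<lambda>x. (u s x - u t x) /\<^sub>R (s - t) - v t x)"
      by (simp add: eventually_at_filter)
  qed
  then show ?thesis by (rule has_vector_derivative_quotient)
qed

text \<open>The locale names the velocity v, which \<open>weak_solution\<close> asserts to exist,
  and measures the continuity of u in L^2; \<open>H1_curve_imp_L2_curve\<close> supplies this from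
  continuity in H^1.\<close>

locale wave_solution =
  fixes m :: real and u v :: "real \<Rightarrow> 'a::euclidean_space \<Rightarrow> complex"
  assumes u: "continuous_curve L2 L2_norm u" and v: "continuous_curve L2 L2_norm v"
    and deriv: "L2_curve_deriv u v" and dist: "distributional_solution m u" and m_pos: "m > 0"
begin

lemma u_L2: "t \<ge> 0 \<Longrightarrow> u t \<in> L2" and v_L2: "t \<ge> 0 \<Longrightarrow> v t \<in> L2"
  using u v by (simp_all add: continuous_curve_def)

text \<open>For \<theta>(t) \<psi>(x) the weak formulation is the equation of
  \<open>weak_equation_derivative\<close> with p and r the pairings of u with \<psi> and
  \<open>lap \<psi>\<close>, and j = m^2 p - r. The damping term is the one that pairs \<theta>'
  with r and so contributes the derivative of r.\<close>

lemma pairing_equation: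
  assumes \<psi>: "\<psi> \<in> test_functions UNIV" and t: "t \<ge> 0"
  shows "((\<lambda>t. pairing \<psi> (v t)) has_vector_derivative
    pairing (lap \<psi>) (v t) + pairing (lap \<psi>) (u t) - of_real (m\<^sup>2) * pairing \<psi> (u t)) (at t within {0..})"
proof -
  define p q r r' where "p t = pairing \<psi> (u t)" and "q t = pairing \<psi> (v t)"
    and "r t = pairing (lap \<psi>) (u t)" and "r' t = pairing (lap \<psi>) (v t)" for t
  have K: "(\<lambda>x. complex_of_real (\<psi> x)) \<in> L2" "(\<lambda>x. complex_of_real (lap \<psi> x)) \<in> L2"
    by (intro test_function_L2 test_functions_lap \<psi>)+
  have "(q has_vector_derivative r' t - (of_real (m\<^sup>2) * p t - r t)) (at t within {0..})"
  proof (rule weak_equation_derivative[where p = p and r = r])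
    show "(p has_vector_derivative q t) (at t within {0..})" if "t \<ge> 0" for t
      unfolding p_def[abs_def] q_def by (rule pairing_has_derivative[OF K(1) u_L2 v_L2 deriv that])
    show "(r has_vector_derivative r' t) (at t within {0..})" if "t \<ge> 0" for t
      unfolding r_def[abs_def] r'_def by (rule pairing_has_derivative[OF K(2) u_L2 v_L2 deriv that])
    show "continuous_on {0..} q" unfolding q_def[abs_def] by (rule continuous_on_pairing[OF K(1) v])
    show "continuous_on {0..} (\<lambda>t. of_real (m\<^sup>2) * p t - r t)"
      unfolding p_def r_def by (intro continuous_intros continuous_on_pairing K u)
    show "t \<ge> 0" by fact
    fix \<theta> :: "real \<Rightarrow> real" assume \<theta>: "\<theta> \<in> test_functions {0<..}"
    let ?\<phi> = "\<lambda>z. \<theta> (fst z) * \<psi> (snd z)"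
    note C = test_functionsD(1)[OF \<theta>] test_functionsD(1)[OF test_functions_dir_deriv[OF \<theta>]]
      test_functionsD(1)[OF \<psi>]
    have "(LINT t:{0<..}|lebesgue. LINT x|lebesgue. (dt (dt ?\<phi>) (t, x) - laplacian ?\<phi> (t, x) + m\<^sup>2 * ?\<phi> (t, x)
        + laplacian (dt ?\<phi>) (t, x)) *\<^sub>R u t x) = 0"
      by (rule dist[unfolded distributional_solution_def, rule_format, OF test_functions_product[OF \<theta> \<psi>]])
    also have "(LINT t:{0<..}|lebesgue. LINT x|lebesgue. (dt (dt ?\<phi>) (t, x) - laplacian ?\<phi> (t, x) + m\<^sup>2 * ?\<phi> (t, x)
        + laplacian (dt ?\<phi>) (t, x)) *\<^sub>R u t x) =
      (LINT t:{0<..}|lebesgue. dir_deriv 1 (dir_deriv 1 \<theta>) t *\<^sub>R p t + dir_deriv 1 \<theta> t *\<^sub>R r t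
        + \<theta> t *\<^sub>R (of_real (m\<^sup>2) * p t - r t))"
    proof (rule set_lebesgue_integral_cong)
      show "\<forall>t. t \<in> {0<..} \<longrightarrow> (LINT x|lebesgue. (dt (dt ?\<phi>) (t, x) - laplacian ?\<phi> (t, x) + m\<^sup>2 * ?\<phi> (t, x)
        + laplacian (dt ?\<phi>) (t, x)) *\<^sub>R u t x) = dir_deriv 1 (dir_deriv 1 \<theta>) t *\<^sub>R p t + dir_deriv 1 \<theta> t *\<^sub>R r t
        + \<theta> t *\<^sub>R (of_real (m\<^sup>2) * p t - r t)"
      proof (intro allI impI)
        fix t :: real assume "t \<in> {0<..}"
        then have ut: "u t \<in> L2" by (intro u_L2) simp
        note i = L2_mult_integrable[OF K(1) ut] L2_mult_integrable[OF K(2) ut]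
        let ?a = "complex_of_real (dir_deriv 1 (dir_deriv 1 \<theta>) t + m\<^sup>2 * \<theta> t)"
        let ?b = "complex_of_real (dir_deriv 1 \<theta> t - \<theta> t)"
        have "(dt (dt ?\<phi>) (t, x) - laplacian ?\<phi> (t, x) + m\<^sup>2 * ?\<phi> (t, x) + laplacian (dt ?\<phi>) (t, x)) *\<^sub>R u t x
            = ?a * (of_real (\<psi> x) * u t x) + ?b * (of_real (lap \<psi> x) * u t x)" for x
          unfolding dt_product[OF C(1,3)] dt_product[OF C(2,3)] laplacian_product[OF C(1,3)] laplacian_product[OF C(2,3)]
          by (simp add: scaleR_conv_of_real algebra_simps)
        then have "(LINT x|lebesgue. (dt (dt ?\<phi>) (t, x) - laplacian ?\<phi> (t, x) + m\<^sup>2 * ?\<phi> (t, x) + laplacian (dt ?\<phi>) (t, x)) *\<^sub>R u t x)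
            = (LINT x|lebesgue. ?a * (of_real (\<psi> x) * u t x) + ?b * (of_real (lap \<psi> x) * u t x))"
          by (simp only:)
        also have "\<dots> = ?a * p t + ?b * r t"
          unfolding p_def r_def pairing_def
          by (simp only: Bochner_Integration.integral_add integrable_mult_right i integral_mult_right_zero)
        finally show "(LINT x|lebesgue. (dt (dt ?\<phi>) (t, x) - laplacian ?\<phi> (t, x) + m\<^sup>2 * ?\<phi> (t, x)
            + laplacian (dt ?\<phi>) (t, x)) *\<^sub>R u t x) = dir_deriv 1 (dir_deriv 1 \<theta>) t *\<^sub>R p t + dir_deriv 1 \<theta> t *\<^sub>R r t
            + \<theta> t *\<^sub>R (of_real (m\<^sup>2) * p t - r t)"
          by (simp add: scaleR_conv_of_real algebra_simps)
      qed
    qed simp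
    finally show "(LINT t:{0<..}|lebesgue. dir_deriv 1 (dir_deriv 1 \<theta>) t *\<^sub>R p t + dir_deriv 1 \<theta> t *\<^sub>R r t
        + \<theta> t *\<^sub>R (of_real (m\<^sup>2) * p t - r t)) = 0" .
  qed
  then show ?thesis
    unfolding q_def[abs_def] p_def r_def r'_def by (simp add: algebra_simps)
qed

end

section \<open>Localised Fourier transforms\<close>

definition cfourier :: "('a::euclidean_space \<Rightarrow> real) \<Rightarrow> ('a \<Rightarrow> complex) \<Rightarrow> 'a \<Rightarrow> complex" where
  "cfourier \<phi> g = fourier (\<lambda>x. of_real (\<phi> x) * g x)"

lemma test_functions_trig:
  assumes "\<phi> \<in> test_functions UNIV"
  shows "(\<lambda>x. \<phi> x * cos (x \<bullet> \<xi>)) \<in> test_functions UNIV" "(\<lambda>x. \<phi> x * sin (x \<bullet> \<xi>)) \<in> test_functions UNIV"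
  by (intro test_functions_mult assms Ck_trig)+

text \<open>The weak formulation admits real test functions, so the character enters as cosine minus
  i times sine.\<close>

lemma cfourier_eq_pairing:
  assumes \<phi>: "\<phi> \<in> test_functions UNIV" and g: "g \<in> L2"
  shows "cfourier \<phi> g \<xi> = pairing (\<lambda>x. of_real (\<phi> x * cos (x \<bullet> \<xi>))) g - \<i> * pairing (\<lambda>x. of_real (\<phi> x * sin (x \<bullet> \<xi>))) g"
proof -
  note i = L2_mult_integrable[OF test_function_L2[OF test_functions_trig(1)[OF \<phi>]] g, of \<xi>]
    L2_mult_integrable[OF test_function_L2[OF test_functions_trig(2)[OF \<phi>]] g, of \<xi>]
  have "cfourier \<phi> g \<xi> = (LINT x|lebesgue. of_real (\<phi> x * cos (x \<bullet> \<xi>)) * g x - \<i> * (of_real (\<phi> x * sin (x \<bullet> \<xi>)) * g x))"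
    unfolding cfourier_def fourier_def
    by (intro Bochner_Integration.integral_cong refl) (simp add: cis_conv_exp complex_eq_iff Re_exp Im_exp algebra_simps)
  also have "\<dots> = pairing (\<lambda>x. of_real (\<phi> x * cos (x \<bullet> \<xi>))) g - \<i> * pairing (\<lambda>x. of_real (\<phi> x * sin (x \<bullet> \<xi>))) g"
    unfolding pairing_def
    by (simp only: Bochner_Integration.integral_diff integrable_mult_right i integral_mult_right_zero)
  finally show ?thesis .
qed

lemma pairing_linear:
  assumes "\<And>i. i \<in> I \<Longrightarrow> K i \<in> L2" "finite I" "A \<in> L2" "B \<in> L2" "g \<in> L2"
  shows "pairing (\<lambda>x. c * A x + (\<Sum>i\<in>I. d i * K i x) + B x) g = c * pairing A g + (\<Sum>i\<in>I. d i * pairing (K i) g) + pairing B g"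
proof -
  note i = L2_mult_integrable[OF assms(3,5)] L2_mult_integrable[OF assms(4,5)] L2_mult_integrable[OF assms(1) assms(5)]
  have "(c * A x + (\<Sum>i\<in>I. d i * K i x) + B x) * g x = c * (A x * g x) + (\<Sum>i\<in>I. d i * (K i x * g x)) + B x * g x" for x
    by (simp add: algebra_simps sum_distrib_left)
  then show ?thesis
    unfolding pairing_def using i by (simp add: Bochner_Integration.integral_sum)
qed

text \<open>Leibniz' rule for \<phi> e with the character e: \<Delta>e = -|\<xi>|^2 e gives the main
  term, while \<nabla>e = -i \<xi> e produces the first-order sum in which one derivative falls on
  \<phi>.\<close>

lemma pairing_lap_trig:
  fixes \<phi> :: "'a::euclidean_space \<Rightarrow> real"
  assumes \<phi>: "\<phi> \<in> test_functions UNIV" and g: "g \<in> L2"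
  shows "pairing (lap (\<lambda>x. \<phi> x * cos (x \<bullet> \<xi>))) g - \<i> * pairing (lap (\<lambda>x. \<phi> x * sin (x \<bullet> \<xi>))) g =
    - of_real ((norm \<xi>)\<^sup>2) * cfourier \<phi> g \<xi> + cfourier (lap \<phi>) g \<xi>
      - 2 * \<i> * (\<Sum>b\<in>Basis. of_real (b \<bullet> \<xi>) * cfourier (dir_deriv b \<phi>) g \<xi>)"
proof -
  let ?c = "\<lambda>\<phi> x. complex_of_real (\<phi> x * cos (x \<bullet> \<xi>))" and ?s = "\<lambda>\<phi> x. complex_of_real (\<phi> x * sin (x \<bullet> \<xi>))"
  note D = test_functions_dir_deriv[OF \<phi>] and L = test_functions_lap[OF \<phi>]
  note cL = test_function_L2[OF test_functions_trig(1)] and sL = test_function_L2[OF test_functions_trig(2)]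
  have "complex_of_real (lap (\<lambda>x. \<phi> x * cos (x \<bullet> \<xi>)) x) =
      - of_real ((norm \<xi>)\<^sup>2) * ?c \<phi> x + (\<Sum>b\<in>Basis. - 2 * of_real (b \<bullet> \<xi>) * ?s (dir_deriv b \<phi>) x) + ?c (lap \<phi>) x" for x
    by (subst lap_mult[OF test_functionsD(1)[OF \<phi>] Ck_trig(1)])
      (simp add: lap_trig dir_deriv_trig sum_distrib_left algebra_simps sum_negf)
  then have 1: "pairing (lap (\<lambda>x. \<phi> x * cos (x \<bullet> \<xi>))) g = - of_real ((norm \<xi>)\<^sup>2) * pairing (?c \<phi>) g
      + (\<Sum>b\<in>Basis. - 2 * of_real (b \<bullet> \<xi>) * pairing (?s (dir_deriv b \<phi>)) g) + pairing (?c (lap \<phi>)) g"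
    by (simp only:) (intro pairing_linear sL cL D L \<phi> g finite_Basis)
  have "complex_of_real (lap (\<lambda>x. \<phi> x * sin (x \<bullet> \<xi>)) x) =
      - of_real ((norm \<xi>)\<^sup>2) * ?s \<phi> x + (\<Sum>b\<in>Basis. 2 * of_real (b \<bullet> \<xi>) * ?c (dir_deriv b \<phi>) x) + ?s (lap \<phi>) x" for x
    by (subst lap_mult[OF test_functionsD(1)[OF \<phi>] Ck_trig(2)])
      (simp add: lap_trig dir_deriv_trig sum_distrib_left algebra_simps)
  then have 2: "pairing (lap (\<lambda>x. \<phi> x * sin (x \<bullet> \<xi>))) g = - of_real ((norm \<xi>)\<^sup>2) * pairing (?s \<phi>) g
      + (\<Sum>b\<in>Basis. 2 * of_real (b \<bullet> \<xi>) * pairing (?c (dir_deriv b \<phi>)) g) + pairing (?s (lap \<phi>)) g"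
    by (simp only:) (intro pairing_linear sL cL D L \<phi> g finite_Basis)
  have i2: "\<i> * (\<i> * z) = - z" for z :: complex by (simp flip: mult.assoc)
  show ?thesis
    unfolding 1 2 cfourier_eq_pairing[OF \<phi> g] cfourier_eq_pairing[OF L g] cfourier_eq_pairing[OF D g]
    by (simp add: algebra_simps sum_distrib_left sum_subtractf sum.distrib sum_negf i2)
qed

context wave_solution
begin

lemma cfourier_deriv:
  assumes \<phi>: "\<phi> \<in> test_functions UNIV" and t: "t \<ge> 0"
  shows "((\<lambda>t. cfourier \<phi> (u t) \<xi>) has_vector_derivative cfourier \<phi> (v t) \<xi>) (at t within {0..})"
proof -
  note K = test_function_L2[OF test_functions_trig(1)[OF \<phi>, of \<xi>]] test_function_L2[OF test_functions_trig(2)[OF \<phi>, of \<xi>]]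
  have "((\<lambda>t. pairing (\<lambda>x. of_real (\<phi> x * cos (x \<bullet> \<xi>))) (u t) - \<i> * pairing (\<lambda>x. of_real (\<phi> x * sin (x \<bullet> \<xi>))) (u t))
      has_vector_derivative cfourier \<phi> (v t) \<xi>) (at t within {0..})"
    unfolding cfourier_eq_pairing[OF \<phi> v_L2[OF t]]
    by (intro has_vector_derivative_diff has_vector_derivative_mult_right pairing_has_derivative[OF _ u_L2 v_L2 deriv t] K)
  then show ?thesis
    by (rule has_vector_derivative_transform[rotated 2]) (use t in \<open>auto simp: cfourier_eq_pairing[OF \<phi> u_L2]\<close>)
qed

text \<open>The sum u + v appears because the Laplacian in the equation acts on u + u_t.\<close>

definition commutator :: "('a \<Rightarrow> real) \<Rightarrow> real \<Rightarrow> 'a \<Rightarrow> complex" where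
  "commutator \<phi> t \<xi> = cfourier (lap \<phi>) (\<lambda>x. u t x + v t x) \<xi>
    - 2 * \<i> * (\<Sum>b\<in>Basis. of_real (b \<bullet> \<xi>) * cfourier (dir_deriv b \<phi>) (\<lambda>x. u t x + v t x) \<xi>)"

lemma cfourier_add:
  assumes \<phi>: "\<phi> \<in> test_functions UNIV" and "f \<in> L2" "g \<in> L2"
  shows "cfourier \<phi> (\<lambda>x. f x + g x) \<xi> = cfourier \<phi> f \<xi> + cfourier \<phi> g \<xi>"
proof -
  note K = test_function_L2[OF test_functions_trig(1)[OF \<phi>, of \<xi>]] test_function_L2[OF test_functions_trig(2)[OF \<phi>, of \<xi>]]
  have "pairing k (\<lambda>x. f x + g x) = pairing k f + pairing k g" if "k \<in> L2" for k
    using L2_mult_integrable[OF that assms(2)] L2_mult_integrable[OF that assms(3)]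
    by (simp add: pairing_def distrib_left)
  then show ?thesis
    using K assms by (simp add: cfourier_eq_pairing L2_add algebra_simps del: of_real_mult)
qed

lemma cfourier_equation:
  assumes \<phi>: "\<phi> \<in> test_functions UNIV" and t: "t \<ge> 0"
  shows "((\<lambda>t. cfourier \<phi> (v t) \<xi>) has_vector_derivative
    - of_real ((norm \<xi>)\<^sup>2) * cfourier \<phi> (v t) \<xi> - of_real ((norm \<xi>)\<^sup>2 + m\<^sup>2) * cfourier \<phi> (u t) \<xi>
      + commutator \<phi> t \<xi>) (at t within {0..})"
proof -
  let ?c = "\<lambda>x. \<phi> x * cos (x \<bullet> \<xi>)" and ?s = "\<lambda>x. \<phi> x * sin (x \<bullet> \<xi>)"
  note T = test_functions_trig[OF \<phi>, of \<xi>]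
  define D where "D = (pairing (lap ?c) (v t) + pairing (lap ?c) (u t) - of_real (m\<^sup>2) * pairing ?c (u t))
      - \<i> * (pairing (lap ?s) (v t) + pairing (lap ?s) (u t) - of_real (m\<^sup>2) * pairing ?s (u t))"
  have "((\<lambda>t. pairing ?c (v t) - \<i> * pairing ?s (v t)) has_vector_derivative D) (at t within {0..})"
    unfolding D_def
    by (intro has_vector_derivative_diff has_vector_derivative_mult_right pairing_equation T t)
  then have "((\<lambda>t. cfourier \<phi> (v t) \<xi>) has_vector_derivative D) (at t within {0..})"
    by (rule has_vector_derivative_transform[rotated 2]) (use t in \<open>auto simp: cfourier_eq_pairing[OF \<phi> v_L2]\<close>)
  moreover have "D = (pairing (lap ?c) (v t) - \<i> * pairing (lap ?s) (v t)) + (pairing (lap ?c) (u t) - \<i> * pairing (lap ?s) (u t))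
      - of_real (m\<^sup>2) * cfourier \<phi> (u t) \<xi>"
    unfolding D_def cfourier_eq_pairing[OF \<phi> u_L2[OF t]] by (simp add: algebra_simps)
  moreover have "\<dots> = - of_real ((norm \<xi>)\<^sup>2) * cfourier \<phi> (v t) \<xi> - of_real ((norm \<xi>)\<^sup>2 + m\<^sup>2) * cfourier \<phi> (u t) \<xi>
      + commutator \<phi> t \<xi>"
    unfolding pairing_lap_trig[OF \<phi> v_L2[OF t]] pairing_lap_trig[OF \<phi> u_L2[OF t]] commutator_def
    by (simp add: cfourier_add u_L2 v_L2 t test_functions_lap test_functions_dir_deriv \<phi> algebra_simps sum.distrib)
  ultimately show ?thesis by simp
qed

end

section \<open>Energy estimates\<close>

text \<open>With the multiplier \<open>p + \<delta> w\<close>, \<open>\<delta> \<le> a / 2\<close>, the energy modified by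
  \<open>2 \<delta> p \<bullet> w + \<delta> a |w|\<^sup>2\<close> decays at a rate proportional to \<open>\<delta>\<close>; the slack \<open>1 / T\<close> absorbs
  the forcing.\<close>

lemma ode_energy_estimate:
  fixes w p f :: "real \<Rightarrow> complex" and a b \<delta> T :: real
  assumes w: "\<And>t. t \<ge> 0 \<Longrightarrow> (w has_vector_derivative p t) (at t within {0..})"
    and p: "\<And>t. t \<ge> 0 \<Longrightarrow> (p has_vector_derivative (- of_real a * p t - of_real b * w t + f t)) (at t within {0..})"
    and f: "continuous_on {0..} f" and T: "T > 0"
    and \<delta>: "0 \<le> \<delta>" "2 * \<delta> \<le> a" "4 * \<delta>\<^sup>2 \<le> b" "\<delta> \<le> 1" "a \<le> b"
  shows "b * (norm (w T))\<^sup>2 \<le> 5 * exp (1 - 4 / 5 * \<delta> * T) * ((norm (p 0))\<^sup>2 + b * (norm (w 0))\<^sup>2)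
    + 8 * exp 1 * T * integral {0..T} (\<lambda>s. (norm (f s))\<^sup>2)"
proof -
  define E where "E s = p s \<bullet> p s + (b + \<delta> * a) * (w s \<bullet> w s) + 2 * \<delta> * (p s \<bullet> w s)" for s
  \<comment> \<open>4/5 = 2 / (5/2): the dissipation is at least 2\<delta> times |p|^2 + b |w|^2,
    and the energy is at most 5/2 times that quantity.\<close>
  define \<gamma> where "\<gamma> = 1 / T - 4 / 5 * \<delta>"
  define I where "I s = integral {0..s} (\<lambda>s. (norm (f s))\<^sup>2)" for s
  have a0: "0 \<le> a" and b0: "0 \<le> b" using \<delta> by auto
  have sq: "(norm z)\<^sup>2 = z \<bullet> z" for z :: complex by (rule power2_norm_eq_inner)
  have cross: "\<bar>2 * \<delta> * (x \<bullet> y)\<bar> \<le> (x \<bullet> x + b * (y \<bullet> y)) / 2" for x y :: complex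
  proof -
    have "0 \<le> (x - (2 * \<delta>) *\<^sub>R y) \<bullet> (x - (2 * \<delta>) *\<^sub>R y)" "0 \<le> (x + (2 * \<delta>) *\<^sub>R y) \<bullet> (x + (2 * \<delta>) *\<^sub>R y)" by simp_all
    moreover have "4 * \<delta>\<^sup>2 * (y \<bullet> y) \<le> b * (y \<bullet> y)" using \<delta>(3) by (intro mult_right_mono) auto
    ultimately show ?thesis
      by (simp add: inner_diff_left inner_diff_right inner_add_left inner_add_right inner_commute power2_eq_square abs_if)
  qed
  have \<delta>a: "0 \<le> \<delta> * a" "\<delta> * a \<le> b"
    using \<delta> a0 mult_mono[of \<delta> 1 a b] by auto
  have lo: "(p s \<bullet> p s + b * (w s \<bullet> w s)) / 2 \<le> E s" for s
  proof -
    have "0 \<le> \<delta> * a * (w s \<bullet> w s)" using \<delta>a by simp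
    then show ?thesis using cross[of "p s" "w s"] unfolding E_def by (simp add: distrib_right)
  qed
  \<comment> \<open>5/2 = 1 + 1 + 1/2: the term b |w|^2, the term \<delta> a |w|^2 with \<delta> a
    \<le> b, and the cross term.\<close>
  have hi: "E s \<le> 5 / 2 * (p s \<bullet> p s + b * (w s \<bullet> w s))" for s
  proof -
    have "\<delta> * a * (w s \<bullet> w s) \<le> b * (w s \<bullet> w s)" using \<delta>a by (intro mult_right_mono) auto
    moreover have "0 \<le> p s \<bullet> p s" by simp
    moreover note abs_le_D1[OF cross[of "p s" "w s"]]
    ultimately show ?thesis unfolding E_def distrib_right by argo
  qed
  \<comment> \<open>No product p \<bullet> w is left: the derivative of \<delta> a |w|^2 cancels the
    contribution of the damping to the derivative of 2\<delta> p \<bullet> w.\<close>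
  define E' where "E' s = - 2 * (a - \<delta>) * (p s \<bullet> p s) - 2 * \<delta> * b * (w s \<bullet> w s) + 2 * (f s \<bullet> (p s + \<delta> *\<^sub>R w s))" for s
  have dE: "(E has_real_derivative E' s) (at s within {0..})" if "s \<ge> 0" for s
  proof -
    let ?q = "- of_real a * p s - of_real b * w s + f s"
    note B = bounded_bilinear.has_vector_derivative[OF bounded_bilinear_inner]
    have "((\<lambda>s. p s \<bullet> p s + (b + \<delta> * a) * (w s \<bullet> w s) + 2 * \<delta> * (p s \<bullet> w s)) has_vector_derivative
       (p s \<bullet> ?q + ?q \<bullet> p s) + (b + \<delta> * a) * (w s \<bullet> p s + p s \<bullet> w s) + 2 * \<delta> * (p s \<bullet> p s + ?q \<bullet> w s)) (at s within {0..})"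
      by (intro has_vector_derivative_add has_vector_derivative_mult_right B w p that)
    moreover have "(p s \<bullet> ?q + ?q \<bullet> p s) + (b + \<delta> * a) * (w s \<bullet> p s + p s \<bullet> w s) + 2 * \<delta> * (p s \<bullet> p s + ?q \<bullet> w s) = E' s"
      unfolding E'_def inner_complex_def by (simp add: algebra_simps)
    ultimately show ?thesis
      unfolding has_real_derivative_iff_has_vector_derivative E_def[abs_def] by simp
  qed
  \<comment> \<open>Young's inequality with weight 4T bounds 2 f \<bullet> X by 4T |f|^2 + |X|^2 /
    (4T); then |X|^2 \<le> 4 E turns the last term into E / T, the slack contained in
    \<gamma>.\<close>
  have E'le: "E' s \<le> \<gamma> * E s + 4 * T * (norm (f s))\<^sup>2" for s
  proof -
    let ?X = "p s + \<delta> *\<^sub>R w s"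
    have X: "?X \<bullet> ?X \<le> 4 * E s"
    proof -
      have "0 \<le> (p s - \<delta> *\<^sub>R w s) \<bullet> (p s - \<delta> *\<^sub>R w s)" by simp
      then have "?X \<bullet> ?X \<le> 2 * (p s \<bullet> p s) + 2 * \<delta>\<^sup>2 * (w s \<bullet> w s)"
        by (simp add: inner_diff_left inner_diff_right inner_add_left inner_add_right inner_commute power2_eq_square)
      also have "2 * \<delta>\<^sup>2 * (w s \<bullet> w s) \<le> 2 * (b * (w s \<bullet> w s))"
      proof -
        have "\<delta>\<^sup>2 \<le> b" using \<delta>(3) zero_le_power2[of \<delta>] by linarith
        then show ?thesis by (simp add: mult_right_mono)
      qed
      finally show ?thesis using lo[of s] by simp
    qed
    have "0 \<le> (f s - (1 / (4 * T)) *\<^sub>R ?X) \<bullet> (f s - (1 / (4 * T)) *\<^sub>R ?X)" by simp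
    then have "0 \<le> 4 * T * (f s \<bullet> f s) - 2 * (f s \<bullet> ?X) + (?X \<bullet> ?X) / (4 * T)"
    proof -
      assume "0 \<le> (f s - (1 / (4 * T)) *\<^sub>R ?X) \<bullet> (f s - (1 / (4 * T)) *\<^sub>R ?X)"
      then have "0 \<le> 4 * T * ((f s - (1 / (4 * T)) *\<^sub>R ?X) \<bullet> (f s - (1 / (4 * T)) *\<^sub>R ?X))" using T by simp
      also have "(f s - (1 / (4 * T)) *\<^sub>R ?X) \<bullet> (f s - (1 / (4 * T)) *\<^sub>R ?X) =
          f s \<bullet> f s - 2 * (1 / (4 * T)) * (f s \<bullet> ?X) + (1 / (4 * T)) * (1 / (4 * T)) * (?X \<bullet> ?X)"
        unfolding inner_diff_left inner_diff_right inner_scaleR_left inner_scaleR_right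
        by (simp only: inner_commute[of ?X "f s"]) (simp only: algebra_simps mult_2)
      also have "4 * T * (f s \<bullet> f s - 2 * (1 / (4 * T)) * (f s \<bullet> ?X) + (1 / (4 * T)) * (1 / (4 * T)) * (?X \<bullet> ?X)) =
          4 * T * (f s \<bullet> f s) - 2 * (f s \<bullet> ?X) + (?X \<bullet> ?X) / (4 * T)"
        using T by (simp add: field_simps)
      finally show ?thesis .
    qed
    moreover have "(?X \<bullet> ?X) / (4 * T) \<le> E s / T"
    proof -
      have "(?X \<bullet> ?X) / (4 * T) \<le> (4 * E s) / (4 * T)" using X T by (intro divide_right_mono) auto
      then show ?thesis by simp
    qed
    moreover have "- 2 * (a - \<delta>) * (p s \<bullet> p s) - 2 * \<delta> * b * (w s \<bullet> w s) \<le> - (4 / 5 * \<delta>) * E s"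
    proof -
      have "2 * \<delta> * (p s \<bullet> p s) \<le> 2 * (a - \<delta>) * (p s \<bullet> p s)" using \<delta>(2) by (intro mult_right_mono) auto
      moreover have "(4 / 5 * \<delta>) * E s \<le> (4 / 5 * \<delta>) * (5 / 2 * (p s \<bullet> p s + b * (w s \<bullet> w s)))"
        using hi \<delta> by (intro mult_left_mono) auto
      ultimately show ?thesis by (simp add: algebra_simps)
    qed
    ultimately show ?thesis
      unfolding E'_def \<gamma>_def sq by (simp add: algebra_simps)
  qed
  \<comment> \<open>Gronwall with an explicit integrating factor. Its exponent is at most 1 on
    [0, T], so the forcing costs a factor e and G decreases.\<close>
  define G where "G s = exp (\<gamma> * (T - s)) * E s - 4 * T * exp 1 * I s" for s
  have cf: "continuous_on {0..T} (\<lambda>s. (norm (f s))\<^sup>2)"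
    using f by (intro continuous_intros continuous_on_subset[OF f]) auto
  have dI: "(I has_real_derivative (norm (f s))\<^sup>2) (at s within {0..T})" if "0 \<le> s" "s \<le> T" for s
    unfolding I_def[abs_def] using that by (intro integral_has_real_derivative cf) auto
  have dG: "(G has_real_derivative (exp (\<gamma> * (T - s)) * (E' s - \<gamma> * E s) - 4 * T * exp 1 * (norm (f s))\<^sup>2)) (at s within {0..T})"
    if "0 \<le> s" "s \<le> T" for s
    unfolding G_def[abs_def]
    by (rule derivative_eq_intros DERIV_subset[OF dE] dI that refl | use that in \<open>simp add: algebra_simps\<close>)+
  have G': "exp (\<gamma> * (T - s)) * (E' s - \<gamma> * E s) - 4 * T * exp 1 * (norm (f s))\<^sup>2 \<le> 0" if "0 \<le> s" "s \<le> T" for s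
  proof -
    have "\<gamma> * (T - s) \<le> (1 / T) * T"
      unfolding \<gamma>_def using that T \<delta> by (intro mult_mono) auto
    then have "exp (\<gamma> * (T - s)) \<le> exp 1" using T by simp
    have "exp (\<gamma> * (T - s)) * (E' s - \<gamma> * E s) \<le> exp (\<gamma> * (T - s)) * (4 * T * (norm (f s))\<^sup>2)"
      using E'le[of s] by (intro mult_left_mono) auto
    also have "\<dots> \<le> exp 1 * (4 * T * (norm (f s))\<^sup>2)"
      using \<open>exp (\<gamma> * (T - s)) \<le> exp 1\<close> T by (intro mult_right_mono) auto
    finally show ?thesis by (simp add: algebra_simps)
  qed
  have "G T \<le> G 0"
  proof (rule DERIV_nonpos_imp_decreasing_open[of 0 T G])
    show "continuous_on {0..T} G"
      using dG DERIV_continuous unfolding continuous_on_eq_continuous_within by fastforce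
    show "\<exists>y. (G has_real_derivative y) (at s) \<and> y \<le> 0" if "0 < s" "s < T" for s
      using dG[of s] G'[of s] that at_within_interior[of s "{0..T}"] by auto
  qed (use T in simp)
  then have "E T \<le> exp (\<gamma> * T) * E 0 + 4 * T * exp 1 * I T"
    by (simp add: G_def I_def)
  moreover have \<gamma>T: "\<gamma> * T = 1 - 4 / 5 * \<delta> * T" using T by (simp add: \<gamma>_def field_simps)
  moreover have "exp (\<gamma> * T) * E 0 \<le> exp (\<gamma> * T) * (5 / 2 * (p 0 \<bullet> p 0 + b * (w 0 \<bullet> w 0)))"
    using hi[of 0] by (intro mult_left_mono) auto
  moreover have "b * (w T \<bullet> w T) \<le> 2 * E T" using lo[of T] inner_ge_zero[of "p T"] by argo
  ultimately show ?thesis unfolding I_def sq \<gamma>T by (simp add: algebra_simps)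
qed

section \<open>Integrability and joint continuity of the localised transforms\<close>

lemma cfourier_L2:
  fixes \<phi> :: "'a::euclidean_space \<Rightarrow> real"
  assumes \<phi>: "\<phi> \<in> test_functions UNIV" and g: "g \<in> L2"
  shows "(\<lambda>x. of_real (\<phi> x) * g x) \<in> L2" "integrable lebesgue (\<lambda>x. of_real (\<phi> x) * g x)"
    "continuous_on UNIV (cfourier \<phi> g)" "cfourier \<phi> g \<in> L2"
    "(L2_norm (cfourier \<phi> g))\<^sup>2 = (2 * pi) ^ DIM('a) * (L2_norm (\<lambda>x. of_real (\<phi> x) * g x))\<^sup>2"
proof -
  obtain K where K: "\<And>x. \<bar>\<phi> x\<bar> \<le> K" using test_functions_bounded[OF \<phi>] by blast
  have [measurable]: "(\<lambda>x. complex_of_real (\<phi> x)) \<in> borel_measurable lebesgue"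
    by (rule L2D(1)[OF test_function_L2[OF \<phi>]])
  note [measurable] = L2D(1)[OF g]
  show 1: "(\<lambda>x. of_real (\<phi> x) * g x) \<in> L2"
    by (rule L2_dominated[OF _ g, of _ K]) (auto simp: norm_mult intro!: mult_right_mono K)
  show 2: "integrable lebesgue (\<lambda>x. of_real (\<phi> x) * g x)"
    by (rule L2_mult_integrable[OF test_function_L2[OF \<phi>] g])
  show "continuous_on UNIV (cfourier \<phi> g)" unfolding cfourier_def by (rule continuous_on_fourier[OF 2])
  show "cfourier \<phi> g \<in> L2" unfolding cfourier_def by (rule plancherel(1)[OF 2 1])
  show "(L2_norm (cfourier \<phi> g))\<^sup>2 = (2 * pi) ^ DIM('a) * (L2_norm (\<lambda>x. of_real (\<phi> x) * g x))\<^sup>2"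
    unfolding cfourier_def by (rule plancherel(2)[OF 2 1])
qed

lemma cfourier_L2_le:
  fixes \<phi> :: "'a::euclidean_space \<Rightarrow> real"
  assumes \<phi>: "\<phi> \<in> test_functions UNIV" and g: "g \<in> L2" and K: "\<And>x. \<bar>\<phi> x\<bar> \<le> K"
  shows "integrable lborel (\<lambda>\<xi>. (norm (cfourier \<phi> g \<xi>))\<^sup>2)"
    and "(LINT \<xi>|lborel. (norm (cfourier \<phi> g \<xi>))\<^sup>2) \<le> (2 * pi) ^ DIM('a) * (K * L2_norm g)\<^sup>2"
proof -
  have [measurable]: "cfourier \<phi> g \<in> borel_measurable borel"
    by (rule borel_measurable_continuous_onI[OF cfourier_L2(3)[OF \<phi> g]])
  show "integrable lborel (\<lambda>\<xi>. (norm (cfourier \<phi> g \<xi>))\<^sup>2)"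
    using L2D(2)[OF cfourier_L2(4)[OF \<phi> g]] by (simp add: integrable_completion)
  have "(LINT \<xi>|lborel. (norm (cfourier \<phi> g \<xi>))\<^sup>2) = (L2_norm (cfourier \<phi> g))\<^sup>2"
    unfolding L2_norm_power2 by (rule integral_completion[symmetric]) measurable
  also have "\<dots> = (2 * pi) ^ DIM('a) * (L2_norm (\<lambda>x. of_real (\<phi> x) * g x))\<^sup>2"
    by (rule cfourier_L2(5)[OF \<phi> g])
  also have "(L2_norm (\<lambda>x. of_real (\<phi> x) * g x))\<^sup>2 \<le> (LINT x|lebesgue. K\<^sup>2 * (norm (g x))\<^sup>2)"
    unfolding L2_norm_power2
  proof (rule integral_mono')
    show "integrable lebesgue (\<lambda>x. K\<^sup>2 * (norm (g x))\<^sup>2)" using L2D(2)[OF g] by simp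
    have "\<bar>\<phi> x\<bar>\<^sup>2 \<le> K\<^sup>2" for x by (intro power_mono K) simp
    then show "(norm (of_real (\<phi> x) * g x))\<^sup>2 \<le> K\<^sup>2 * (norm (g x))\<^sup>2" for x
      by (simp add: norm_mult power_mult_distrib mult_right_mono)
  qed simp
  also have "\<dots> = (K * L2_norm g)\<^sup>2" by (simp add: L2_norm_power2 power_mult_distrib)
  finally show "(LINT \<xi>|lborel. (norm (cfourier \<phi> g \<xi>))\<^sup>2) \<le> (2 * pi) ^ DIM('a) * (K * L2_norm g)\<^sup>2"
    by (simp add: mult_left_mono)
qed

lemma continuous_curve_add:
  assumes u: "continuous_curve L2 L2_norm u" and v: "continuous_curve L2 L2_norm v"
  shows "continuous_curve L2 L2_norm (\<lambda>t x. u t x + v t x)"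
  unfolding continuous_curve_def
proof (intro conjI allI impI)
  have uL: "u t \<in> L2" and vL: "v t \<in> L2" if "t \<ge> 0" for t
    using u v that by (simp_all add: continuous_curve_def)
  then show "(\<lambda>x. u t x + v t x) \<in> L2" if "t \<ge> 0" for t using that by (intro L2_add) auto
  fix t :: real assume t: "t \<ge> 0"
  have L: "((\<lambda>s. L2_norm (\<lambda>x. u s x - u t x) + L2_norm (\<lambda>x. v s x - v t x)) \<longlongrightarrow> 0 + 0) (at t within {0..})"
    using u v t by (intro tendsto_add) (simp_all add: continuous_curve_def)
  show "((\<lambda>s. L2_norm (\<lambda>x. u s x + v s x - (u t x + v t x))) \<longlongrightarrow> 0) (at t within {0..})"
  proof (rule Lim_null_comparison)
    show "((\<lambda>s. L2_norm (\<lambda>x. u s x - u t x) + L2_norm (\<lambda>x. v s x - v t x)) \<longlongrightarrow> 0) (at t within {0..})"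
      using L by simp
    have "norm (L2_norm (\<lambda>x. u s x + v s x - (u t x + v t x))) \<le> L2_norm (\<lambda>x. u s x - u t x) + L2_norm (\<lambda>x. v s x - v t x)"
      if "s \<ge> 0" for s
    proof -
      have "(\<lambda>x. u s x + v s x - (u t x + v t x)) = (\<lambda>x. (u s x - u t x) + (v s x - v t x))" by auto
      then show ?thesis using L2_norm_triangle[OF L2_diff[OF uL uL] L2_diff[OF vL vL]] that t by simp
    qed
    then show "\<forall>\<^sub>F s in at t within {0..}. norm (L2_norm (\<lambda>x. u s x + v s x - (u t x + v t x))) \<le> L2_norm (\<lambda>x. u s x - u t x) + L2_norm (\<lambda>x. v s x - v t x)"
      by (simp add: eventually_at_filter)
  qed
qed

lemma continuous_curve_bounded:
  assumes g: "continuous_curve L2 L2_norm g"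
  shows "\<exists>B\<ge>0. \<forall>t\<in>{0..T}. L2_norm (g t) \<le> B"
proof -
  have gL: "g t \<in> L2" if "t \<ge> 0" for t using g that by (simp add: continuous_curve_def)
  have "continuous_on {0..T} (\<lambda>t. L2_norm (g t))"
    unfolding continuous_on_def
  proof
    fix t assume t: "t \<in> {0..T}"
    have "((\<lambda>s. L2_norm (\<lambda>x. g s x - g t x)) \<longlongrightarrow> 0) (at t within {0..})"
      using g t by (simp add: continuous_curve_def)
    then have L: "((\<lambda>s. L2_norm (\<lambda>x. g s x - g t x)) \<longlongrightarrow> 0) (at t within {0..T})"
      by (rule tendsto_within_subset) auto
    have "norm (L2_norm (g s) - L2_norm (g t)) \<le> L2_norm (\<lambda>x. g s x - g t x)" if "s \<ge> 0" for s
    proof -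
      have gs: "g s \<in> L2" and gt: "g t \<in> L2" using that t gL by auto
      have "L2_norm (\<lambda>x. g t x - g s x) = L2_norm (\<lambda>x. g s x - g t x)"
        by (simp add: L2_norm_def norm_minus_commute)
      then show ?thesis
        using L2_norm_triangle[OF L2_diff[OF gs gt] gt] L2_norm_triangle[OF L2_diff[OF gt gs] gs] by (simp add: abs_le_iff)
    qed
    then have "\<forall>\<^sub>F s in at t within {0..T}. norm (L2_norm (g s) - L2_norm (g t)) \<le> L2_norm (\<lambda>x. g s x - g t x)"
      by (simp add: eventually_at_filter)
    from Lim_null_comparison[OF this L]
    show "((\<lambda>t. L2_norm (g t)) \<longlongrightarrow> L2_norm (g t)) (at t within {0..T})" by (rule LIM_zero_cancel)
  qed
  then have "bounded ((\<lambda>t. L2_norm (g t)) ` {0..T})"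
    by (intro compact_imp_bounded compact_continuous_image) auto
  then obtain B where "\<forall>t\<in>{0..T}. \<bar>L2_norm (g t)\<bar> \<le> B" "B > 0" by (auto simp: bounded_pos)
  then show ?thesis by (intro exI[of _ B]) auto
qed

text \<open>Increments in time are small uniformly in the frequency, by Cauchy-Schwarz and the bound
  1 for cosine and sine; hence continuity in each variable yields joint continuity. It supplies the
  measurability that Fubini needs in \<open>duhamel_integral\<close>.\<close>

lemma continuous_on_cfourier_joint:
  assumes \<phi>: "\<phi> \<in> test_functions UNIV" and g: "continuous_curve L2 L2_norm g"
  shows "continuous_on ({0..} \<times> UNIV) (\<lambda>z. cfourier \<phi> (g (fst z)) (snd z))"
  unfolding continuous_on_def
proof
  fix z :: "real \<times> 'a" assume z: "z \<in> {0..} \<times> UNIV"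
  obtain t \<xi> where z_eq: "z = (t, \<xi>)" by (cases z)
  have t: "t \<ge> 0" using z z_eq by auto
  have gL: "g t \<in> L2" if "t \<ge> 0" for t using g that by (simp add: continuous_curve_def)
  let ?F = "at z within {0..} \<times> UNIV"
  let ?h = "\<lambda>s. L2_norm (\<lambda>x. g s x - g t x)"
  have "continuous (at t within {0..}) ?h"
    using g t by (simp add: continuous_curve_def continuous_within L2_norm_def)
  then have "((\<lambda>y. ?h (fst y)) \<longlongrightarrow> ?h t) ?F"
    by (rule continuous_within_tendsto_compose)
      (auto simp: z_eq eventually_at_filter mem_Times_iff intro!: tendsto_eq_intros)
  then have 1: "((\<lambda>y. 2 * L2_norm (\<lambda>x. complex_of_real (\<phi> x)) * ?h (fst y)) \<longlongrightarrow> 0) ?F"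
    by (intro tendsto_mult_right_zero) (simp add: L2_norm_def)
  have "isCont (cfourier \<phi> (g t)) \<xi>"
    using cfourier_L2(3)[OF \<phi> gL[OF t]] by (simp add: continuous_on_eq_continuous_at)
  then have "((\<lambda>y. cfourier \<phi> (g t) (snd y)) \<longlongrightarrow> cfourier \<phi> (g t) \<xi>) ?F"
    by (rule isCont_tendsto_compose) (auto simp: z_eq intro!: tendsto_eq_intros)
  then have "((\<lambda>y. cfourier \<phi> (g t) (snd y) - cfourier \<phi> (g t) \<xi>) \<longlongrightarrow> 0) ?F" by (rule LIM_zero)
  then have 2: "((\<lambda>y. norm (cfourier \<phi> (g t) (snd y) - cfourier \<phi> (g t) \<xi>)) \<longlongrightarrow> 0) ?F" by (rule tendsto_norm_zero)
  have "norm (cfourier \<phi> (g s) \<zeta> - cfourier \<phi> (g t) \<xi>) \<le>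
      2 * L2_norm (\<lambda>x. complex_of_real (\<phi> x)) * ?h s + norm (cfourier \<phi> (g t) \<zeta> - cfourier \<phi> (g t) \<xi>)"
    if s: "s \<ge> 0" for s \<zeta>
  proof -
    let ?c = "\<lambda>x. complex_of_real (\<phi> x * cos (x \<bullet> \<zeta>))" and ?s = "\<lambda>x. complex_of_real (\<phi> x * sin (x \<bullet> \<zeta>))"
    have K: "?c \<in> L2" "?s \<in> L2" by (intro test_function_L2 test_functions_trig \<phi>)+
    have D: "(\<lambda>x. g s x - g t x) \<in> L2" using s t gL by (intro L2_diff) auto
    have le: "L2_norm ?c \<le> L2_norm (\<lambda>x. complex_of_real (\<phi> x))" "L2_norm ?s \<le> L2_norm (\<lambda>x. complex_of_real (\<phi> x))"
      unfolding L2_norm_def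
      by (intro real_sqrt_le_mono integral_mono' L2D(2)[OF test_function_L2[OF \<phi>]];
          simp add: norm_mult abs_mult power_mult_distrib abs_square_le_1 mult_left_le)+
    have "cfourier \<phi> (g s) \<zeta> - cfourier \<phi> (g t) \<zeta> = pairing ?c (\<lambda>x. g s x - g t x) - \<i> * pairing ?s (\<lambda>x. g s x - g t x)"
      unfolding cfourier_eq_pairing[OF \<phi> gL[OF s]] cfourier_eq_pairing[OF \<phi> gL[OF t]]
        pairing_diff[OF K(1) gL[OF s] gL[OF t], symmetric] pairing_diff[OF K(2) gL[OF s] gL[OF t], symmetric]
      by (simp add: algebra_simps)
    also have "norm \<dots> \<le> norm (pairing ?c (\<lambda>x. g s x - g t x)) + norm (pairing ?s (\<lambda>x. g s x - g t x))"
      using norm_triangle_ineq4[of "pairing ?c (\<lambda>x. g s x - g t x)" "\<i> * pairing ?s (\<lambda>x. g s x - g t x)"] by (simp add: norm_mult)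
    also have "\<dots> \<le> L2_norm ?c * ?h s + L2_norm ?s * ?h s"
      by (intro add_mono norm_pairing_le K D)
    also have "\<dots> \<le> L2_norm (\<lambda>x. complex_of_real (\<phi> x)) * ?h s + L2_norm (\<lambda>x. complex_of_real (\<phi> x)) * ?h s"
      by (intro add_mono mult_right_mono le) simp_all
    finally have "norm (cfourier \<phi> (g s) \<zeta> - cfourier \<phi> (g t) \<zeta>) \<le> 2 * L2_norm (\<lambda>x. complex_of_real (\<phi> x)) * ?h s"
      by simp
    then show ?thesis
      using norm_triangle_ineq[of "cfourier \<phi> (g s) \<zeta> - cfourier \<phi> (g t) \<zeta>" "cfourier \<phi> (g t) \<zeta> - cfourier \<phi> (g t) \<xi>"] by simp
  qed
  then have "\<forall>\<^sub>F y in ?F. norm (cfourier \<phi> (g (fst y)) (snd y) - cfourier \<phi> (g t) \<xi>) \<le>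
      2 * L2_norm (\<lambda>x. complex_of_real (\<phi> x)) * ?h (fst y) + norm (cfourier \<phi> (g t) (snd y) - cfourier \<phi> (g t) \<xi>)"
    by (auto simp: eventually_at_filter mem_Times_iff intro!: always_eventually)
  then have "((\<lambda>y. cfourier \<phi> (g (fst y)) (snd y) - cfourier \<phi> (g t) \<xi>) \<longlongrightarrow> 0) ?F"
    by (rule Lim_null_comparison) (use tendsto_add[OF 1 2] in simp)
  then show "((\<lambda>z. cfourier \<phi> (g (fst z)) (snd z)) \<longlongrightarrow> cfourier \<phi> (g (fst z)) (snd z)) ?F"
    using z_eq by (simp add: LIM_zero_cancel)
qed

lemma lborel_integral_indicator:
  fixes h :: "real \<Rightarrow> real"
  assumes "continuous_on {a..b} h"
  shows "(LINT s|lborel. indicator {a..b} s * h s) = integral {a..b} h"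
  using set_borel_integral_eq_integral(2)[OF borel_integrable_atLeastAtMost'[OF assms]]
  by (simp add: set_lebesgue_integral_def)

section \<open>The commutator as a forcing term\<close>

definition cutoff :: "('a::euclidean_space \<Rightarrow> real) \<Rightarrow> real \<Rightarrow> 'a \<Rightarrow> real" where
  "cutoff \<eta> R x = \<eta> (x /\<^sub>R R)"

lemma cutoff_test: "\<eta> \<in> test_functions UNIV \<Longrightarrow> R > 0 \<Longrightarrow> cutoff \<eta> R \<in> test_functions UNIV"
  unfolding cutoff_def[abs_def] by (rule test_functions_scaled)

context wave_solution
begin

lemmas curve_add = continuous_curve_add[OF u v]

lemma commutator_continuous:
  assumes \<phi>: "\<phi> \<in> test_functions UNIV"
  shows "continuous_on ({0..} \<times> UNIV) (\<lambda>z. commutator \<phi> (fst z) (snd z))"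
  unfolding commutator_def
  by (intro continuous_intros continuous_on_cfourier_joint[OF _ curve_add] test_functions_lap test_functions_dir_deriv \<phi>)

lemma commutator_continuous_time:
  assumes \<phi>: "\<phi> \<in> test_functions UNIV"
  shows "continuous_on {0..} (\<lambda>s. commutator \<phi> s \<xi>)"
proof -
  have "continuous_on {0..} (\<lambda>s. commutator \<phi> (fst (s, \<xi>)) (snd (s, \<xi>)))"
    by (rule continuous_on_compose2[OF commutator_continuous[OF \<phi>], of "{0..}" "\<lambda>s. (s, \<xi>)"])
      (intro continuous_intros, auto)
  then show ?thesis by simp
qed

text \<open>The zeroth-order part uses |\<xi>|^2 + m^2 \<ge> m^2. The first-order part grows like
  |\<xi>| and is tamed by |\<xi>|^2 / (|\<xi>|^2 + m^2) \<le> 1; the dimension comes from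
  Cauchy-Schwarz for the sum over \<open>Basis\<close>.\<close>

lemma commutator_bound:
  "(norm (commutator \<phi> t \<xi>))\<^sup>2 / ((norm \<xi>)\<^sup>2 + m\<^sup>2) \<le>
    2 / m\<^sup>2 * (norm (cfourier (lap \<phi>) (\<lambda>x. u t x + v t x) \<xi>))\<^sup>2
    + 8 * DIM('a) * (\<Sum>b\<in>Basis. (norm (cfourier (dir_deriv b \<phi>) (\<lambda>x. u t x + v t x) \<xi>))\<^sup>2)"
proof -
  let ?F = "cfourier (lap \<phi>) (\<lambda>x. u t x + v t x) \<xi>"
  let ?B = "\<lambda>b. cfourier (dir_deriv b \<phi>) (\<lambda>x. u t x + v t x) \<xi>"
  let ?S = "\<Sum>b\<in>Basis. of_real (b \<bullet> \<xi>) * ?B b"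
  have b: "0 < (norm \<xi>)\<^sup>2 + m\<^sup>2" using m_pos by (simp add: add_nonneg_pos)
  have "norm ?S \<le> (\<Sum>b\<in>Basis. norm \<xi> * norm (?B b))"
    by (rule sum_norm_le) (auto simp: norm_mult inner_commute[of _ \<xi>] intro!: mult_right_mono Basis_le_norm)
  also have "\<dots> = norm \<xi> * (\<Sum>b\<in>Basis. norm (?B b))" by (simp add: sum_distrib_left)
  finally have "(norm ?S)\<^sup>2 \<le> (norm \<xi> * (\<Sum>b\<in>Basis. norm (?B b)))\<^sup>2" by (rule power_mono) simp
  also have "\<dots> \<le> (norm \<xi>)\<^sup>2 * ((\<Sum>b\<in>Basis. (norm (?B b))\<^sup>2) * card (Basis :: 'a set))"
    unfolding power_mult_distrib by (intro mult_left_mono sum_squared_le_sum_of_squares) simp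
  finally have S: "(norm ?S)\<^sup>2 \<le> (norm \<xi>)\<^sup>2 * (DIM('a) * (\<Sum>b\<in>Basis. (norm (?B b))\<^sup>2))" by (simp add: mult_ac)
  have "(norm (commutator \<phi> t \<xi>))\<^sup>2 \<le> 2 * (norm ?F)\<^sup>2 + 2 * (norm (2 * \<i> * ?S))\<^sup>2"
    unfolding commutator_def using norm_add_power2_le[of ?F "- (2 * \<i> * ?S)"] by simp
  also have "\<dots> = 2 * (norm ?F)\<^sup>2 + 8 * (norm ?S)\<^sup>2" by (simp add: norm_mult power_mult_distrib)
  also have "\<dots> \<le> 2 * (norm ?F)\<^sup>2 + 8 * ((norm \<xi>)\<^sup>2 * (DIM('a) * (\<Sum>b\<in>Basis. (norm (?B b))\<^sup>2)))" using S by simp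
  also have "\<dots> \<le> (2 / m\<^sup>2 * (norm ?F)\<^sup>2 + 8 * DIM('a) * (\<Sum>b\<in>Basis. (norm (?B b))\<^sup>2)) * ((norm \<xi>)\<^sup>2 + m\<^sup>2)"
  proof -
    have "2 * (norm ?F)\<^sup>2 \<le> (2 / m\<^sup>2 * (norm ?F)\<^sup>2) * ((norm \<xi>)\<^sup>2 + m\<^sup>2)"
    proof -
      have "(2 / m\<^sup>2 * (norm ?F)\<^sup>2) * m\<^sup>2 \<le> (2 / m\<^sup>2 * (norm ?F)\<^sup>2) * ((norm \<xi>)\<^sup>2 + m\<^sup>2)"
        by (intro mult_left_mono) auto
      then show ?thesis using m_pos by simp
    qed
    moreover have "8 * ((norm \<xi>)\<^sup>2 * (DIM('a) * (\<Sum>b\<in>Basis. (norm (?B b))\<^sup>2))) \<le> (8 * DIM('a) * (\<Sum>b\<in>Basis. (norm (?B b))\<^sup>2)) * ((norm \<xi>)\<^sup>2 + m\<^sup>2)"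
    proof -
      have "(8 * DIM('a) * (\<Sum>b\<in>Basis. (norm (?B b))\<^sup>2)) * (norm \<xi>)\<^sup>2 \<le> (8 * DIM('a) * (\<Sum>b\<in>Basis. (norm (?B b))\<^sup>2)) * ((norm \<xi>)\<^sup>2 + m\<^sup>2)"
        by (intro mult_left_mono mult_nonneg_nonneg sum_nonneg) auto
      then show ?thesis by (simp add: mult_ac)
    qed
    ultimately show ?thesis by (simp only: distrib_right add_mono)
  qed
  finally show ?thesis using b by (simp add: pos_divide_le_eq)
qed

lemma commutator_integral:
  assumes \<eta>: "\<eta> \<in> test_functions UNIV"
  shows "\<exists>C\<ge>0. \<forall>R\<ge>1. \<forall>t\<in>{0..T}.
    integrable lborel (\<lambda>\<xi>. (norm (commutator (cutoff \<eta> R) t \<xi>))\<^sup>2 / ((norm \<xi>)\<^sup>2 + m\<^sup>2)) \<and>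
    (LINT \<xi>|lborel. (norm (commutator (cutoff \<eta> R) t \<xi>))\<^sup>2 / ((norm \<xi>)\<^sup>2 + m\<^sup>2)) \<le> C / R\<^sup>2"
proof -
  obtain B where B: "B \<ge> 0" "\<And>t. t \<in> {0..T} \<Longrightarrow> L2_norm (\<lambda>x. u t x + v t x) \<le> B"
    using continuous_curve_bounded[OF curve_add, of T] by blast
  obtain K0 where K0: "K0 > 0" "\<And>x. \<bar>lap \<eta> x\<bar> \<le> K0"
    using test_functions_bounded[OF test_functions_lap[OF \<eta>]] by blast
  have "\<forall>b. \<exists>K. K > 0 \<and> (\<forall>x. \<bar>dir_deriv b \<eta> x\<bar> \<le> K)"
    using test_functions_bounded[OF test_functions_dir_deriv[OF \<eta>]] by blast
  then obtain K where K: "\<And>b. K b > 0" "\<And>b x. \<bar>dir_deriv b \<eta> x\<bar> \<le> K b" by metis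
  define P where "P = (2 * pi) ^ DIM('a)"
  define C where "C = 2 / m\<^sup>2 * (P * (K0 * B)\<^sup>2) + 8 * DIM('a) * (\<Sum>b\<in>(Basis :: 'a set). P * (K b * B)\<^sup>2)"
  have "P > 0" by (simp add: P_def)
  have C0: "C \<ge> 0" unfolding C_def using \<open>P > 0\<close> by (intro add_nonneg_nonneg mult_nonneg_nonneg sum_nonneg) auto
  have "integrable lborel (\<lambda>\<xi>. (norm (commutator (cutoff \<eta> R) t \<xi>))\<^sup>2 / ((norm \<xi>)\<^sup>2 + m\<^sup>2)) \<and>
    (LINT \<xi>|lborel. (norm (commutator (cutoff \<eta> R) t \<xi>))\<^sup>2 / ((norm \<xi>)\<^sup>2 + m\<^sup>2)) \<le> C / R\<^sup>2"
    if R: "R \<ge> 1" and t: "t \<in> {0..T}" for R t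
  proof -
    let ?g = "\<lambda>x. u t x + v t x" and ?\<phi> = "cutoff \<eta> R"
    have g: "?g \<in> L2" using curve_add t by (simp add: continuous_curve_def)
    have \<phi>: "?\<phi> \<in> test_functions UNIV" using R by (intro cutoff_test \<eta>) simp
    have Ck: "\<And>k. Ck k \<eta>" by (rule test_functionsD(1)[OF \<eta>])
    have d: "\<eta> differentiable (at x)" for x using Ck[of "Suc 0"] by simp
    have "\<bar>lap ?\<phi> x\<bar> \<le> K0 / R" for x
    proof -
      have "\<bar>lap ?\<phi> x\<bar> = \<bar>lap \<eta> (x /\<^sub>R R)\<bar> / R\<^sup>2"
        unfolding cutoff_def[abs_def] lap_scaled[OF Ck] by simp
      also have "\<dots> \<le> K0 / R\<^sup>2" using K0 by (intro divide_right_mono) auto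
      \<comment> \<open>The better rate R^{-2} is given away so that both parts of the commutator
        have the rate of the gradient term.\<close>
      also have "\<dots> \<le> K0 / R" using K0 R by (intro divide_left_mono) (auto simp: power2_eq_square)
      finally show ?thesis .
    qed
    note F = cfourier_L2_le[OF test_functions_lap[OF \<phi>] g this]
    have "\<bar>dir_deriv b ?\<phi> x\<bar> \<le> K b / R" for b x
      unfolding cutoff_def[abs_def] dir_deriv_scaled[OF d] using K(2)[of b "x /\<^sub>R R"] R by (simp add: divide_right_mono)
    note D = cfourier_L2_le[OF test_functions_dir_deriv[OF \<phi>] g this]
    let ?G = "\<lambda>\<xi>. 2 / m\<^sup>2 * (norm (cfourier (lap ?\<phi>) ?g \<xi>))\<^sup>2 + 8 * DIM('a) * (\<Sum>b\<in>Basis. (norm (cfourier (dir_deriv b ?\<phi>) ?g \<xi>))\<^sup>2)"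
    have Gi: "integrable lborel ?G" using F(1) D(1) by (intro Bochner_Integration.integrable_add integrable_mult_right Bochner_Integration.integrable_sum)
    have "continuous_on UNIV (\<lambda>\<xi>. commutator ?\<phi> (fst (t, \<xi>)) (snd (t, \<xi>)))"
      by (rule continuous_on_compose2[OF commutator_continuous[OF \<phi>], of UNIV "\<lambda>\<xi>. (t, \<xi>)"])
        (intro continuous_intros, use t in auto)
    then have "continuous_on UNIV (commutator ?\<phi> t)" by simp
    then have [measurable]: "commutator ?\<phi> t \<in> borel_measurable borel" by (rule borel_measurable_continuous_onI)
    have i: "integrable lborel (\<lambda>\<xi>. (norm (commutator ?\<phi> t \<xi>))\<^sup>2 / ((norm \<xi>)\<^sup>2 + m\<^sup>2))"
    proof (rule Bochner_Integration.integrable_bound[OF Gi])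
      show "AE \<xi> in lborel. norm ((norm (commutator ?\<phi> t \<xi>))\<^sup>2 / ((norm \<xi>)\<^sup>2 + m\<^sup>2)) \<le> norm (?G \<xi>)"
      proof (rule AE_I2)
        fix \<xi> :: 'a
        have "norm ((norm (commutator ?\<phi> t \<xi>))\<^sup>2 / ((norm \<xi>)\<^sup>2 + m\<^sup>2)) = (norm (commutator ?\<phi> t \<xi>))\<^sup>2 / ((norm \<xi>)\<^sup>2 + m\<^sup>2)"
          by simp
        also have "\<dots> \<le> ?G \<xi>" by (rule commutator_bound)
        finally show "norm ((norm (commutator ?\<phi> t \<xi>))\<^sup>2 / ((norm \<xi>)\<^sup>2 + m\<^sup>2)) \<le> norm (?G \<xi>)" by simp
      qed
    qed measurable
    have "(LINT \<xi>|lborel. (norm (commutator ?\<phi> t \<xi>))\<^sup>2 / ((norm \<xi>)\<^sup>2 + m\<^sup>2)) \<le> (LINT \<xi>|lborel. ?G \<xi>)"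
      by (intro integral_mono i Gi commutator_bound)
    also have "\<dots> = 2 / m\<^sup>2 * (LINT \<xi>|lborel. (norm (cfourier (lap ?\<phi>) ?g \<xi>))\<^sup>2)
        + 8 * DIM('a) * (\<Sum>b\<in>Basis. LINT \<xi>|lborel. (norm (cfourier (dir_deriv b ?\<phi>) ?g \<xi>))\<^sup>2)"
      using F(1) D(1)
      by (simp only: Bochner_Integration.integral_add integrable_mult_right Bochner_Integration.integrable_sum
          integral_mult_right_zero Bochner_Integration.integral_sum)
    also have "\<dots> \<le> 2 / m\<^sup>2 * (P * (K0 / R * B)\<^sup>2) + 8 * DIM('a) * (\<Sum>b\<in>(Basis::'a set). P * (K b / R * B)\<^sup>2)"
    proof -
      have "P * (k / R * L2_norm ?g)\<^sup>2 \<le> P * (k / R * B)\<^sup>2" if "k > 0" for k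
        using that R B(2)[OF t] \<open>P > 0\<close> by (intro mult_left_mono power_mono) auto
      then show ?thesis
        using F(2) D(2) K(1) K0(1) unfolding P_def[symmetric]
        by (intro add_mono mult_left_mono sum_mono) (auto intro: order_trans)
    qed
    also have "\<dots> = C / R\<^sup>2"
    proof -
      have "P * (k / R * B)\<^sup>2 = (P * (k * B)\<^sup>2) / R\<^sup>2" for k by (simp add: power_mult_distrib power_divide)
      then show ?thesis
        unfolding C_def by (simp only: sum_divide_distrib[symmetric]) (simp add: add_divide_distrib)
    qed
    finally show ?thesis using i by simp
  qed
  then show ?thesis using C0 by blast
qed

text \<open>The forcing integral of \<open>ode_energy_estimate\<close> divided by b, the coefficient
  of |w|^2 in the bound there.\<close>

definition duhamel :: "('a \<Rightarrow> real) \<Rightarrow> real \<Rightarrow> 'a \<Rightarrow> real" where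
  "duhamel \<phi> T \<xi> = integral {0..T} (\<lambda>s. (norm (commutator \<phi> s \<xi>))\<^sup>2) / ((norm \<xi>)\<^sup>2 + m\<^sup>2)"

lemma duhamel_integral:
  assumes \<eta>: "\<eta> \<in> test_functions UNIV" and T: "T > 0"
  shows "\<exists>C\<ge>0. \<forall>R\<ge>1. integrable lborel (duhamel (cutoff \<eta> R) T) \<and>
    (LINT \<xi>|lborel. duhamel (cutoff \<eta> R) T \<xi>) \<le> C / R\<^sup>2"
proof -
  obtain C where C: "C \<ge> 0" and Ci: "\<And>R t. R \<ge> 1 \<Longrightarrow> t \<in> {0..T} \<Longrightarrow>
      integrable lborel (\<lambda>\<xi>. (norm (commutator (cutoff \<eta> R) t \<xi>))\<^sup>2 / ((norm \<xi>)\<^sup>2 + m\<^sup>2))"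
    and Cl: "\<And>R t. R \<ge> 1 \<Longrightarrow> t \<in> {0..T} \<Longrightarrow>
      (LINT \<xi>|lborel. (norm (commutator (cutoff \<eta> R) t \<xi>))\<^sup>2 / ((norm \<xi>)\<^sup>2 + m\<^sup>2)) \<le> C / R\<^sup>2"
    using commutator_integral[OF \<eta>, of T] by blast
  have "integrable lborel (duhamel (cutoff \<eta> R) T) \<and> (LINT \<xi>|lborel. duhamel (cutoff \<eta> R) T \<xi>) \<le> (T * C) / R\<^sup>2"
    if R: "R \<ge> 1" for R
  proof -
    let ?\<phi> = "cutoff \<eta> R"
    have \<phi>: "?\<phi> \<in> test_functions UNIV" using R by (intro cutoff_test \<eta>) simp
    \<comment> \<open>The commutator is controlled for nonnegative times only. Multiplying by the
      indicator of the closed strip gives a Borel function of (s, \<xi>), to which Fubini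
      applies.\<close>
    define H where "H s \<xi> = indicator {0..T} s * ((norm (commutator ?\<phi> s \<xi>))\<^sup>2 / ((norm \<xi>)\<^sup>2 + m\<^sup>2))" for s \<xi>
    have pos: "(norm \<xi>)\<^sup>2 + m\<^sup>2 \<noteq> 0" for \<xi> :: 'a
      using m_pos zero_le_power2[of "norm \<xi>"] zero_less_power2[of m] by linarith
    have "continuous_on ({0..T} \<times> UNIV) (\<lambda>z. (norm (commutator ?\<phi> (fst z) (snd z)))\<^sup>2 / ((norm (snd z))\<^sup>2 + m\<^sup>2))"
      using pos by (intro continuous_intros continuous_on_subset[OF commutator_continuous[OF \<phi>]]) auto
    then have "(\<lambda>z. indicator ({0..T} \<times> UNIV) z *\<^sub>R ((norm (commutator ?\<phi> (fst z) (snd z)))\<^sup>2 / ((norm (snd z))\<^sup>2 + m\<^sup>2)))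
        \<in> borel_measurable borel"
      by (intro borel_measurable_continuous_on_indicator) (auto intro!: borel_closed closed_Times)
    moreover have "(\<lambda>z. indicator ({0..T} \<times> UNIV) z *\<^sub>R ((norm (commutator ?\<phi> (fst z) (snd z)))\<^sup>2 / ((norm (snd z))\<^sup>2 + m\<^sup>2))) = (\<lambda>(s, \<xi>). H s \<xi>)"
      by (auto simp: H_def indicator_def)
    ultimately have Hm: "(\<lambda>(s, \<xi>). H s \<xi>) \<in> borel_measurable (lborel \<Otimes>\<^sub>M lborel)"
      by (simp add: lborel_prod)
    have Hi: "integrable lborel (H s)" for s
      unfolding H_def using Ci[OF R, of s] by (cases "s \<in> {0..T}") auto
    have H0: "H s \<xi> \<ge> 0" for s \<xi> by (simp add: H_def)
    have Hl: "(LINT \<xi>|lborel. H s \<xi>) \<le> indicator {0..T} s * (C / R\<^sup>2)" for s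
      unfolding H_def using Cl[OF R, of s] by (cases "s \<in> {0..T}") auto
    have ind: "integrable lborel (\<lambda>s. indicator {0..T} s * (C / R\<^sup>2))"
      using T by (intro integrable_mult_left integrable_real_indicator) (auto simp: emeasure_lborel_Icc_eq)
    have Hii: "integrable lborel (\<lambda>s. LINT \<xi>|lborel. H s \<xi>)"
    proof (rule Bochner_Integration.integrable_bound[OF ind])
      show "(\<lambda>s. LINT \<xi>|lborel. H s \<xi>) \<in> borel_measurable lborel"
        using Hm by (rule lborel.borel_measurable_lebesgue_integral)
      show "AE s in lborel. norm (LINT \<xi>|lborel. H s \<xi>) \<le> norm (indicator {0..T} s * (C / R\<^sup>2))"
        using Hl H0 C by (intro AE_I2) (simp add: order_trans[OF Hl])
    qed
    have Hint: "integrable (lborel \<Otimes>\<^sub>M lborel) (\<lambda>(s, \<xi>). H s \<xi>)"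
      using Hm Hii Hi H0 by (intro lborel_pair.Fubini_integrable) (auto simp: case_prod_beta)
    have eq: "(LINT s|lborel. H s \<xi>) = duhamel ?\<phi> T \<xi>" for \<xi>
    proof -
      have "continuous_on {0..T} (\<lambda>s. commutator ?\<phi> s \<xi>)"
        by (rule continuous_on_subset[OF commutator_continuous_time[OF \<phi>]]) simp
      then have "continuous_on {0..T} (\<lambda>s. (norm (commutator ?\<phi> s \<xi>))\<^sup>2 / ((norm \<xi>)\<^sup>2 + m\<^sup>2))"
        by (intro continuous_intros) (use pos in blast)+
      from lborel_integral_indicator[OF this] show ?thesis
        by (simp add: H_def duhamel_def)
    qed
    have "integrable lborel (\<lambda>\<xi>. LINT s|lborel. H s \<xi>)"
      using lborel_pair.integrable_snd[OF Hint] by simp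
    moreover have "(LINT \<xi>|lborel. LINT s|lborel. H s \<xi>) = (LINT s|lborel. LINT \<xi>|lborel. H s \<xi>)"
      by (rule lborel_pair.Fubini_integral[OF Hint])
    moreover have "\<dots> \<le> (LINT s|lborel. indicator {0..T} s * (C / R\<^sup>2))"
      by (intro integral_mono Hii ind Hl)
    moreover have "\<dots> = T * C / R\<^sup>2" using T by simp
    ultimately show ?thesis using T by (simp add: eq)
  qed
  then show ?thesis using C T by (intro exI[of _ "T * C"]) auto
qed

text \<open>An admissible \<delta> for \<open>ode_energy_estimate\<close> with a = |\<xi>|^2 and b =
  |\<xi>|^2 + m^2: the factor 1/2 ensures 2\<delta> \<le> a and \<delta> \<le> 1, the factor m/2
  ensures 4\<delta>^2 \<le> m^2 \<le> b.\<close>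

definition rate :: "'a \<Rightarrow> real" where
  "rate \<xi> = min (1 / 2) (m / 2) * min 1 ((norm \<xi>)\<^sup>2)"

text \<open>The estimate is stated for the difference of the localised solution and a solution \<open>z\<close> of the
  exact equation, so that it serves both bounds.\<close>

lemma cfourier_estimate:
  assumes \<phi>: "\<phi> \<in> test_functions UNIV" and T: "T > 0"
    and z: "\<And>t. t \<ge> 0 \<Longrightarrow> (z has_vector_derivative z' t) (at t within {0..})"
    and z': "\<And>t. t \<ge> 0 \<Longrightarrow> (z' has_vector_derivative
      (- of_real ((norm \<xi>)\<^sup>2) * z' t - of_real ((norm \<xi>)\<^sup>2 + m\<^sup>2) * z t)) (at t within {0..})"
  shows "(norm (cfourier \<phi> (u T) \<xi> - z T))\<^sup>2 \<le>
    5 * exp 1 * exp (- (4 / 5 * rate \<xi> * T)) * ((norm (cfourier \<phi> (v 0) \<xi> - z' 0))\<^sup>2 / m\<^sup>2 + (norm (cfourier \<phi> (u 0) \<xi> - z 0))\<^sup>2)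
    + 8 * exp 1 * T * duhamel \<phi> T \<xi>"
proof -
  define a b where "a = (norm \<xi>)\<^sup>2" and "b = (norm \<xi>)\<^sup>2 + m\<^sup>2"
  have a: "a \<ge> 0" by (simp add: a_def)
  have b: "b > 0" "m\<^sup>2 \<le> b" "a \<le> b" using m_pos by (simp_all add: b_def a_def add_nonneg_pos)
  let ?\<kappa> = "min (1 / 2) (m / 2)"
  have \<kappa>: "0 \<le> ?\<kappa>" "?\<kappa> \<le> 1 / 2" "?\<kappa> \<le> m / 2" using m_pos by auto
  have r: "rate \<xi> = ?\<kappa> * min 1 a" by (simp add: rate_def a_def)
  have \<delta>: "0 \<le> rate \<xi>" unfolding r using \<kappa> a by (intro mult_nonneg_nonneg) auto
  have \<delta>1: "rate \<xi> \<le> 1 / 2 * a" unfolding r using \<kappa> a by (intro mult_mono) auto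
  have \<delta>2: "rate \<xi> \<le> m / 2 * 1" unfolding r using \<kappa> a m_pos by (intro mult_mono) auto
  have \<delta>3: "rate \<xi> \<le> 1 / 2 * 1" unfolding r using \<kappa> a by (intro mult_mono) auto
  have "(rate \<xi>)\<^sup>2 \<le> (m / 2)\<^sup>2" using \<delta> \<delta>2 by (intro power_mono) auto
  then have \<delta>4: "4 * (rate \<xi>)\<^sup>2 \<le> b" using b(2) by (simp add: power_divide)
  note cc = commutator_continuous_time[OF \<phi>, of \<xi>]
  have *: "b * (norm (cfourier \<phi> (u T) \<xi> - z T))\<^sup>2 \<le>
     5 * exp (1 - 4 / 5 * rate \<xi> * T) * ((norm (cfourier \<phi> (v 0) \<xi> - z' 0))\<^sup>2 + b * (norm (cfourier \<phi> (u 0) \<xi> - z 0))\<^sup>2)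
    + 8 * exp 1 * T * integral {0..T} (\<lambda>s. (norm (commutator \<phi> s \<xi>))\<^sup>2)"
  proof (rule ode_energy_estimate[where w = "\<lambda>t. cfourier \<phi> (u t) \<xi> - z t" and p = "\<lambda>t. cfourier \<phi> (v t) \<xi> - z' t" and a = a and b = b])
    show "((\<lambda>t. cfourier \<phi> (u t) \<xi> - z t) has_vector_derivative cfourier \<phi> (v t) \<xi> - z' t) (at t within {0..})" if "t \<ge> 0" for t
      by (intro has_vector_derivative_diff cfourier_deriv \<phi> that z)
    show "((\<lambda>t. cfourier \<phi> (v t) \<xi> - z' t) has_vector_derivative - of_real a * (cfourier \<phi> (v t) \<xi> - z' t)
        - of_real b * (cfourier \<phi> (u t) \<xi> - z t) + commutator \<phi> t \<xi>) (at t within {0..})" if "t \<ge> 0" for t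
      by (rule has_vector_derivative_eq_rhs[OF has_vector_derivative_diff[OF cfourier_equation[OF \<phi> that] z'[OF that]]])
        (simp add: a_def b_def algebra_simps)
  qed (use cc T \<delta> \<delta>1 \<delta>3 \<delta>4 b in auto)
  let ?V = "(norm (cfourier \<phi> (v 0) \<xi> - z' 0))\<^sup>2" and ?U = "(norm (cfourier \<phi> (u 0) \<xi> - z 0))\<^sup>2"
  let ?e = "5 * exp (1 - 4 / 5 * rate \<xi> * T)" and ?D = "8 * exp 1 * T * integral {0..T} (\<lambda>s. (norm (commutator \<phi> s \<xi>))\<^sup>2)"
  have "(norm (cfourier \<phi> (u T) \<xi> - z T))\<^sup>2 \<le> (?e * (?V + b * ?U) + ?D) / b"
    using * b(1) by (simp add: pos_le_divide_eq mult.commute)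
  also have "\<dots> = ?e * (?V / b + ?U) + ?D / b" using b(1) by (simp add: field_simps)
  also have "\<dots> \<le> ?e * (?V / m\<^sup>2 + ?U) + ?D / b"
    using b m_pos by (intro add_right_mono mult_left_mono divide_left_mono) auto
  also have "?e = 5 * exp 1 * exp (- (4 / 5 * rate \<xi> * T))" using exp_add[of 1 "- (4 / 5 * rate \<xi> * T)"] by simp
  also have "?D / b = 8 * exp 1 * T * duhamel \<phi> T \<xi>" by (simp add: duhamel_def b_def)
  finally show ?thesis .
qed

end

section \<open>The upper bound\<close>

lemma gaussian_integral:
  assumes s: "s > 0"
  shows "integrable lborel (\<lambda>x::'a::euclidean_space. exp (- (s * (norm x)\<^sup>2)))"
    and "(LINT x::'a|lborel. exp (- (s * (norm x)\<^sup>2))) = sqrt (pi / s) ^ DIM('a)"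
proof -
  let ?g = "\<lambda>x::'a. exp (- (norm x)\<^sup>2 / 2)"
  have "integrable lborel (\<lambda>x::'a. complex_of_real (?g x))"
    "(LINT x|lborel. complex_of_real (?g x)) = complex_of_real (sqrt (2 * pi) ^ DIM('a))"
    using gaussian_fourier[of "0::'a"] by simp_all
  then have g: "integrable lborel ?g" "(LINT x|lborel. ?g x) = sqrt (2 * pi) ^ DIM('a)"
    using integrable_Re by (fastforce, metis integral_complex_of_real of_real_eq_iff)
  let ?c = "sqrt (2 * s)"
  have c: "?c \<noteq> 0" "?c > 0" using s by auto
  have [measurable]: "?g \<in> borel_measurable borel" by measurable
  have eq: "?g (0 + ?c *\<^sub>R x) = exp (- (s * (norm x)\<^sup>2))" for x
    using s by (simp add: power_mult_distrib)
  show "integrable lborel (\<lambda>x::'a. exp (- (s * (norm x)\<^sup>2)))"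
    using lborel_integrable_affine[OF c(1), of ?g 0] g(1) by (simp only: eq) simp
  have "sqrt (2 * pi) ^ DIM('a) = \<bar>?c\<bar> ^ DIM('a) *\<^sub>R (LINT x::'a|lborel. exp (- (s * (norm x)\<^sup>2)))"
    using lborel_integral_affine[OF c(1), of ?g 0] g(2) by (simp only: eq) simp
  then have "(LINT x::'a|lborel. exp (- (s * (norm x)\<^sup>2))) = (sqrt (2 * pi) / ?c) ^ DIM('a)"
    using c by (simp add: power_divide field_simps)
  also have "sqrt (2 * pi) / ?c = sqrt (pi / s)" using s by (simp add: real_sqrt_divide real_sqrt_mult)
  finally show "(LINT x::'a|lborel. exp (- (s * (norm x)\<^sup>2))) = sqrt (pi / s) ^ DIM('a)" .
qed

lemma cutoff_tendsto:
  assumes \<eta>: "\<eta> \<in> test_functions UNIV" "\<eta> 0 = 1"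
  shows "(\<lambda>k. cutoff \<eta> (real (Suc k)) x) \<longlonglongrightarrow> 1"
proof -
  have "isCont \<eta> (0 *\<^sub>R x)"
    using Ck_continuous[OF test_functionsD(1)[OF \<eta>(1)]] by (simp add: continuous_on_eq_continuous_at)
  moreover have "(\<lambda>k. inverse (real (Suc k)) *\<^sub>R x) \<longlonglongrightarrow> 0 *\<^sub>R x"
    by (intro tendsto_intros LIMSEQ_inverse_real_of_nat)
  ultimately have "(\<lambda>k. \<eta> (inverse (real (Suc k)) *\<^sub>R x)) \<longlonglongrightarrow> \<eta> (0 *\<^sub>R x)"
    by (rule isCont_tendsto_compose)
  then show ?thesis by (simp add: cutoff_def \<eta>(2))
qed

lemma cutoff_L2_tendsto:
  assumes \<eta>: "\<eta> \<in> test_functions UNIV" "\<eta> 0 = 1" "\<And>x. \<bar>\<eta> x\<bar> \<le> 1" and g: "g \<in> L2"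
  shows "(\<lambda>k. (L2_norm (\<lambda>x. of_real (cutoff \<eta> (real (Suc k)) x) * g x))\<^sup>2) \<longlonglongrightarrow> (L2_norm g)\<^sup>2"
  unfolding L2_norm_power2
proof (rule integral_dominated_convergence)
  note [measurable] = L2D(1)[OF g]
  have [measurable]: "(\<lambda>x. complex_of_real (cutoff \<eta> (real (Suc k)) x)) \<in> borel_measurable lebesgue" for k
    by (intro L2D(1) test_function_L2 cutoff_test \<eta>) simp
  show "(\<lambda>x. (norm (g x))\<^sup>2) \<in> borel_measurable lebesgue"
    "(\<lambda>x. (norm (of_real (cutoff \<eta> (real (Suc k)) x) * g x))\<^sup>2) \<in> borel_measurable lebesgue" for k
    by measurable
  show "integrable lebesgue (\<lambda>x. (norm (g x))\<^sup>2)" by (rule L2D(2)[OF g])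
  have "\<bar>cutoff \<eta> R x\<bar>\<^sup>2 \<le> 1" for R x using power_mono[OF \<eta>(3), of _ 2] by (simp add: cutoff_def)
  then show "AE x in lebesgue. norm ((norm (of_real (cutoff \<eta> (real (Suc k)) x) * g x))\<^sup>2) \<le> (norm (g x))\<^sup>2" for k
    by (intro AE_I2) (simp add: norm_mult power_mult_distrib mult_left_le_one_le)
  have "(\<lambda>k. (norm (of_real (cutoff \<eta> (real (Suc k)) x) * g x))\<^sup>2) \<longlonglongrightarrow> (norm (of_real 1 * g x))\<^sup>2" for x
    by (intro tendsto_intros cutoff_tendsto \<eta>)
  then show "AE x in lebesgue. (\<lambda>k. (norm (of_real (cutoff \<eta> (real (Suc k)) x) * g x))\<^sup>2) \<longlonglongrightarrow> (norm (g x))\<^sup>2"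
    by simp
qed

lemma norm_cfourier_le:
  assumes \<phi>: "\<phi> \<in> test_functions UNIV" and 1: "\<And>x. \<bar>\<phi> x\<bar> \<le> 1" and g: "integrable lebesgue g"
  shows "norm (cfourier \<phi> g \<xi>) \<le> L1_norm g"
proof -
  have "norm (cfourier \<phi> g \<xi>) \<le> L1_norm (\<lambda>x. of_real (\<phi> x) * g x)"
    unfolding cfourier_def by (rule norm_fourier_le)
  also have "\<dots> \<le> L1_norm g"
    unfolding L1_norm_def
    by (rule integral_mono') (use g 1 in \<open>auto simp: norm_mult mult_left_le_one_le\<close>)
  finally show ?thesis .
qed

lemma cutoff_profile_exists:
  obtains \<eta> :: "'a::euclidean_space \<Rightarrow> real"
  where "\<eta> \<in> test_functions UNIV" "\<eta> 0 = 1" "\<And>x. 0 \<le> \<eta> x" "\<And>x. \<eta> x \<le> 1"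
  using cutoff_exists[where 'a = 'a] by metis

context wave_solution
begin

lemma upper_estimate:
  assumes u0: "integrable lebesgue (u 0)" and v0: "integrable lebesgue (v 0)" and T: "T > 0"
    and c: "c = 4 / 5 * min (1 / 2) (m / 2)"
  shows "(2 * pi) ^ DIM('a) * (L2_norm (u T))\<^sup>2 \<le> 5 * exp 1 *
    (sqrt (pi / (c * T)) ^ DIM('a) * ((L1_norm (v 0))\<^sup>2 / m\<^sup>2 + (L1_norm (u 0))\<^sup>2)
     + exp (- (c * T)) * ((2 * pi) ^ DIM('a) * ((L2_norm (v 0))\<^sup>2 / m\<^sup>2 + (L2_norm (u 0))\<^sup>2)))"
proof -
  obtain \<eta> :: "'a \<Rightarrow> real" where \<eta>: "\<eta> \<in> test_functions UNIV" "\<eta> 0 = 1" "\<And>x. 0 \<le> \<eta> x" "\<And>x. \<eta> x \<le> 1"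
    by (rule cutoff_profile_exists) blast
  have \<eta>1: "\<bar>\<eta> x\<bar> \<le> 1" for x using \<eta>(3,4)[of x] by simp
  obtain C where C: "\<And>R. R \<ge> 1 \<Longrightarrow> integrable lborel (duhamel (cutoff \<eta> R) T)"
      "\<And>R. R \<ge> 1 \<Longrightarrow> (LINT \<xi>|lborel. duhamel (cutoff \<eta> R) T \<xi>) \<le> C / R\<^sup>2"
    using duhamel_integral[OF \<eta>(1) T] by blast
  have c0: "c > 0" using m_pos by (simp add: c)
  let ?N = "(2 * pi) ^ DIM('a)"
  let ?X = "(L1_norm (v 0))\<^sup>2 / m\<^sup>2 + (L1_norm (u 0))\<^sup>2"
  let ?Y = "(L2_norm (v 0))\<^sup>2 / m\<^sup>2 + (L2_norm (u 0))\<^sup>2"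
  have *: "?N * (L2_norm (\<lambda>x. of_real (cutoff \<eta> R x) * u T x))\<^sup>2 \<le>
      5 * exp 1 * (sqrt (pi / (c * T)) ^ DIM('a) * ?X + exp (- (c * T)) * (?N * ?Y)) + 8 * exp 1 * T * (C / R\<^sup>2)" if R: "R \<ge> 1" for R
  proof -
    let ?\<phi> = "cutoff \<eta> R"
    have \<phi>: "?\<phi> \<in> test_functions UNIV" using R by (intro cutoff_test \<eta>) simp
    have \<phi>1: "\<bar>?\<phi> x\<bar> \<le> 1" for x using \<eta>1 by (simp add: cutoff_def)
    let ?V = "\<lambda>\<xi>. (norm (cfourier ?\<phi> (v 0) \<xi>))\<^sup>2" and ?U = "\<lambda>\<xi>. (norm (cfourier ?\<phi> (u 0) \<xi>))\<^sup>2"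
    \<comment> \<open>Both frequency regimes are added instead of splitting the domain: the terms
      are nonnegative and one of them suffices at each \<xi>. The Gaussian carries the pointwise
      bound \<open>?X\<close>, while beyond the unit ball integrability in \<xi> has to come from
      the transforms themselves.\<close>
    let ?G = "\<lambda>\<xi>. 5 * exp 1 * (exp (- (c * T * (norm \<xi>)\<^sup>2)) * ?X + exp (- (c * T)) * (?V \<xi> / m\<^sup>2 + ?U \<xi>)) + 8 * exp 1 * T * duhamel ?\<phi> T \<xi>"
    note VL = cfourier_L2_le[OF \<phi> v_L2[of 0] \<phi>1] and UL = cfourier_L2_le[OF \<phi> u_L2[of 0] \<phi>1]
    have cT: "c * T > 0" using c0 T by simp
    have Gi: "integrable lborel ?G"
      using VL(1) UL(1) C(1)[OF R] gaussian_integral(1)[OF cT, where 'a = 'a] by simp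
    have "?N * (L2_norm (\<lambda>x. of_real (?\<phi> x) * u T x))\<^sup>2 = (LINT \<xi>|lborel. (norm (cfourier ?\<phi> (u T) \<xi>))\<^sup>2)"
    proof -
      have [measurable]: "cfourier ?\<phi> (u T) \<in> borel_measurable borel"
        using T by (intro borel_measurable_continuous_onI cfourier_L2(3)[OF \<phi>] u_L2) simp
      have "?N * (L2_norm (\<lambda>x. of_real (?\<phi> x) * u T x))\<^sup>2 = (L2_norm (cfourier ?\<phi> (u T)))\<^sup>2"
        using T by (intro cfourier_L2(5)[OF \<phi>, symmetric] u_L2) simp
      also have "\<dots> = (LINT \<xi>|lborel. (norm (cfourier ?\<phi> (u T) \<xi>))\<^sup>2)"
        unfolding L2_norm_power2 by (rule integral_completion) measurable
      finally show ?thesis .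
    qed
    also have "\<dots> \<le> (LINT \<xi>|lborel. ?G \<xi>)"
    proof (rule integral_mono'[OF Gi])
      fix \<xi> :: 'a
      have est: "(norm (cfourier ?\<phi> (u T) \<xi> - 0))\<^sup>2 \<le>
          5 * exp 1 * exp (- (4 / 5 * rate \<xi> * T)) * ((norm (cfourier ?\<phi> (v 0) \<xi> - 0))\<^sup>2 / m\<^sup>2 + (norm (cfourier ?\<phi> (u 0) \<xi> - 0))\<^sup>2)
          + 8 * exp 1 * T * duhamel ?\<phi> T \<xi>"
        by (rule cfourier_estimate[OF \<phi> T, where z = "\<lambda>_. 0" and z' = "\<lambda>_. 0"]) auto
      have VU: "?V \<xi> / m\<^sup>2 + ?U \<xi> \<le> ?X"
        using norm_cfourier_le[OF \<phi> \<phi>1 v0, of \<xi>] norm_cfourier_le[OF \<phi> \<phi>1 u0, of \<xi>]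
        by (intro add_mono divide_right_mono power_mono) auto
      have VU0: "0 \<le> ?V \<xi> / m\<^sup>2 + ?U \<xi>" by simp
      have "exp (- (4 / 5 * rate \<xi> * T)) * (?V \<xi> / m\<^sup>2 + ?U \<xi>) \<le>
          exp (- (c * T * (norm \<xi>)\<^sup>2)) * ?X + exp (- (c * T)) * (?V \<xi> / m\<^sup>2 + ?U \<xi>)"
      proof (cases "(norm \<xi>)\<^sup>2 \<le> 1")
        case True
        then have e: "exp (- (4 / 5 * rate \<xi> * T)) = exp (- (c * T * (norm \<xi>)\<^sup>2))" by (simp add: rate_def c min_def mult_ac)
        moreover have "exp (- (c * T * (norm \<xi>)\<^sup>2)) * (?V \<xi> / m\<^sup>2 + ?U \<xi>) \<le> exp (- (c * T * (norm \<xi>)\<^sup>2)) * ?X"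
          by (intro mult_left_mono VU) simp
        moreover have "0 \<le> exp (- (c * T)) * (?V \<xi> / m\<^sup>2 + ?U \<xi>)" using VU0 by simp
        ultimately show ?thesis unfolding e by linarith
      next
        case False
        then have e: "exp (- (4 / 5 * rate \<xi> * T)) = exp (- (c * T))" by (simp add: rate_def c min_def mult_ac)
        moreover have "0 \<le> exp (- (c * T * (norm \<xi>)\<^sup>2)) * ?X" by simp
        ultimately show ?thesis unfolding e by linarith
      qed
      then have "5 * exp 1 * (exp (- (4 / 5 * rate \<xi> * T)) * (?V \<xi> / m\<^sup>2 + ?U \<xi>)) \<le>
          5 * exp 1 * (exp (- (c * T * (norm \<xi>)\<^sup>2)) * ?X + exp (- (c * T)) * (?V \<xi> / m\<^sup>2 + ?U \<xi>))"
        by (intro mult_left_mono) auto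
      then show "(norm (cfourier ?\<phi> (u T) \<xi>))\<^sup>2 \<le> ?G \<xi>"
        using est by (simp only: diff_zero mult.assoc)
      show "0 \<le> ?G \<xi>" using order_trans[OF zero_le_power2 \<open>(norm (cfourier ?\<phi> (u T) \<xi>))\<^sup>2 \<le> ?G \<xi>\<close>] .
    qed
    also have "\<dots> = 5 * exp 1 * (sqrt (pi / (c * T)) ^ DIM('a) * ?X
        + exp (- (c * T)) * ((LINT \<xi>|lborel. ?V \<xi>) / m\<^sup>2 + (LINT \<xi>|lborel. ?U \<xi>))) + 8 * exp 1 * T * (LINT \<xi>|lborel. duhamel ?\<phi> T \<xi>)"
      using VL(1) UL(1) C(1)[OF R] gaussian_integral[OF cT, where 'a = 'a] by simp
    also have "\<dots> \<le> 5 * exp 1 * (sqrt (pi / (c * T)) ^ DIM('a) * ?X + exp (- (c * T)) * (?N * ?Y)) + 8 * exp 1 * T * (C / R\<^sup>2)"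
    proof -
      have "(LINT \<xi>|lborel. ?V \<xi>) / m\<^sup>2 \<le> (?N * (1 * L2_norm (v 0))\<^sup>2) / m\<^sup>2"
        using VL(2) by (intro divide_right_mono) auto
      then have "(LINT \<xi>|lborel. ?V \<xi>) / m\<^sup>2 + (LINT \<xi>|lborel. ?U \<xi>) \<le> ?N * ?Y"
        using UL(2) by (simp add: distrib_left)
      then show ?thesis
        using C(2)[OF R] T by (intro add_mono mult_left_mono order_refl) auto
    qed
    finally show ?thesis .
  qed
  have l1: "(\<lambda>k. ?N * (L2_norm (\<lambda>x. of_real (cutoff \<eta> (real (Suc k)) x) * u T x))\<^sup>2) \<longlonglongrightarrow> ?N * (L2_norm (u T))\<^sup>2"
    using T by (intro tendsto_mult_left cutoff_L2_tendsto \<eta> \<eta>1 u_L2) simp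
  have "(\<lambda>k. 5 * exp 1 * (sqrt (pi / (c * T)) ^ DIM('a) * ?X + exp (- (c * T)) * (?N * ?Y)) + 8 * exp 1 * T * (C * (inverse (real (Suc k)))\<^sup>2))
     \<longlonglongrightarrow> 5 * exp 1 * (sqrt (pi / (c * T)) ^ DIM('a) * ?X + exp (- (c * T)) * (?N * ?Y)) + 8 * exp 1 * T * (C * 0\<^sup>2)"
    by (intro tendsto_intros LIMSEQ_inverse_real_of_nat)
  then have l2: "(\<lambda>k. 5 * exp 1 * (sqrt (pi / (c * T)) ^ DIM('a) * ?X + exp (- (c * T)) * (?N * ?Y)) + 8 * exp 1 * T * (C / (real (Suc k))\<^sup>2))
     \<longlonglongrightarrow> 5 * exp 1 * (sqrt (pi / (c * T)) ^ DIM('a) * ?X + exp (- (c * T)) * (?N * ?Y))"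
    by (simp add: divide_inverse power_inverse del: of_nat_Suc)
  show ?thesis
    by (rule LIMSEQ_le[OF l1 l2]) (use * in auto)
qed

end

section \<open>The lower bound\<close>

text \<open>The roots of the characteristic polynomial are -a/2 \<plusminus> i \<omega>; positivity
  of \<omega> selects the oscillating regime, which contains the low frequencies.\<close>

lemma free_solution:
  fixes P0 P1 :: complex and a b \<omega> :: real
  assumes \<omega>: "\<omega> > 0" "\<omega>\<^sup>2 = b - a\<^sup>2 / 4"
  obtains z z' :: "real \<Rightarrow> complex"
  where "\<And>t. (z has_vector_derivative z' t) (at t)"
    "\<And>t. (z' has_vector_derivative (- of_real a * z' t - of_real b * z t)) (at t)"
    "z 0 = P0" "z' 0 = P1"
    "\<And>t. z t = of_real (exp (- (a * t / 2))) * (P0 * of_real (cos (\<omega> * t)) + (P1 + of_real (a / 2) * P0) / of_real \<omega> * of_real (sin (\<omega> * t)))"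
proof -
  define Q where "Q = (P1 + of_real (a / 2) * P0) / of_real \<omega>"
  define C S where "C t = exp (- (a * t / 2)) * cos (\<omega> * t)" and "S t = exp (- (a * t / 2)) * sin (\<omega> * t)" for t
  have C: "(C has_real_derivative (- (a / 2) * C t - \<omega> * S t)) (at t)"
    and S: "(S has_real_derivative (- (a / 2) * S t + \<omega> * C t)) (at t)" for t
    unfolding C_def[abs_def] S_def[abs_def] by (auto intro!: derivative_eq_intros simp: algebra_simps)
  \<comment> \<open>The pair (z, y) rotates with angular speed \<omega> while it decays like e^{-a t
    / 2}. This first-order system delivers both derivatives of z.\<close>
  define z y where "z t = of_real (C t) * P0 + of_real (S t) * Q" and "y t = of_real (C t) * Q - of_real (S t) * P0" for t
  have m: "((\<lambda>t. of_real (f t) * K) has_vector_derivative of_real f' * K) (at t)" if "(f has_real_derivative f') (at t)"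
    for f f' t and K :: complex
    using has_vector_derivative_scaleR[OF that has_vector_derivative_const[of K]] by (simp add: scaleR_conv_of_real)
  have zd: "(z has_vector_derivative (- of_real (a / 2) * z t + of_real \<omega> * y t)) (at t)" for t
    unfolding z_def[abs_def]
    by (rule has_vector_derivative_eq_rhs[OF has_vector_derivative_add[OF m[OF C] m[OF S]]]) (simp add: z_def y_def algebra_simps)
  have yd: "(y has_vector_derivative (- of_real (a / 2) * y t - of_real \<omega> * z t)) (at t)" for t
    unfolding y_def[abs_def]
    by (rule has_vector_derivative_eq_rhs[OF has_vector_derivative_diff[OF m[OF C] m[OF S]]]) (simp add: z_def y_def algebra_simps)
  define z' where "z' t = - of_real (a / 2) * z t + of_real \<omega> * y t" for t
  have b: "complex_of_real b = of_real \<omega> * of_real \<omega> + of_real (a / 2) * of_real (a / 2)"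
    using \<omega>(2) by (simp flip: of_real_mult of_real_add add: power2_eq_square)
  have z'd: "(z' has_vector_derivative (- of_real a * z' t - of_real b * z t)) (at t)" for t
    unfolding z'_def[abs_def]
  proof (rule has_vector_derivative_eq_rhs)
    show "((\<lambda>t. - of_real (a / 2) * z t + of_real \<omega> * y t) has_vector_derivative
       - of_real (a / 2) * (- of_real (a / 2) * z t + of_real \<omega> * y t) + of_real \<omega> * (- of_real (a / 2) * y t - of_real \<omega> * z t)) (at t)"
      by (intro has_vector_derivative_add has_vector_derivative_mult_right zd yd)
    have alg: "- h * (- h * x + o' * y) + o' * (- h * y - o' * x) = - (h + h) * (- h * x + o' * y) - (o' * o' + h * h) * x"
      for h o' x y :: complex by (simp add: algebra_simps)
    have "complex_of_real a = of_real (a / 2) + of_real (a / 2)" by (simp flip: of_real_add)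
    then show "- of_real (a / 2) * (- of_real (a / 2) * z t + of_real \<omega> * y t) + of_real \<omega> * (- of_real (a / 2) * y t - of_real \<omega> * z t)
        = - of_real a * (- of_real (a / 2) * z t + of_real \<omega> * y t) - of_real b * z t"
      unfolding b by (simp only: alg)
  qed
  show ?thesis
  proof (rule that[of z z'])
    show "(z has_vector_derivative z' t) (at t)" for t unfolding z'_def by (rule zd)
    show "z' 0 = P1" using \<omega>(1) by (simp add: z'_def z_def y_def C_def S_def Q_def)
    show "z t = of_real (exp (- (a * t / 2))) * (P0 * of_real (cos (\<omega> * t)) + (P1 + of_real (a / 2) * P0) / of_real \<omega> * of_real (sin (\<omega> * t)))" for t
      unfolding Q_def[symmetric] by (simp add: z_def C_def S_def algebra_simps)
  qed (use z'd in \<open>auto simp: z_def C_def S_def\<close>)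
qed

text \<open>At frequencies \<open>\<xi>\<close> with \<open>T |\<xi>|\<^sup>2\<close> close to \<open>s\<^sub>0\<close> the phase \<open>\<omega> T\<close> is close to
  \<open>m T + s\<^sub>0 / (2 m)\<close>.\<close>

lemma phase_approximation:
  fixes m s0 :: real
  assumes m: "m > 0"
  shows "\<exists>d>0. \<forall>s a. \<bar>s - s0\<bar> < d \<longrightarrow> \<bar>a\<bar> < d \<longrightarrow>
    (let w = sqrt (m\<^sup>2 + a - a\<^sup>2 / 4) in
      w > 0 \<and> w\<^sup>2 = m\<^sup>2 + a - a\<^sup>2 / 4 \<and> \<bar>s * (1 - a / 4) / (w + m) - s0 / (2 * m)\<bar> \<le> 1 / 8 \<and> \<bar>m / w - 1\<bar> \<le> 1 / 8 \<and> \<bar>a / (2 * w)\<bar> \<le> 1 / 8)"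
proof -
  let ?w = "\<lambda>z::real \<times> real. sqrt (m\<^sup>2 + snd z - (snd z)\<^sup>2 / 4)"
  \<comment> \<open>The claim is continuity at (s0, 0) with s and a as independent variables. In the
    application a = s / T, and large T makes a small.\<close>
  let ?F = "nhds (s0, 0::real)"
  have fst: "(fst \<longlongrightarrow> s0) ?F" using tendsto_fst[OF filterlim_ident[of "nhds (s0, 0::real)"]] by simp
  have snd: "(snd \<longlongrightarrow> 0) ?F" using tendsto_snd[OF filterlim_ident[of "nhds (s0, 0::real)"]] by simp
  have w0: "(?w \<longlongrightarrow> sqrt (m\<^sup>2 + 0 - 0\<^sup>2 / 4)) ?F" by (intro tendsto_intros snd) simp_all
  then have w: "(?w \<longlongrightarrow> m) ?F" using m by simp
  have e1: "\<forall>\<^sub>F z in ?F. 0 < ?w z" using w m by (rule order_tendstoD(1))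
  have "((\<lambda>z. fst z * (1 - snd z / 4) / (?w z + m)) \<longlongrightarrow> s0 * (1 - 0 / 4) / (m + m)) ?F"
    by (intro tendsto_intros fst snd w) (use m in auto)
  then have "((\<lambda>z. fst z * (1 - snd z / 4) / (?w z + m)) \<longlongrightarrow> s0 / (2 * m)) ?F" by simp
  from tendstoD[OF this, of "1 / 8"]
  have e2: "\<forall>\<^sub>F z in ?F. dist (fst z * (1 - snd z / 4) / (?w z + m)) (s0 / (2 * m)) < 1 / 8" by simp
  have "((\<lambda>z. m / ?w z) \<longlongrightarrow> m / m) ?F" by (intro tendsto_intros w) (use m in auto)
  from tendstoD[OF this, of "1 / 8"] have e3: "\<forall>\<^sub>F z in ?F. dist (m / ?w z) 1 < 1 / 8" using m by simp
  have "((\<lambda>z. snd z / (2 * ?w z)) \<longlongrightarrow> 0 / (2 * m)) ?F" by (intro tendsto_intros snd w) (use m in auto)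
  from tendstoD[OF this, of "1 / 8"] have e4: "\<forall>\<^sub>F z in ?F. dist (snd z / (2 * ?w z)) 0 < 1 / 8" by simp
  have "\<forall>\<^sub>F z in ?F. 0 < ?w z \<and> dist (fst z * (1 - snd z / 4) / (?w z + m)) (s0 / (2 * m)) < 1 / 8 \<and> dist (m / ?w z) 1 < 1 / 8
      \<and> dist (snd z / (2 * ?w z)) 0 < 1 / 8"
    using e1 e2 e3 e4 by eventually_elim simp
  then obtain d where d: "d > 0" "\<And>z. dist z (s0, 0) < d \<Longrightarrow> 0 < ?w z \<and> dist (fst z * (1 - snd z / 4) / (?w z + m)) (s0 / (2 * m)) < 1 / 8 \<and> dist (m / ?w z) 1 < 1 / 8
      \<and> dist (snd z / (2 * ?w z)) 0 < 1 / 8"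
    unfolding eventually_nhds_metric by blast
  show ?thesis
  proof (intro exI[of _ "d / 2"] conjI allI impI)
    show "0 < d / 2" using d by simp
    fix s a :: real assume s: "\<bar>s - s0\<bar> < d / 2" and a: "\<bar>a\<bar> < d / 2"
    have "dist (s, a) (s0, 0) \<le> \<bar>s - s0\<bar> + \<bar>a\<bar>"
      unfolding dist_Pair_Pair dist_real_def using sqrt_sum_squares_le_sum_abs[of "s - s0" a] by simp
    then have D: "dist (s, a) (s0, 0) < d" using s a by linarith
    have pos: "m\<^sup>2 + a - a\<^sup>2 / 4 > 0" using d(2)[OF D] by simp
    show "let w = sqrt (m\<^sup>2 + a - a\<^sup>2 / 4) in
      w > 0 \<and> w\<^sup>2 = m\<^sup>2 + a - a\<^sup>2 / 4 \<and> \<bar>s * (1 - a / 4) / (w + m) - s0 / (2 * m)\<bar> \<le> 1 / 8 \<and> \<bar>m / w - 1\<bar> \<le> 1 / 8 \<and> \<bar>a / (2 * w)\<bar> \<le> 1 / 8"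
      unfolding Let_def using d(2)[OF D] real_sqrt_pow2[of "m\<^sup>2 + a - a\<^sup>2 / 4"] pos by (simp add: dist_real_def)
  qed
qed

lemma
  fixes x y :: real
  shows abs_cos_diff_le: "\<bar>cos x - cos y\<bar> \<le> \<bar>x - y\<bar>"
    and abs_sin_diff_le: "\<bar>sin x - sin y\<bar> \<le> \<bar>x - y\<bar>"
proof -
  have "norm (cos x - cos y) \<le> 1 * norm (x - y)" "norm (sin x - sin y) \<le> 1 * norm (x - y)"
    by (rule field_differentiable_bound[of UNIV _ "\<lambda>x. - sin x"]; auto intro!: derivative_eq_intros)
      (rule field_differentiable_bound[of UNIV _ cos]; auto intro!: derivative_eq_intros)
  then show "\<bar>cos x - cos y\<bar> \<le> \<bar>x - y\<bar>" "\<bar>sin x - sin y\<bar> \<le> \<bar>x - y\<bar>" by simp_all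
qed

text \<open>P0 and Q = P1 / m each pick up two errors of relative size 1/8, and ((x + y) / 4)^2
  \<le> (x^2 + y^2) / 8. With this value the two errors in \<open>profile_quadrature\<close> use up
  only half of |P0|^2 + |Q|^2.\<close>

lemma profile_perturbation:
  fixes P0 P1 :: complex and \<phi> \<psi> :: real
  assumes m: "m > 0" and w: "w > 0" and \<phi>: "\<bar>\<phi> - \<psi>\<bar> \<le> 1 / 8" and mw: "\<bar>m / w - 1\<bar> \<le> 1 / 8" and aw: "\<bar>a / (2 * w)\<bar> \<le> 1 / 8"
  shows "(norm (P0 * of_real (cos \<phi>) + (P1 + of_real (a / 2) * P0) / of_real w * of_real (sin \<phi>)
    - (P0 * of_real (cos \<psi>) + P1 / of_real m * of_real (sin \<psi>))))\<^sup>2 \<le> (1 / 8) * ((norm P0)\<^sup>2 + (norm (P1 / of_real m))\<^sup>2)"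
proof -
  define Q where "Q = P1 / complex_of_real m"
  have P1: "P1 = of_real m * Q" using m by (simp add: Q_def)
  let ?D = "P0 * of_real (cos \<phi>) + (P1 + of_real (a / 2) * P0) / of_real w * of_real (sin \<phi>) - (P0 * of_real (cos \<psi>) + Q * of_real (sin \<psi>))"
  have "?D = P0 * of_real (cos \<phi> - cos \<psi>) + Q * of_real (sin \<phi> - sin \<psi>) + Q * of_real ((m / w - 1) * sin \<phi>) + P0 * of_real (a / (2 * w) * sin \<phi>)"
    unfolding P1 using w by (simp add: field_simps)
  also have "norm \<dots> \<le> norm P0 * (1 / 8) + norm Q * (1 / 8) + norm Q * (1 / 8) + norm P0 * (1 / 8)"
  proof (intro norm_triangle_mono)
    have 1: "\<bar>x * sin \<phi>\<bar> \<le> 1 / 8" if "\<bar>x\<bar> \<le> 1 / 8" for x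
      using mult_mono[OF that abs_sin_le_one[of \<phi>]] by (simp add: abs_mult)
    show "norm (P0 * of_real (cos \<phi> - cos \<psi>)) \<le> norm P0 * (1 / 8)" "norm (Q * of_real (sin \<phi> - sin \<psi>)) \<le> norm Q * (1 / 8)"
      unfolding norm_mult norm_of_real using \<phi> abs_cos_diff_le[of \<phi> \<psi>] abs_sin_diff_le[of \<phi> \<psi>]
      by (intro mult_left_mono; simp)+
    show "norm (Q * of_real ((m / w - 1) * sin \<phi>)) \<le> norm Q * (1 / 8)" "norm (P0 * of_real (a / (2 * w) * sin \<phi>)) \<le> norm P0 * (1 / 8)"
      unfolding norm_mult norm_of_real using 1[OF mw] 1[OF aw] by (intro mult_left_mono; simp)+
  qed
  also have "\<dots> = (norm P0 + norm Q) / 4" by simp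
  finally have "(norm ?D)\<^sup>2 \<le> ((norm P0 + norm Q) / 4)\<^sup>2" by (rule power_mono) simp
  also have "\<dots> \<le> (1 / 8) * ((norm P0)\<^sup>2 + (norm Q)\<^sup>2)"
    using zero_le_power2[of "norm P0 - norm Q"] by (simp add: power_divide power2_sum power2_diff)
  finally show ?thesis unfolding Q_def .
qed

text \<open>Phases differing by \<open>pi / 2\<close> interchange sine and cosine, so the two profiles cannot both be
  small.\<close>

lemma profile_quadrature:
  fixes X1 X2 P Q :: complex
  assumes "(norm (X1 - (P * of_real (cos \<tau>) + Q * of_real (sin \<tau>))))\<^sup>2 \<le> (1 / 8) * ((norm P)\<^sup>2 + (norm Q)\<^sup>2)"
    and "(norm (X2 - (P * of_real (cos (\<tau> + pi / 2)) + Q * of_real (sin (\<tau> + pi / 2)))))\<^sup>2 \<le> (1 / 8) * ((norm P)\<^sup>2 + (norm Q)\<^sup>2)"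
  shows "(1 / 4) * ((norm P)\<^sup>2 + (norm Q)\<^sup>2) \<le> (norm X1)\<^sup>2 + (norm X2)\<^sup>2"
proof -
  let ?Y1 = "P * of_real (cos \<tau>) + Q * of_real (sin \<tau>)" and ?Y2 = "P * of_real (cos (\<tau> + pi / 2)) + Q * of_real (sin (\<tau> + pi / 2))"
  have "(norm ?Y1)\<^sup>2 + (norm ?Y2)\<^sup>2 = ((norm P)\<^sup>2 + (norm Q)\<^sup>2) * ((cos \<tau>)\<^sup>2 + (sin \<tau>)\<^sup>2)"
  proof -
    have "(norm (P * of_real c + Q * of_real s))\<^sup>2 + (norm (P * of_real (- s) + Q * of_real c))\<^sup>2 =
        ((norm P)\<^sup>2 + (norm Q)\<^sup>2) * (c\<^sup>2 + s\<^sup>2)" for c s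
      unfolding cmod_power2 by (simp add: power2_eq_square algebra_simps)
    moreover have "cos (\<tau> + pi / 2) = - sin \<tau>" "sin (\<tau> + pi / 2) = cos \<tau>"
      by (simp_all add: cos_add sin_add)
    ultimately show ?thesis by simp
  qed
  then have Y: "(norm ?Y1)\<^sup>2 + (norm ?Y2)\<^sup>2 = (norm P)\<^sup>2 + (norm Q)\<^sup>2" by simp
  have "(norm ?Y1)\<^sup>2 \<le> 2 * (norm X1)\<^sup>2 + 2 * (norm (X1 - ?Y1))\<^sup>2"
    using norm_add_power2_le[of X1 "?Y1 - X1"] by (simp add: norm_minus_commute)
  moreover have "(norm ?Y2)\<^sup>2 \<le> 2 * (norm X2)\<^sup>2 + 2 * (norm (X2 - ?Y2))\<^sup>2"
    using norm_add_power2_le[of X2 "?Y2 - X2"] by (simp add: norm_minus_commute)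
  ultimately show ?thesis using assms Y by argo
qed

text \<open>In the variable sqrt(T) \<xi> the window is a fixed ball of radius \<rho> about sqrt(s0)
  e, where s = T |\<xi>|^2 stays close to s0; this brings \<open>phase_approximation\<close> into
  play.\<close>

lemma frequency_window:
  fixes e :: "'a::euclidean_space"
  assumes m: "m > 0" and s0: "s0 \<ge> 0" and e: "norm e = 1"
  shows "\<exists>\<rho>>0. \<exists>T1>0. \<forall>T\<ge>T1. \<forall>x. norm x \<le> \<rho> / sqrt T \<longrightarrow>
    (let a = (norm (sqrt (s0 / T) *\<^sub>R e + x))\<^sup>2; w = sqrt (m\<^sup>2 + a - a\<^sup>2 / 4) in
      a * T \<le> s0 + 1 \<and> w > 0 \<and> w\<^sup>2 = m\<^sup>2 + a - a\<^sup>2 / 4 \<and> \<bar>w * T - (m * T + s0 / (2 * m))\<bar> \<le> 1 / 8 \<and> \<bar>m / w - 1\<bar> \<le> 1 / 8 \<and> \<bar>a / (2 * w)\<bar> \<le> 1 / 8)"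
proof -
  obtain d where d: "d > 0" "\<And>s a. \<bar>s - s0\<bar> < d \<Longrightarrow> \<bar>a\<bar> < d \<Longrightarrow>
    (let w = sqrt (m\<^sup>2 + a - a\<^sup>2 / 4) in
      w > 0 \<and> w\<^sup>2 = m\<^sup>2 + a - a\<^sup>2 / 4 \<and> \<bar>s * (1 - a / 4) / (w + m) - s0 / (2 * m)\<bar> \<le> 1 / 8 \<and> \<bar>m / w - 1\<bar> \<le> 1 / 8 \<and> \<bar>a / (2 * w)\<bar> \<le> 1 / 8)"
    using phase_approximation[OF m, of s0] by blast
  define d' where "d' = min 1 (d / 2)"
  have d': "d' > 0" "d' \<le> 1" "d' < d" using d(1) by (auto simp: d'_def)
  \<comment> \<open>Chosen so that 2 sqrt(s0) \<rho> + \<rho>^2 \<le> d' once \<rho> \<le> 1; the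
    left-hand side bounds the deviation of s from s0.\<close>
  define \<rho> where "\<rho> = d' / (2 * sqrt s0 + 1)"
  have \<rho>: "\<rho> > 0" using d' s0 by (simp add: \<rho>_def add_nonneg_pos)
  have \<rho>1: "\<rho> \<le> 1"
  proof -
    have "d' \<le> 2 * sqrt s0 + 1" using d' real_sqrt_ge_zero[OF s0] by linarith
    then show ?thesis using s0 by (simp add: \<rho>_def pos_divide_le_eq add_nonneg_pos)
  qed
  have \<rho>d: "2 * sqrt s0 * \<rho> + \<rho>\<^sup>2 \<le> d'"
  proof -
    have "\<rho>\<^sup>2 \<le> \<rho>" using \<rho> \<rho>1 by (simp add: power2_eq_square mult_left_le)
    then have "2 * sqrt s0 * \<rho> + \<rho>\<^sup>2 \<le> (2 * sqrt s0 + 1) * \<rho>" by (simp add: algebra_simps)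
    also have "\<dots> = d'"
    proof -
      have "2 * sqrt s0 + 1 \<noteq> 0" using real_sqrt_ge_zero[OF s0] by linarith
      then show ?thesis by (simp add: \<rho>_def)
    qed
    finally show ?thesis .
  qed
  \<comment> \<open>From this time on, a \<le> (s0 + 1) / T \<le> d / 2.\<close>
  define T1 where "T1 = 2 * (s0 + 1) / d"
  have T1: "T1 > 0" using d s0 by (simp add: T1_def)
  show ?thesis
  proof (rule exI[of _ \<rho>], intro conjI \<rho>, rule exI[of _ T1], intro conjI T1 allI impI)
    fix T :: real and x :: 'a assume T: "T1 \<le> T" and x: "norm x \<le> \<rho> / sqrt T"
    have T0: "T > 0" using T T1 by simp
    let ?\<xi> = "sqrt (s0 / T) *\<^sub>R e + x"
    define a s where "a = (norm ?\<xi>)\<^sup>2" and "s = a * T"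
    define y where "y = sqrt T *\<^sub>R x"
    have y: "norm y \<le> \<rho>" using x T0 by (simp add: y_def field_simps)
    have "sqrt T *\<^sub>R ?\<xi> = sqrt s0 *\<^sub>R e + y"
      using T0 by (simp add: y_def scaleR_add_right real_sqrt_divide)
    moreover have "s = (norm (sqrt T *\<^sub>R ?\<xi>))\<^sup>2" using T0 by (simp add: s_def a_def power_mult_distrib)
    ultimately have s: "s = (norm (sqrt s0 *\<^sub>R e + y))\<^sup>2" by simp
    have "s = s0 + 2 * sqrt s0 * (e \<bullet> y) + (norm y)\<^sup>2"
    proof -
      have "e \<bullet> e = 1" using e by (simp add: norm_eq_1)
      then show ?thesis unfolding s using s0
        by (simp add: power2_norm_eq_inner inner_add_left inner_add_right inner_commute flip: mult.assoc)
    qed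
    moreover have "\<bar>2 * sqrt s0 * (e \<bullet> y)\<bar> \<le> 2 * sqrt s0 * \<rho>"
    proof -
      have "\<bar>e \<bullet> y\<bar> \<le> \<rho>" using Cauchy_Schwarz_ineq2[of e y] e y by simp
      then show ?thesis using s0 by (simp add: abs_mult mult_left_mono)
    qed
    moreover have "(norm y)\<^sup>2 \<le> \<rho>\<^sup>2" using y by (intro power_mono) auto
    moreover have "0 \<le> (norm y)\<^sup>2" by simp
    ultimately have sd: "\<bar>s - s0\<bar> \<le> d'" using \<rho>d by argo
    have a0: "0 \<le> a" by (simp add: a_def)
    have aT: "a * T \<le> s0 + 1" using sd d' by (simp add: s_def)
    have "a < d"
    proof -
      have "a * T \<le> (d / 2) * T1" using aT d by (simp add: T1_def)
      also have "\<dots> \<le> (d / 2) * T" using T d by (intro mult_left_mono) auto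
      finally have "a \<le> d / 2" using T0 by simp
      then show ?thesis using d by simp
    qed
    then have ad: "\<bar>a\<bar> < d" using a0 by simp
    define w where "w = sqrt (m\<^sup>2 + a - a\<^sup>2 / 4)"
    have "\<bar>s - s0\<bar> < d" using sd d' by linarith
    note W = d(2)[OF this ad, unfolded Let_def, folded w_def]
    \<comment> \<open>Difference of squares: w^2 - m^2 = a (1 - a / 4) avoids the cancellation
      between w T and m T.\<close>
    have "w * T - m * T = s * (1 - a / 4) / (w + m)"
    proof -
      have "(w - m) * (w + m) = a * (1 - a / 4)"
        using W by (simp add: algebra_simps power2_eq_square)
      then have "(w - m) * T * (w + m) = s * (1 - a / 4)" by (simp add: s_def mult_ac)
      then show ?thesis using W m by (simp add: eq_divide_eq algebra_simps)
    qed
    then have "w * T - (m * T + s0 / (2 * m)) = s * (1 - a / 4) / (w + m) - s0 / (2 * m)" by linarith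
    then have "\<bar>w * T - (m * T + s0 / (2 * m))\<bar> \<le> 1 / 8" using W by (simp only:)
    then show "let a = (norm (sqrt (s0 / T) *\<^sub>R e + x))\<^sup>2; w = sqrt (m\<^sup>2 + a - a\<^sup>2 / 4) in
      a * T \<le> s0 + 1 \<and> w > 0 \<and> w\<^sup>2 = m\<^sup>2 + a - a\<^sup>2 / 4 \<and> \<bar>w * T - (m * T + s0 / (2 * m))\<bar> \<le> 1 / 8 \<and> \<bar>m / w - 1\<bar> \<le> 1 / 8 \<and> \<bar>a / (2 * w)\<bar> \<le> 1 / 8"
      unfolding Let_def a_def[symmetric] w_def[symmetric] using W aT by blast
  qed
qed

section \<open>Tails, first moments and frequency windows\<close>

text \<open>The mass that the cutoff takes from g. It disappears as R grows, whereas
  \<open>moment\<close> remains and is multiplied by |\<xi>|, which is of order T^{-1/2}.\<close>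

definition tail :: "('a::euclidean_space \<Rightarrow> real) \<Rightarrow> ('a \<Rightarrow> complex) \<Rightarrow> real" where
  "tail \<phi> g = (LINT x|lebesgue. (1 - \<phi> x) * norm (g x))"

definition moment :: "('a::euclidean_space \<Rightarrow> complex) \<Rightarrow> real" where
  "moment g = (LINT x|lebesgue. norm x * norm (g x))"

text \<open>The inequality |e^{-i x \<bullet> \<xi>} - 1| \<le> |x| |\<xi>| trades closeness to
  frequency 0 for a first moment; here the weight of \<open>L11\<close> enters.\<close>

lemma norm_cfourier_minus_integral_le:
  fixes g :: "'a::euclidean_space \<Rightarrow> complex"
  assumes g: "integrable lebesgue g" "integrable lebesgue (\<lambda>x. norm x * norm (g x))"
    and \<phi>: "continuous_on UNIV \<phi>" "\<And>x. 0 \<le> \<phi> x" "\<And>x. \<phi> x \<le> 1"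
  shows "norm (cfourier \<phi> g \<xi> - (LINT x|lebesgue. g x)) \<le>
    tail \<phi> g + norm \<xi> * moment g"
proof -
  have [measurable]: "g \<in> borel_measurable lebesgue" using g by auto
  have [measurable]: "(\<lambda>x. cis (- (x \<bullet> \<xi>)) * of_real (\<phi> x)) \<in> borel_measurable lebesgue" "\<phi> \<in> borel_measurable lebesgue"
    using \<phi>(1) by (auto intro!: continuous_borel_measurable_lebesgue continuous_intros)
  let ?k = "\<lambda>x. cis (- (x \<bullet> \<xi>)) * of_real (\<phi> x)"
  have i1: "integrable lebesgue (\<lambda>x. ?k x * g x)"
    by (rule Bochner_Integration.integrable_bound[OF g(1)])
      (use \<phi> in \<open>auto simp: norm_mult mult_left_le_one_le\<close>)
  have i2: "integrable lebesgue (\<lambda>x. (1 - \<phi> x) * norm (g x))"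
    by (rule Bochner_Integration.integrable_bound[OF integrable_norm[OF g(1)]])
      (use \<phi> in \<open>auto simp: abs_mult mult_left_le_one_le\<close>)
  have "cfourier \<phi> g \<xi> - (LINT x|lebesgue. g x) = (LINT x|lebesgue. (?k x - 1) * g x)"
    unfolding cfourier_def fourier_def using i1 g(1) by (simp add: left_diff_distrib mult.assoc)
  also have "norm \<dots> \<le> (LINT x|lebesgue. norm ((?k x - 1) * g x))" by (rule integral_norm_bound)
  also have "\<dots> \<le> (LINT x|lebesgue. (1 - \<phi> x) * norm (g x) + norm \<xi> * (norm x * norm (g x)))"
  proof (rule integral_mono')
    show "integrable lebesgue (\<lambda>x. (1 - \<phi> x) * norm (g x) + norm \<xi> * (norm x * norm (g x)))"
      using i2 g(2) by simp
    fix x :: 'a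
    have "norm (cis (- (x \<bullet> \<xi>)) - 1) \<le> \<bar>- (x \<bullet> \<xi>)\<bar>"
      using iexp_approx1[of "- (x \<bullet> \<xi>)" 0] by (simp add: cis_conv_exp)
    also have "\<dots> \<le> norm x * norm \<xi>" using Cauchy_Schwarz_ineq2[of x \<xi>] by simp
    finally have c: "norm (cis (- (x \<bullet> \<xi>)) - 1) \<le> norm x * norm \<xi>" .
    have "?k x - 1 = (cis (- (x \<bullet> \<xi>)) - 1) * of_real (\<phi> x) - of_real (1 - \<phi> x)" by (simp add: algebra_simps)
    also have "norm \<dots> \<le> norm ((cis (- (x \<bullet> \<xi>)) - 1) * of_real (\<phi> x)) + norm (complex_of_real (1 - \<phi> x))"
      by (rule norm_triangle_ineq4)
    also have "norm ((cis (- (x \<bullet> \<xi>)) - 1) * of_real (\<phi> x)) \<le> (norm x * norm \<xi>) * 1"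
      unfolding norm_mult norm_of_real using c \<phi>(2,3)[of x] by (intro mult_mono) auto
    also have "norm (complex_of_real (1 - \<phi> x)) = 1 - \<phi> x" unfolding norm_of_real using \<phi>(3)[of x] by simp
    finally have "norm (?k x - 1) \<le> (1 - \<phi> x) + norm \<xi> * norm x" by (simp add: mult.commute)
    then have "norm (?k x - 1) * norm (g x) \<le> ((1 - \<phi> x) + norm \<xi> * norm x) * norm (g x)" by (rule mult_right_mono) simp
    then show "norm ((?k x - 1) * g x) \<le> (1 - \<phi> x) * norm (g x) + norm \<xi> * (norm x * norm (g x))"
      by (simp only: norm_mult distrib_right mult.assoc)
    show "0 \<le> (1 - \<phi> x) * norm (g x) + norm \<xi> * (norm x * norm (g x))" using \<phi>(3)[of x] by simp
  qed
  also have "\<dots> = tail \<phi> g + norm \<xi> * moment g"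
    using i2 g(2) by (simp add: tail_def moment_def)
  finally show ?thesis .
qed

lemma cutoff_tail_tendsto:
  fixes g :: "'a::euclidean_space \<Rightarrow> complex"
  assumes \<eta>: "\<eta> \<in> test_functions UNIV" "\<eta> 0 = 1" "\<And>x. 0 \<le> \<eta> x" "\<And>x. \<eta> x \<le> 1" and g: "integrable lebesgue g"
  shows "(\<lambda>k. tail (cutoff \<eta> (real (Suc k))) g) \<longlonglongrightarrow> 0"
proof -
  have [measurable]: "cutoff \<eta> (real (Suc k)) \<in> borel_measurable lebesgue" for k
    by (rule continuous_borel_measurable_lebesgue, rule Ck_continuous[OF test_functionsD(1)[OF cutoff_test[OF \<eta>(1)]]]) simp
  have [measurable]: "g \<in> borel_measurable lebesgue" using g by auto
  have "(\<lambda>k. LINT x|lebesgue. (1 - cutoff \<eta> (real (Suc k)) x) * norm (g x)) \<longlonglongrightarrow> (LINT x::'a|lebesgue. 0::real)"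
  proof (rule integral_dominated_convergence)
    show "integrable lebesgue (\<lambda>x. norm (g x))" using g by simp
    show "AE x in lebesgue. norm ((1 - cutoff \<eta> (real (Suc k)) x) * norm (g x)) \<le> norm (g x)" for k
      using \<eta>(3,4) by (intro AE_I2) (simp add: cutoff_def abs_mult mult_left_le_one_le)
    have "(\<lambda>k. (1 - cutoff \<eta> (real (Suc k)) x) * norm (g x)) \<longlonglongrightarrow> (1 - 1) * norm (g x)" for x
      by (intro tendsto_intros cutoff_tendsto \<eta>)
    then show "AE x in lebesgue. (\<lambda>k. (1 - cutoff \<eta> (real (Suc k)) x) * norm (g x)) \<longlonglongrightarrow> 0" by simp
    show "(\<lambda>x. (1 - cutoff \<eta> (real (Suc k)) x) * norm (g x)) \<in> borel_measurable lebesgue" for k by measurable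
  qed simp
  then show ?thesis by (simp add: tail_def)
qed

text \<open>The conclusion of \<open>frequency_window\<close> at a single T; s0 is the value near
  which T |\<xi>|^2 lies.\<close>

definition window :: "real \<Rightarrow> 'a::euclidean_space \<Rightarrow> real \<Rightarrow> real \<Rightarrow> real \<Rightarrow> bool" where
  "window m e s0 \<rho> T \<longleftrightarrow> (\<forall>x. norm x \<le> \<rho> / sqrt T \<longrightarrow>
    (let a = (norm (sqrt (s0 / T) *\<^sub>R e + x))\<^sup>2; w = sqrt (m\<^sup>2 + a - a\<^sup>2 / 4) in
      a * T \<le> s0 + 1 \<and> w > 0 \<and> w\<^sup>2 = m\<^sup>2 + a - a\<^sup>2 / 4 \<and> \<bar>w * T - (m * T + s0 / (2 * m))\<bar> \<le> 1 / 8 \<and> \<bar>m / w - 1\<bar> \<le> 1 / 8 \<and> \<bar>a / (2 * w)\<bar> \<le> 1 / 8))"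

text \<open>For s0 = 0 and s0 = pi m the phases m T + s0 / (2 m) differ by pi / 2. A common \<rho>
  makes the two windows translates of one ball, so that their contributions can be added
  pointwise.\<close>

lemma windows_exist:
  fixes e :: "'a::euclidean_space"
  assumes m: "m > 0" and e: "norm e = 1"
  shows "\<exists>\<rho>>0. \<exists>T1>0. \<forall>T\<ge>T1. window m e 0 \<rho> T \<and> window m e (pi * m) \<rho> T"
proof -
  have "0 \<le> pi * m" using m by simp
  from frequency_window[OF m this e] frequency_window[OF m order_refl e]
  obtain \<rho>1 T1 \<rho>2 T2 where w1: "\<rho>1 > 0" "T1 > 0" "\<And>T. T \<ge> T1 \<Longrightarrow> window m e (pi * m) \<rho>1 T"
    and w2: "\<rho>2 > 0" "T2 > 0" "\<And>T. T \<ge> T2 \<Longrightarrow> window m e 0 \<rho>2 T"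
    unfolding window_def by blast
  have mono: "window m e s0 (min \<rho>1 \<rho>2) T" if "window m e s0 \<rho> T" "\<rho> = \<rho>1 \<or> \<rho> = \<rho>2" "T > 0" for s0 \<rho> T
  proof -
    have "min \<rho>1 \<rho>2 / sqrt T \<le> \<rho> / sqrt T" using that(2,3) by (intro divide_right_mono) auto
    then show ?thesis using that(1) unfolding window_def by (meson order_trans)
  qed
  show ?thesis
  proof (rule exI[of _ "min \<rho>1 \<rho>2"], intro conjI, goal_cases)
    case 2
    show ?case
    proof (rule exI[of _ "max T1 T2"], intro conjI allI impI)
    fix T assume T: "max T1 T2 \<le> T"
    show "window m e 0 (min \<rho>1 \<rho>2) T" "window m e (pi * m) (min \<rho>1 \<rho>2) T"
      using T w1(2) w2(2) by (auto intro!: mono[OF w1(3)] mono[OF w2(3)])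
    qed (use w1 in auto)
  qed (use w1 w2 in auto)
qed

context wave_solution
begin

text \<open>X is the exact solution with data P0, P1 at time T, freed of its damping e^{-a T / 2}.
  On the window a T \<le> s0 + 1, so the squared damping factor is at least e^{-(s0 + 1)}.\<close>

lemma profile_error:
  assumes \<phi>: "\<phi> \<in> test_functions UNIV" "\<And>x. 0 \<le> \<phi> x" "\<And>x. \<phi> x \<le> 1"
    and u0: "integrable lebesgue (u 0)" "integrable lebesgue (\<lambda>x. norm x * norm (u 0 x))"
    and v0: "integrable lebesgue (v 0)" "integrable lebesgue (\<lambda>x. norm x * norm (v 0 x))"
    and T: "T > 0" and win: "window m e s0 \<rho> T" and x: "norm x \<le> \<rho> / sqrt T"
    and \<xi>: "\<xi> = sqrt (s0 / T) *\<^sub>R e + x"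
    and P0: "P0 = (LINT x|lebesgue. u 0 x)" and P1: "P1 = (LINT x|lebesgue. v 0 x)"
  obtains X where
    "(norm (X - (P0 * of_real (cos (m * T + s0 / (2 * m))) + P1 / of_real m * of_real (sin (m * T + s0 / (2 * m))))))\<^sup>2
      \<le> (1 / 8) * ((norm P0)\<^sup>2 + (norm (P1 / of_real m))\<^sup>2)"
    "exp (- (s0 + 1)) * (norm X)\<^sup>2 \<le> 2 * (norm (cfourier \<phi> (u T) \<xi>))\<^sup>2 + 20 * exp 1 *
      (((tail \<phi> (v 0))\<^sup>2 + (s0 + 1) / T * (moment (v 0))\<^sup>2) / m\<^sup>2
       + ((tail \<phi> (u 0))\<^sup>2 + (s0 + 1) / T * (moment (u 0))\<^sup>2))
      + 16 * exp 1 * T * duhamel \<phi> T \<xi>"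
proof -
  define a w where "a = (norm \<xi>)\<^sup>2" and "w = sqrt (m\<^sup>2 + a - a\<^sup>2 / 4)"
  have W: "a * T \<le> s0 + 1" "w > 0" "w\<^sup>2 = m\<^sup>2 + a - a\<^sup>2 / 4" "\<bar>w * T - (m * T + s0 / (2 * m))\<bar> \<le> 1 / 8" "\<bar>m / w - 1\<bar> \<le> 1 / 8" "\<bar>a / (2 * w)\<bar> \<le> 1 / 8"
    using win[unfolded window_def, rule_format, OF x, folded \<xi>, unfolded Let_def, folded a_def, folded w_def] by auto
  have w2: "w\<^sup>2 = ((norm \<xi>)\<^sup>2 + m\<^sup>2) - ((norm \<xi>)\<^sup>2)\<^sup>2 / 4" using W(3) by (simp add: a_def)
  obtain z z' :: "real \<Rightarrow> complex" where z: "\<And>t. (z has_vector_derivative z' t) (at t)"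
    "\<And>t. (z' has_vector_derivative (- of_real ((norm \<xi>)\<^sup>2) * z' t - of_real ((norm \<xi>)\<^sup>2 + m\<^sup>2) * z t)) (at t)"
    "z 0 = P0" "z' 0 = P1"
    "\<And>t. z t = of_real (exp (- ((norm \<xi>)\<^sup>2 * t / 2))) * (P0 * of_real (cos (w * t)) + (P1 + of_real ((norm \<xi>)\<^sup>2 / 2) * P0) / of_real w * of_real (sin (w * t)))"
    by (rule free_solution[OF W(2) w2, of P0 P1]) (rule that)
  let ?X = "P0 * of_real (cos (w * T)) + (P1 + of_real (a / 2) * P0) / of_real w * of_real (sin (w * T))"
  let ?tu = "tail \<phi> (u 0)" and ?tv = "tail \<phi> (v 0)"
  let ?Mu = "moment (u 0)" and ?Mv = "moment (v 0)"
  have "(norm (cfourier \<phi> (u T) \<xi> - z T))\<^sup>2 \<le>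
    5 * exp 1 * exp (- (4 / 5 * rate \<xi> * T)) * ((norm (cfourier \<phi> (v 0) \<xi> - z' 0))\<^sup>2 / m\<^sup>2 + (norm (cfourier \<phi> (u 0) \<xi> - z 0))\<^sup>2)
    + 8 * exp 1 * T * duhamel \<phi> T \<xi>"
    by (rule cfourier_estimate[OF \<phi>(1) T]; rule has_vector_derivative_at_within; rule z)
  also have "\<dots> \<le> 5 * exp 1 * 1 * ((2 * ((?tv)\<^sup>2 + (s0 + 1) / T * (?Mv)\<^sup>2)) / m\<^sup>2 + 2 * ((?tu)\<^sup>2 + (s0 + 1) / T * (?Mu)\<^sup>2))
    + 8 * exp 1 * T * duhamel \<phi> T \<xi>"
  \<comment> \<open>The exponential is estimated by 1: T |\<xi>|^2 is bounded on the window, and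
    smallness comes from the difference between the transformed data and P0, P1.\<close>
  proof (intro add_right_mono mult_mono add_mono divide_right_mono mult_left_mono)
    have "0 \<le> rate \<xi>" using m_pos by (simp add: rate_def)
    then show "exp (- (4 / 5 * rate \<xi> * T)) \<le> 1" using T by simp
    have sq: "(norm d)\<^sup>2 \<le> 2 * (t\<^sup>2 + (s0 + 1) / T * M\<^sup>2)" if "norm d \<le> t + norm \<xi> * M" for d :: complex and t M
    proof -
      have "(norm d)\<^sup>2 \<le> (t + norm \<xi> * M)\<^sup>2" using that by (rule power_mono) simp
      also have "\<dots> \<le> 2 * (t\<^sup>2 + a * M\<^sup>2)"
        using zero_le_power2[of "t - norm \<xi> * M"] by (simp add: power2_sum power2_diff power_mult_distrib a_def algebra_simps)
      also have "\<dots> \<le> 2 * (t\<^sup>2 + (s0 + 1) / T * M\<^sup>2)"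
        using W(1) T by (intro mult_left_mono add_left_mono mult_right_mono) (auto simp: pos_le_divide_eq)
      finally show ?thesis .
    qed
    have c: "continuous_on UNIV \<phi>" by (rule Ck_continuous[OF test_functionsD(1)[OF \<phi>(1)]])
    show "(norm (cfourier \<phi> (v 0) \<xi> - z' 0))\<^sup>2 \<le> 2 * ((?tv)\<^sup>2 + (s0 + 1) / T * (?Mv)\<^sup>2)"
      unfolding z(4) P1 by (rule sq, rule norm_cfourier_minus_integral_le[OF v0 c \<phi>(2,3)])
    show "(norm (cfourier \<phi> (u 0) \<xi> - z 0))\<^sup>2 \<le> 2 * ((?tu)\<^sup>2 + (s0 + 1) / T * (?Mu)\<^sup>2)"
      unfolding z(3) P0 by (rule sq, rule norm_cfourier_minus_integral_le[OF u0 c \<phi>(2,3)])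
  qed simp_all
  finally have err: "(norm (cfourier \<phi> (u T) \<xi> - z T))\<^sup>2 \<le>
     10 * exp 1 * (((?tv)\<^sup>2 + (s0 + 1) / T * (?Mv)\<^sup>2) / m\<^sup>2 + ((?tu)\<^sup>2 + (s0 + 1) / T * (?Mu)\<^sup>2)) + 8 * exp 1 * T * duhamel \<phi> T \<xi>"
    by (simp add: algebra_simps add_divide_distrib)
  have zT: "z T = of_real (exp (- (a * T / 2))) * ?X" unfolding z(5) a_def ..
  have "(norm (z T))\<^sup>2 = exp (- (a * T)) * (norm ?X)\<^sup>2"
  proof -
    have "(exp (- (a * T / 2)))\<^sup>2 = exp (- (a * T))" by (simp flip: exp_double)
    then show ?thesis unfolding zT norm_mult norm_of_real power_mult_distrib by simp
  qed
  then have "exp (- (s0 + 1)) * (norm ?X)\<^sup>2 \<le> (norm (z T))\<^sup>2"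
    using W(1) by (simp add: mult_right_mono)
  also have "(norm (z T))\<^sup>2 \<le> 2 * (norm (cfourier \<phi> (u T) \<xi>))\<^sup>2 + 2 * (norm (cfourier \<phi> (u T) \<xi> - z T))\<^sup>2"
    using norm_add_power2_le[of "cfourier \<phi> (u T) \<xi>" "z T - cfourier \<phi> (u T) \<xi>"] by (simp add: norm_minus_commute)
  also note add_left_mono[OF mult_left_mono[OF err zero_le_numeral]]
  finally have "exp (- (s0 + 1)) * (norm ?X)\<^sup>2 \<le> 2 * (norm (cfourier \<phi> (u T) \<xi>))\<^sup>2 +
      2 * (10 * exp 1 * (((?tv)\<^sup>2 + (s0 + 1) / T * (?Mv)\<^sup>2) / m\<^sup>2 + ((?tu)\<^sup>2 + (s0 + 1) / T * (?Mu)\<^sup>2)) + 8 * exp 1 * T * duhamel \<phi> T \<xi>)" .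
  then have "exp (- (s0 + 1)) * (norm ?X)\<^sup>2 \<le> 2 * (norm (cfourier \<phi> (u T) \<xi>))\<^sup>2 + 20 * exp 1 *
      (((?tv)\<^sup>2 + (s0 + 1) / T * (?Mv)\<^sup>2) / m\<^sup>2 + ((?tu)\<^sup>2 + (s0 + 1) / T * (?Mu)\<^sup>2)) + 16 * exp 1 * T * duhamel \<phi> T \<xi>"
    by argo
  with profile_perturbation[OF m_pos W(2,4-6)] show ?thesis by (rule that)
qed

lemma duhamel_nonneg: "0 \<le> duhamel \<phi> T \<xi>"
proof -
  have "0 \<le> integral {0..T} (\<lambda>s. (norm (commutator \<phi> s \<xi>))\<^sup>2)"
    \<comment> \<open>For arbitrary \<phi> the integrand may fail to be integrable; the integral is
      then 0 by convention.\<close>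
    by (cases "(\<lambda>s. (norm (commutator \<phi> s \<xi>))\<^sup>2) integrable_on {0..T}")
      (auto simp: not_integrable_integral intro: Henstock_Kurzweil_Integration.integral_nonneg)
  then show ?thesis unfolding duhamel_def by (intro divide_nonneg_nonneg) auto
qed

text \<open>At each x of the ball the two windows together see a fixed share of |P0|^2 + |P1 / m|^2.
  Integration multiplies this by the volume of the ball, which has the order T^{-n/2}; letting R
  tend to infinity removes the tails and the forcing.\<close>

lemma lower_estimate:
  fixes e :: 'a
  assumes u0: "integrable lebesgue (u 0)" "integrable lebesgue (\<lambda>x. norm x * norm (u 0 x))"
    and v0: "integrable lebesgue (v 0)" "integrable lebesgue (\<lambda>x. norm x * norm (v 0 x))"
    and T: "T > 0" and \<rho>: "\<rho> > 0" and win: "window m e 0 \<rho> T" "window m e (pi * m) \<rho> T"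
    and P0: "P0 = (LINT x|lebesgue. u 0 x)" and P1: "P1 = (LINT x|lebesgue. v 0 x)"
    and K: "K = pi * m + 1"
  shows "(unit_ball_vol (real DIM('a)) * (\<rho> / sqrt T) ^ DIM('a)) *
      (exp (- K) / 4 * ((norm P0)\<^sup>2 + (norm (P1 / of_real m))\<^sup>2)
       - 40 * exp 1 * (K / T * ((moment (v 0))\<^sup>2 / m\<^sup>2 + (moment (u 0))\<^sup>2)))
    \<le> 4 * ((2 * pi) ^ DIM('a) * (L2_norm (u T))\<^sup>2)"
proof -
  obtain \<eta> :: "'a \<Rightarrow> real" where \<eta>: "\<eta> \<in> test_functions UNIV" "\<eta> 0 = 1" "\<And>x. 0 \<le> \<eta> x" "\<And>x. \<eta> x \<le> 1"
    by (rule cutoff_profile_exists) blast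
  obtain C where C: "\<And>R. R \<ge> 1 \<Longrightarrow> integrable lborel (duhamel (cutoff \<eta> R) T)"
      "\<And>R. R \<ge> 1 \<Longrightarrow> (LINT \<xi>|lborel. duhamel (cutoff \<eta> R) T \<xi>) \<le> C / R\<^sup>2"
    using duhamel_integral[OF \<eta>(1) T] by blast
  let ?vol = "unit_ball_vol (real DIM('a)) * (\<rho> / sqrt T) ^ DIM('a)"
  let ?N = "(norm P0)\<^sup>2 + (norm (P1 / of_real m))\<^sup>2"
  let ?tu = "\<lambda>R. tail (cutoff \<eta> R) (u 0)" and ?tv = "\<lambda>R. tail (cutoff \<eta> R) (v 0)"
  let ?Mu = "moment (u 0)" and ?Mv = "moment (v 0)"
  let ?E = "\<lambda>R. ((?tv R)\<^sup>2 + K / T * (?Mv)\<^sup>2) / m\<^sup>2 + ((?tu R)\<^sup>2 + K / T * (?Mu)\<^sup>2)"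
  have K0: "K \<ge> 1" using m_pos by (simp add: K)
  let ?B = "cball (0::'a) (\<rho> / sqrt T)"
  have vol: "measure lborel ?B = ?vol" using \<rho> T by (intro content_cball) simp
  have *: "?vol * (exp (- K) / 4 * ?N - 40 * exp 1 * ?E R) \<le> 4 * ((2 * pi) ^ DIM('a) * (L2_norm (u T))\<^sup>2) + 32 * exp 1 * T * (C / R\<^sup>2)"
    if R: "R \<ge> 1" for R
  proof -
    let ?\<phi> = "cutoff \<eta> R"
    have \<phi>: "?\<phi> \<in> test_functions UNIV" "\<And>x. 0 \<le> ?\<phi> x" "\<And>x. ?\<phi> x \<le> 1"
      using R \<eta> by (auto intro: cutoff_test simp: cutoff_def)
    have \<phi>1: "\<bar>?\<phi> x\<bar> \<le> 1" for x using \<phi>(2,3)[of x] by simp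
    have uT: "u T \<in> L2" using T by (intro u_L2) simp
    let ?e = "sqrt (pi * m / T) *\<^sub>R e"
    \<comment> \<open>As \<open>?W\<close> is nonnegative on the whole space, each window is bounded
      by its full integral. Overlapping windows do no harm, at the price of a factor 2.\<close>
    let ?W = "\<lambda>\<xi>. 2 * (norm (cfourier ?\<phi> (u T) \<xi>))\<^sup>2 + 16 * exp 1 * T * duhamel ?\<phi> T \<xi>"
    have W0: "0 \<le> ?W \<xi>" for \<xi> using duhamel_nonneg[of ?\<phi> T \<xi>] T by simp
    have Wi: "integrable lborel ?W" using cfourier_L2_le(1)[OF \<phi>(1) uT \<phi>1] C(1)[OF R] by simp
    then have [measurable]: "?W \<in> borel_measurable borel" by (auto dest: borel_measurable_integrable)
    have Wt: "integrable lborel (\<lambda>x. ?W (?e + x))" "(LINT x|lborel. ?W (?e + x)) = (LINT x|lborel. ?W x)"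
      using Wi lborel_integrable_translation[of ?W ?e] lborel_integral_translation[of ?W ?e] by simp_all
    have Wint: "(LINT x|lborel. ?W x) \<le> 2 * ((2 * pi) ^ DIM('a) * (L2_norm (u T))\<^sup>2) + 16 * exp 1 * T * (C / R\<^sup>2)"
    proof -
      have "(LINT x|lborel. ?W x) = 2 * (LINT \<xi>|lborel. (norm (cfourier ?\<phi> (u T) \<xi>))\<^sup>2) + 16 * exp 1 * T * (LINT \<xi>|lborel. duhamel ?\<phi> T \<xi>)"
        using cfourier_L2_le(1)[OF \<phi>(1) uT \<phi>1] C(1)[OF R] by simp
      also have "\<dots> \<le> 2 * ((2 * pi) ^ DIM('a) * (1 * L2_norm (u T))\<^sup>2) + 16 * exp 1 * T * (C / R\<^sup>2)"
        using cfourier_L2_le(2)[OF \<phi>(1) uT \<phi>1] C(2)[OF R] T by (intro add_mono mult_left_mono) auto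
      finally show ?thesis by simp
    qed
    have pt: "exp (- K) / 4 * ?N - 40 * exp 1 * ?E R \<le> ?W x + ?W (?e + x)" if x: "norm x \<le> \<rho> / sqrt T" for x
    proof -
      \<comment> \<open>K = pi m + 1 dominates s0 + 1 for both windows. Two errors with factor 20 e
        add up to the factor 40 e.\<close>
      have EK: "20 * exp 1 * (((?tv R)\<^sup>2 + (s + 1) / T * (?Mv)\<^sup>2) / m\<^sup>2 + ((?tu R)\<^sup>2 + (s + 1) / T * (?Mu)\<^sup>2)) \<le> 20 * exp 1 * ?E R"
        if "s + 1 \<le> K" for s
        using that T by (intro mult_left_mono add_mono divide_right_mono mult_right_mono) auto
      obtain X1 where X1: "(norm (X1 - (P0 * of_real (cos (m * T + 0 / (2 * m))) + P1 / of_real m * of_real (sin (m * T + 0 / (2 * m))))))\<^sup>2 \<le> (1 / 8) * ?N"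
        "exp (- (0 + 1)) * (norm X1)\<^sup>2 \<le> 2 * (norm (cfourier ?\<phi> (u T) x))\<^sup>2 + 20 * exp 1 *
          (((?tv R)\<^sup>2 + (0 + 1) / T * (?Mv)\<^sup>2) / m\<^sup>2 + ((?tu R)\<^sup>2 + (0 + 1) / T * (?Mu)\<^sup>2)) + 16 * exp 1 * T * duhamel ?\<phi> T x"
        by (rule profile_error[OF \<phi> u0 v0 T win(1) x _ P0 P1, of x]) (simp, rule that)
      obtain X2 where X2: "(norm (X2 - (P0 * of_real (cos (m * T + pi * m / (2 * m))) + P1 / of_real m * of_real (sin (m * T + pi * m / (2 * m))))))\<^sup>2 \<le> (1 / 8) * ?N"
        "exp (- (pi * m + 1)) * (norm X2)\<^sup>2 \<le> 2 * (norm (cfourier ?\<phi> (u T) (?e + x)))\<^sup>2 + 20 * exp 1 *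
          (((?tv R)\<^sup>2 + (pi * m + 1) / T * (?Mv)\<^sup>2) / m\<^sup>2 + ((?tu R)\<^sup>2 + (pi * m + 1) / T * (?Mu)\<^sup>2)) + 16 * exp 1 * T * duhamel ?\<phi> T (?e + x)"
        by (rule profile_error[OF \<phi> u0 v0 T win(2) x refl P0 P1]) (rule that)
      have "(1 / 4) * ?N \<le> (norm X1)\<^sup>2 + (norm X2)\<^sup>2"
        by (rule profile_quadrature[of X1 P0 "m * T" "P1 / of_real m"]) (use X1(1) X2(1) m_pos in simp_all)
      then have "exp (- K) * ((1 / 4) * ?N) \<le> exp (- K) * ((norm X1)\<^sup>2 + (norm X2)\<^sup>2)" by (rule mult_left_mono) simp
      also have "\<dots> \<le> exp (- (0 + 1)) * (norm X1)\<^sup>2 + exp (- (pi * m + 1)) * (norm X2)\<^sup>2"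
        unfolding distrib_left using K0 K by (intro add_mono mult_right_mono) auto
      finally have fin: "exp (- K) * ((1 / 4) * ?N) \<le> exp (- (0 + 1)) * (norm X1)\<^sup>2 + exp (- (pi * m + 1)) * (norm X2)\<^sup>2" .
      have collect: "g' - B' \<le> A1 + D1 + (A2 + D2)"
        if "g \<le> p + q" "p \<le> A1 + B1 + D1" "q \<le> A2 + B2 + D2" "B1 \<le> B" "B2 \<le> B" "B' = 2 * B" "g' = g"
        for g g' p q A1 A2 B1 B2 D1 D2 B B' :: real
        using that by linarith
      show ?thesis
        by (rule collect[OF fin X1(2) X2(2) EK EK]) (use K0 K in simp_all)
    qed
    have "?vol * (exp (- K) / 4 * ?N - 40 * exp 1 * ?E R) = (LINT x|lborel. indicator ?B x * (exp (- K) / 4 * ?N - 40 * exp 1 * ?E R))"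
      unfolding vol[symmetric] by (simp add: emeasure_lborel_cball_finite)
    also have "\<dots> \<le> (LINT x|lborel. ?W x + ?W (?e + x))"
    proof (rule integral_mono)
      show "integrable lborel (\<lambda>x::'a. indicator ?B x * (exp (- K) / 4 * ?N - 40 * exp 1 * ?E R))"
        by (intro integrable_mult_left integrable_real_indicator emeasure_lborel_cball_finite) simp
      show "integrable lborel (\<lambda>x. ?W x + ?W (?e + x))" by (rule Bochner_Integration.integrable_add[OF Wi Wt(1)])
      show "indicator ?B x * (exp (- K) / 4 * ?N - 40 * exp 1 * ?E R) \<le> ?W x + ?W (?e + x)" for x
      proof (cases "x \<in> ?B")
        case True
        then show ?thesis using pt[of x] by simp
      next
        case False
        then have "indicat_real ?B x = 0" by simp
        then show ?thesis using W0[of x] W0[of "?e + x"] by (simp only: mult_zero_left add_nonneg_nonneg)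
      qed
    qed
    also have "\<dots> = 2 * (LINT x|lborel. ?W x)"
      unfolding Bochner_Integration.integral_add[OF Wi Wt(1)] Wt(2) by (rule mult_2[symmetric])
    finally show ?thesis using Wint by linarith
  qed
  have l1: "(\<lambda>k. ?vol * (exp (- K) / 4 * ?N - 40 * exp 1 * ?E (real (Suc k)))) \<longlonglongrightarrow>
      ?vol * (exp (- K) / 4 * ?N - 40 * exp 1 * ((0\<^sup>2 + K / T * (?Mv)\<^sup>2) / m\<^sup>2 + (0\<^sup>2 + K / T * (?Mu)\<^sup>2)))"
    using m_pos by (intro tendsto_intros cutoff_tail_tendsto \<eta> u0 v0) auto
  have "(\<lambda>k. 4 * ((2 * pi) ^ DIM('a) * (L2_norm (u T))\<^sup>2) + 32 * exp 1 * T * (C * (inverse (real (Suc k)))\<^sup>2))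
      \<longlonglongrightarrow> 4 * ((2 * pi) ^ DIM('a) * (L2_norm (u T))\<^sup>2) + 32 * exp 1 * T * (C * 0\<^sup>2)"
    by (intro tendsto_intros LIMSEQ_inverse_real_of_nat)
  then have l2: "(\<lambda>k. 4 * ((2 * pi) ^ DIM('a) * (L2_norm (u T))\<^sup>2) + 32 * exp 1 * T * (C / (real (Suc k))\<^sup>2))
      \<longlonglongrightarrow> 4 * ((2 * pi) ^ DIM('a) * (L2_norm (u T))\<^sup>2)"
    by (simp add: divide_inverse power_inverse del: of_nat_Suc)
  have "?vol * (exp (- K) / 4 * ?N - 40 * exp 1 * ((0\<^sup>2 + K / T * (?Mv)\<^sup>2) / m\<^sup>2 + (0\<^sup>2 + K / T * (?Mu)\<^sup>2)))
      \<le> 4 * ((2 * pi) ^ DIM('a) * (L2_norm (u T))\<^sup>2)"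
    by (rule LIMSEQ_le[OF l1 l2]) (use * in auto)
  then show ?thesis by (simp add: distrib_left)
qed

end

section \<open>Uniform constants and the final estimate\<close>

lemma L1_norm_nonneg [simp]: "0 \<le> L1_norm f"
  by (simp add: L1_norm_def)

lemma L2_norm_le_H1_norm: "L2_norm f \<le> H1_norm f"
  unfolding H1_norm_def by (rule real_le_rsqrt) (simp add: sum_nonneg)

lemma H1_curve_imp_L2_curve:
  assumes "continuous_curve H1 H1_norm u"
  shows "continuous_curve L2 L2_norm u"
  unfolding continuous_curve_def
proof (intro conjI allI impI)
  show "u t \<in> L2" if "t \<ge> 0" for t using assms that by (simp add: continuous_curve_def H1_def)
  show "((\<lambda>s. L2_norm (\<lambda>x. u s x - u t x)) \<longlongrightarrow> 0) (at t within {0..})" if "t \<ge> 0" for t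
  proof (rule Lim_null_comparison)
    show "((\<lambda>s. H1_norm (\<lambda>x. u s x - u t x)) \<longlongrightarrow> 0) (at t within {0..})"
      using assms that by (simp add: continuous_curve_def)
  qed (simp add: L2_norm_le_H1_norm)
qed

lemma powr_quarter_power2:
  fixes T :: real
  assumes "T > 0"
  shows "(T powr (- real n / 4))\<^sup>2 = (1 / sqrt T) ^ n"
proof -
  have "(T powr (- real n / 4))\<^sup>2 = T powr (- real n / 2)"
    by (simp add: power2_eq_square flip: powr_add)
  also have "\<dots> = (T powr (- (1 / 2))) powr real n" by (simp add: powr_powr)
  also have "\<dots> = (T powr (- (1 / 2))) ^ n" using assms by (simp add: powr_realpow)
  also have "T powr (- (1 / 2)) = 1 / sqrt T"
    using assms by (simp only: powr_minus_divide powr_half_sqrt less_imp_le)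
  finally show ?thesis .
qed

text \<open>The constants are quantified before u and v, hence outside the locale: they must be
  independent of the data. In this direction even t0 is.\<close>

lemma upper_bound:
  assumes m: "m > 0"
  shows "\<exists>A>0. \<exists>t0>0. \<forall>(u :: real \<Rightarrow> 'a::euclidean_space \<Rightarrow> complex) v. wave_solution m u v \<longrightarrow>
    integrable lebesgue (u 0) \<longrightarrow> integrable lebesgue (v 0) \<longrightarrow>
    (\<forall>T\<ge>t0. L2_norm (u T) \<le> A * T powr (- real DIM('a) / 4) * (L1_norm (u 0) + L1_norm (v 0) + L2_norm (u 0) + L2_norm (v 0)))"
proof -
  define c where "c = 4 / 5 * min (1 / 2) (m / 2)"
  have c: "c > 0" using m by (simp add: c_def)
  let ?P = "(2 * pi) ^ DIM('a)" and ?M = "1 / m\<^sup>2 + 1"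
  \<comment> \<open>The two summands collect the Gaussian integral of the low frequencies and the
    exponentially small remainder, both measured against T^{-n/2}; the factor 1 / m^2 + 1 merges the
    weights of the velocity and of u.\<close>
  define A2 where "A2 = 5 * exp 1 * ?M * (sqrt (pi / c) ^ DIM('a) / ?P + 1)"
  have A2: "A2 > 0" unfolding A2_def using c m by (intro mult_pos_pos add_nonneg_pos) auto
  have "((\<lambda>T::real. T ^ DIM('a) / exp (c * T)) \<longlongrightarrow> 0) at_top"
  proof -
    have "filterlim (\<lambda>T::real. c * T) at_top at_top"
      using c by (intro filterlim_tendsto_pos_mult_at_top[OF tendsto_const]) (auto intro: filterlim_ident)
    from filterlim_compose[OF tendsto_power_div_exp_0[of "DIM('a)"] this]
    have "((\<lambda>T. (1 / c) ^ DIM('a) * ((c * T) ^ DIM('a) / exp (c * T))) \<longlongrightarrow> (1 / c) ^ DIM('a) * 0) at_top"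
      by (intro tendsto_mult_left)
    then show ?thesis using c by (simp add: power_mult_distrib power_divide)
  qed
  then have "\<forall>\<^sub>F T in at_top. T ^ DIM('a) / exp (c * T) < (1::real)" by (rule order_tendstoD(2)) simp
  then obtain T0 :: real where T0: "\<And>T. T \<ge> T0 \<Longrightarrow> T ^ DIM('a) / exp (c * T) < 1" by (auto simp: eventually_at_top_linorder)
  show ?thesis
  proof (rule exI[of _ "sqrt A2"], intro conjI, goal_cases)
    case 1 then show ?case using A2 by simp
  next
    case 2
    \<comment> \<open>T \<ge> 1 gives sqrt(T) \<le> T, and T \<ge> T0 gives T^n \<le> e^{c T};
      together they bound e^{-c T} by T^{-n/2}.\<close>
    show ?case
    proof (rule exI[of _ "max 1 T0"], intro conjI allI impI)
      fix u v :: "real \<Rightarrow> 'a \<Rightarrow> complex" and T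
      assume w: "wave_solution m u v" and u0: "integrable lebesgue (u 0)" and v0: "integrable lebesgue (v 0)" and T: "max 1 T0 \<le> T"
      interpret wave_solution m u v by (rule w)
      have T1: "T \<ge> 1" and Tpos: "T > 0" using T by auto
      let ?S = "L1_norm (u 0) + L1_norm (v 0) + L2_norm (u 0) + L2_norm (v 0)"
      let ?X = "(L1_norm (v 0))\<^sup>2 / m\<^sup>2 + (L1_norm (u 0))\<^sup>2" and ?Y = "(L2_norm (v 0))\<^sup>2 / m\<^sup>2 + (L2_norm (u 0))\<^sup>2"
      let ?r = "(1 / sqrt T) ^ DIM('a)"
      have le: "y\<^sup>2 / m\<^sup>2 + x\<^sup>2 \<le> ?M * ?S\<^sup>2" if "0 \<le> x" "x \<le> ?S" "0 \<le> y" "y \<le> ?S" for x y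
      proof -
        have "x\<^sup>2 \<le> ?S\<^sup>2" "y\<^sup>2 \<le> ?S\<^sup>2" using that by (auto intro: power_mono)
        then have "y\<^sup>2 / m\<^sup>2 + x\<^sup>2 \<le> ?S\<^sup>2 / m\<^sup>2 + ?S\<^sup>2" by (intro add_mono divide_right_mono) auto
        then show ?thesis by (simp add: algebra_simps)
      qed
      have X: "?X \<le> ?M * ?S\<^sup>2" and Y: "?Y \<le> ?M * ?S\<^sup>2" by (intro le; simp)+
      have "exp (- (c * T)) \<le> ?r"
      proof -
        have "T ^ DIM('a) \<le> exp (c * T)" using T0[of T] T by (simp add: pos_divide_less_eq)
        moreover have "sqrt T ^ DIM('a) \<le> T ^ DIM('a)"
        proof (rule power_mono)
          have "T \<le> T\<^sup>2" using T1 by (simp add: power2_eq_square)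
          then show "sqrt T \<le> T" using T1 by (simp add: real_le_lsqrt)
        qed (use Tpos in simp)
        ultimately have "sqrt T ^ DIM('a) \<le> exp (c * T)" by linarith
        then show ?thesis using Tpos by (simp add: exp_minus divide_inverse power_inverse le_imp_inverse_le)
      qed
      moreover have "sqrt (pi / (c * T)) ^ DIM('a) = sqrt (pi / c) ^ DIM('a) * ?r"
        by (simp add: power_divide real_sqrt_divide real_sqrt_mult power_mult_distrib)
      ultimately have "?P * (L2_norm (u T))\<^sup>2 \<le> 5 * exp 1 * (sqrt (pi / c) ^ DIM('a) * ?r * (?M * ?S\<^sup>2) + ?r * (?P * (?M * ?S\<^sup>2)))"
        using X Y c Tpos
        by (intro order_trans[OF upper_estimate[OF u0 v0 Tpos c_def]] mult_left_mono add_mono mult_mono) auto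
      also have "\<dots> = ?P * (A2 * ?r * ?S\<^sup>2)"
      proof -
        have rearrange: "5 * E * (s * r * (M * S) + r * (P * (M * S))) = P * ((5 * E * M * (s / P + 1)) * r * S)"
          if "P \<noteq> 0" for E s r M S P :: real
          using that by (simp add: field_simps)
        show ?thesis unfolding A2_def by (rule rearrange) simp
      qed
      finally have "(L2_norm (u T))\<^sup>2 \<le> A2 * ?r * ?S\<^sup>2" by simp
      also have "\<dots> = (sqrt A2 * T powr (- real DIM('a) / 4) * ?S)\<^sup>2"
        unfolding power_mult_distrib powr_quarter_power2[OF Tpos] using A2 by simp
      finally show "L2_norm (u T) \<le> sqrt A2 * T powr (- real DIM('a) / 4) * ?S"
        by (rule power2_le_imp_le) (use A2 in \<open>auto intro!: mult_nonneg_nonneg\<close>)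
    qed simp
  qed
qed

text \<open>Only B precedes u and v. The time t0 depends on the first moments and the integrals of
  the data, since the main term must dominate the moment error.\<close>

lemma lower_bound:
  assumes m: "m > 0"
  shows "\<exists>B>0. \<forall>(u :: real \<Rightarrow> 'a::euclidean_space \<Rightarrow> complex) v. wave_solution m u v \<longrightarrow>
    integrable lebesgue (u 0) \<longrightarrow> integrable lebesgue (\<lambda>x. norm x * norm (u 0 x)) \<longrightarrow>
    integrable lebesgue (v 0) \<longrightarrow> integrable lebesgue (\<lambda>x. norm x * norm (v 0 x)) \<longrightarrow>
    (\<exists>t0>0. \<forall>T\<ge>t0. B * (norm (LINT x|lebesgue. u 0 x) + norm (LINT x|lebesgue. v 0 x)) * T powr (- real DIM('a) / 4) \<le> L2_norm (u T))"
proof -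
  obtain e :: 'a where e: "norm e = 1" using nonempty_Basis norm_Basis by blast
  obtain \<rho> T1 where \<rho>: "\<rho> > 0" and T1: "T1 > 0" and win: "\<And>T. T \<ge> T1 \<Longrightarrow> window m e 0 \<rho> T" "\<And>T. T \<ge> T1 \<Longrightarrow> window m e (pi * m) \<rho> T"
    using windows_exist[OF m e] by blast
  define K where "K = pi * m + 1"
  let ?P = "(2 * pi) ^ DIM('a)"
  define V where "V = unit_ball_vol (real DIM('a)) * \<rho> ^ DIM('a)"
  have V: "V > 0" using \<rho> by (simp add: V_def)
  \<comment> \<open>e^{-K} / 8 is what is left of e^{-K} / 4 after the moment error, 4 (2\<pi>)^n
    comes from \<open>lower_estimate\<close>, and 2 max(1, m^2) compares (|P0| + |P1|)^2 with |P0|^2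
    + |P1 / m|^2.\<close>
  define B2 where "B2 = V * (exp (- K) / 8) / (4 * ?P) / (2 * max 1 (m\<^sup>2))"
  have B2: "B2 > 0" unfolding B2_def using V by (intro divide_pos_pos mult_pos_pos) auto
  show ?thesis
  proof (rule exI[of _ "sqrt B2"], intro conjI allI impI)
    show "sqrt B2 > 0" using B2 by simp
    fix u v :: "real \<Rightarrow> 'a \<Rightarrow> complex"
    assume w: "wave_solution m u v" and u0: "integrable lebesgue (u 0)" "integrable lebesgue (\<lambda>x. norm x * norm (u 0 x))"
      and v0: "integrable lebesgue (v 0)" "integrable lebesgue (\<lambda>x. norm x * norm (v 0 x))"
    interpret wave_solution m u v by (rule w)
    define P0 P1 where "P0 = (LINT x|lebesgue. u 0 x)" and "P1 = (LINT x|lebesgue. v 0 x)"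
    define N where "N = (norm P0)\<^sup>2 + (norm (P1 / of_real m))\<^sup>2"
    define M where "M = (moment (v 0))\<^sup>2 / m\<^sup>2 + (moment (u 0))\<^sup>2"
    have M0: "M \<ge> 0" by (simp add: M_def)
    have K0: "K > 0" using m by (simp add: K_def add_pos_pos)
    show "\<exists>t0>0. \<forall>T\<ge>t0. sqrt B2 * (norm (LINT x|lebesgue. u 0 x) + norm (LINT x|lebesgue. v 0 x)) * T powr (- real DIM('a) / 4) \<le> L2_norm (u T)"
      unfolding P0_def[symmetric] P1_def[symmetric]
    \<comment> \<open>If N = 0, both integrals vanish and the claim is trivial; otherwise t0 may be
      defined by dividing by N.\<close>
    proof (cases "N = 0")
      case True
      then have "P0 = 0" "P1 = 0" using m by (simp_all add: N_def add_nonneg_eq_0_iff)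
      then show "\<exists>t0>0. \<forall>T\<ge>t0. sqrt B2 * (norm P0 + norm P1) * T powr (- real DIM('a) / 4) \<le> L2_norm (u T)"
        by (intro exI[of _ 1]) simp
    next
      case False
      then have N: "N > 0" by (simp add: N_def order_less_le)
      \<comment> \<open>From t0 on, the moment error is at most half of the main term e^{-K} / 4
        times N.\<close>
      define t0 where "t0 = max T1 (40 * exp 1 * K * M / (exp (- K) / 8 * N))"
      show "\<exists>t0>0. \<forall>T\<ge>t0. sqrt B2 * (norm P0 + norm P1) * T powr (- real DIM('a) / 4) \<le> L2_norm (u T)"
      proof (rule exI[of _ t0], intro conjI allI impI)
        show "t0 > 0" using T1 by (simp add: t0_def)
        fix T assume "t0 \<le> T"
        then have TT1: "T \<ge> T1" and T2: "40 * exp 1 * K * M / (exp (- K) / 8 * N) \<le> T" by (auto simp: t0_def)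
        have T: "T > 0" using TT1 T1 by simp
        have "40 * exp 1 * (K / T * M) \<le> exp (- K) / 8 * N"
        proof -
          have "40 * exp 1 * K * M \<le> T * (exp (- K) / 8 * N)" using T2 N by (subst (asm) pos_divide_le_eq) auto
          then have "40 * exp 1 * K * M / T \<le> exp (- K) / 8 * N"
            by (simp only: pos_divide_le_eq[OF T] mult.commute[of _ T])
          then show ?thesis by (simp only: times_divide_eq_left times_divide_eq_right mult.assoc)
        qed
        then have "exp (- K) / 8 * N \<le> exp (- K) / 4 * N - 40 * exp 1 * (K / T * M)" by argo
        then have "(V * (1 / sqrt T) ^ DIM('a)) * (exp (- K) / 8 * N) \<le> (V * (1 / sqrt T) ^ DIM('a)) * (exp (- K) / 4 * N - 40 * exp 1 * (K / T * M))"
          using V T by (intro mult_left_mono) auto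
        also have "V * (1 / sqrt T) ^ DIM('a) = unit_ball_vol (real DIM('a)) * (\<rho> / sqrt T) ^ DIM('a)"
          by (simp add: V_def power_divide)
        also have "\<dots> * (exp (- K) / 4 * N - 40 * exp 1 * (K / T * M)) \<le> 4 * (?P * (L2_norm (u T))\<^sup>2)"
          unfolding N_def M_def by (rule lower_estimate[OF u0 v0 T \<rho> win[OF TT1] P0_def P1_def K_def])
        finally have "V * (1 / sqrt T) ^ DIM('a) * (exp (- K) / 8 * N) \<le> 4 * (?P * (L2_norm (u T))\<^sup>2)"
          by (simp add: V_def power_divide)
        note est = this
        have "a * k / (4 * P) * r * N \<le> L" if "a * r * (k * N) \<le> 4 * (P * L)" "P > 0" for a k P r N L :: real
          using that by (simp add: pos_divide_le_eq mult_ac)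
        note rearrange = this
        have low: "V * (exp (- K) / 8) / (4 * ?P) * (1 / sqrt T) ^ DIM('a) * N \<le> (L2_norm (u T))\<^sup>2"
          by (rule rearrange[OF est]) simp
        have "(norm P0 + norm P1)\<^sup>2 \<le> 2 * max 1 (m\<^sup>2) * N"
        proof -
          have "(norm P1)\<^sup>2 = m\<^sup>2 * (norm (P1 / of_real m))\<^sup>2" using m by (simp add: norm_divide power_divide)
          also have "\<dots> \<le> max 1 (m\<^sup>2) * (norm (P1 / of_real m))\<^sup>2" by (intro mult_right_mono) auto
          finally have "(norm P1)\<^sup>2 \<le> max 1 (m\<^sup>2) * (norm (P1 / of_real m))\<^sup>2" .
          moreover have "1 * (norm P0)\<^sup>2 \<le> max 1 (m\<^sup>2) * (norm P0)\<^sup>2" by (intro mult_right_mono) auto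
          moreover have "(norm P0 + norm P1)\<^sup>2 \<le> 2 * (norm P0)\<^sup>2 + 2 * (norm P1)\<^sup>2"
            using zero_le_power2[of "norm P0 - norm P1"] by (simp add: power2_sum power2_diff)
          ultimately show ?thesis unfolding N_def distrib_left by linarith
        qed
        then have "B2 * (1 / sqrt T) ^ DIM('a) * (norm P0 + norm P1)\<^sup>2 \<le> B2 * (1 / sqrt T) ^ DIM('a) * (2 * max 1 (m\<^sup>2) * N)"
          using B2 T by (intro mult_left_mono) auto
        also have "\<dots> = V * (exp (- K) / 8) / (4 * ?P) * (1 / sqrt T) ^ DIM('a) * N"
        proof -
          have "B2 * (2 * max 1 (m\<^sup>2)) = V * (exp (- K) / 8) / (4 * ?P)"
            by (rule nonzero_divide_eq_eq[THEN iffD1, OF _ B2_def[symmetric], symmetric]) simp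
          moreover have "B2 * r * (2 * max 1 (m\<^sup>2) * N) = B2 * (2 * max 1 (m\<^sup>2)) * r * N" for r
            by (simp only: mult_ac)
          ultimately show ?thesis by (simp only:)
        qed
        also note low
        finally have "(sqrt B2 * (norm P0 + norm P1) * T powr (- real DIM('a) / 4))\<^sup>2 \<le> (L2_norm (u T))\<^sup>2"
          unfolding power_mult_distrib powr_quarter_power2[OF T] using B2 by (simp add: mult_ac)
        then show "sqrt B2 * (norm P0 + norm P1) * T powr (- real DIM('a) / 4) \<le> L2_norm (u T)"
          by (rule power2_le_imp_le) simp
      qed
    qed
  qed
qed

theorem theorem1p3:
  fixes m :: real
  assumes "m > 0"
  shows "\<exists>C>0. \<forall>u\<^sub>0 \<in> H1 \<inter> L11. \<forall>u\<^sub>1 \<in> L2 \<inter> L11. \<forall>u :: real \<Rightarrow> real ^ 'n \<Rightarrow> complex.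
    weak_solution m u\<^sub>0 u\<^sub>1 u \<longrightarrow>
    (\<exists>t\<^sub>0>0. \<forall>t\<ge>t\<^sub>0.
       inverse C * (norm (LINT x|lebesgue. u\<^sub>0 x) + norm (LINT x|lebesgue. u\<^sub>1 x))
           * t powr (- real CARD('n) / 4) \<le> L2_norm (u t) \<and>
       L2_norm (u t) \<le> C * t powr (- real CARD('n) / 4)
           * (L1_norm u\<^sub>0 + L1_norm u\<^sub>1 + H1_norm u\<^sub>0 + L2_norm u\<^sub>1))"
proof -
  note dims = DIM_cart DIM_real mult_1_right
  obtain A tA where A: "A > 0" "tA > 0" and up: "\<forall>(u :: real \<Rightarrow> real ^ 'n \<Rightarrow> complex) v. wave_solution m u v \<longrightarrow>
    integrable lebesgue (u 0) \<longrightarrow> integrable lebesgue (v 0) \<longrightarrow>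
    (\<forall>T\<ge>tA. L2_norm (u T) \<le> A * T powr (- real CARD('n) / 4) * (L1_norm (u 0) + L1_norm (v 0) + L2_norm (u 0) + L2_norm (v 0)))"
    using upper_bound[OF assms, where 'a = "real ^ 'n", unfolded dims] by (elim exE conjE)
  obtain B where B: "B > 0" and low: "\<forall>(u :: real \<Rightarrow> real ^ 'n \<Rightarrow> complex) v. wave_solution m u v \<longrightarrow>
    integrable lebesgue (u 0) \<longrightarrow> integrable lebesgue (\<lambda>x. norm x * norm (u 0 x)) \<longrightarrow>
    integrable lebesgue (v 0) \<longrightarrow> integrable lebesgue (\<lambda>x. norm x * norm (v 0 x)) \<longrightarrow>
    (\<exists>t0>0. \<forall>T\<ge>t0. B * (norm (LINT x|lebesgue. u 0 x) + norm (LINT x|lebesgue. v 0 x)) * T powr (- real CARD('n) / 4) \<le> L2_norm (u T))"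
    using lower_bound[OF assms, where 'a = "real ^ 'n", unfolded dims] by (elim exE conjE)
  \<comment> \<open>A \<le> C serves the upper bound, and 1 / B \<le> C gives C^{-1} \<le> B for the
    lower one.\<close>
  define C where "C = max A (1 / B)"
  have C: "C > 0" "A \<le> C" "inverse C \<le> B"
  proof -
    show "C > 0" "A \<le> C" using A by (auto simp: C_def)
    have "inverse C \<le> inverse (1 / B)" using B by (intro le_imp_inverse_le) (auto simp: C_def)
    then show "inverse C \<le> B" by simp
  qed
  show ?thesis
  proof (rule exI[of _ C], intro conjI ballI allI impI C(1))
    fix u\<^sub>0 u\<^sub>1 :: "real ^ 'n \<Rightarrow> complex" and u :: "real \<Rightarrow> real ^ 'n \<Rightarrow> complex"
    assume u0: "u\<^sub>0 \<in> H1 \<inter> L11" and u1: "u\<^sub>1 \<in> L2 \<inter> L11" and ws: "weak_solution m u\<^sub>0 u\<^sub>1 u"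
    obtain v where v: "continuous_curve L2 L2_norm v" "L2_curve_deriv u v"
      and ae: "AE x in lebesgue. u 0 x = u\<^sub>0 x" "AE x in lebesgue. v 0 x = u\<^sub>1 x"
      using ws unfolding weak_solution_def by blast
    have "continuous_curve L2 L2_norm u" "distributional_solution m u"
      using ws H1_curve_imp_L2_curve[of u] by (simp_all add: weak_solution_def)
    then have w: "wave_solution m u v" using v assms by unfold_locales
    then interpret wave_solution m u v .
    have meas: "u 0 \<in> borel_measurable lebesgue" "v 0 \<in> borel_measurable lebesgue"
      using L2D(1)[OF u_L2[of 0]] L2D(1)[OF v_L2[of 0]] by simp_all
    \<comment> \<open>The initial values agree with the data only almost everywhere, so
      integrability, integrals and norms are carried across null sets.\<close>
    have transfer: "integrable lebesgue f" "integrable lebesgue (\<lambda>x. norm x * norm (f x))"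
      "(LINT x|lebesgue. f x) = (LINT x|lebesgue. g x)" "L1_norm f = L1_norm g" "L2_norm f = L2_norm g"
      if g: "g \<in> L11" and fm [measurable]: "f \<in> borel_measurable lebesgue" and fg: "AE x in lebesgue. f x = g x"
      for f g :: "real ^ 'n \<Rightarrow> complex"
    proof -
      have gi: "integrable lebesgue g" "integrable lebesgue (\<lambda>x. (1 + norm x) * norm (g x))"
        using g by (auto simp: L11_def)
      have [measurable]: "g \<in> borel_measurable lebesgue" using gi(1) by auto
      have [measurable]: "(\<lambda>x::real ^ 'n. norm x) \<in> borel_measurable lebesgue"
        by (intro continuous_borel_measurable_lebesgue continuous_intros)
      show "integrable lebesgue f" using gi(1) fg by (subst integrable_cong_AE[of f _ g]) auto
      show "integrable lebesgue (\<lambda>x. norm x * norm (f x))"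
      proof (rule Bochner_Integration.integrable_bound[OF gi(2)])
        show "AE x in lebesgue. norm (norm x * norm (f x)) \<le> norm ((1 + norm x) * norm (g x))"
          using fg by eventually_elim (simp add: abs_mult mult_right_mono)
      qed measurable
      show "(LINT x|lebesgue. f x) = (LINT x|lebesgue. g x)" using fg by (intro integral_cong_AE) auto
      have "AE x in lebesgue. norm (f x) = norm (g x)" using fg by eventually_elim simp
      then show "L1_norm f = L1_norm g" unfolding L1_norm_def by (intro integral_cong_AE) auto
      show "L2_norm f = L2_norm g" using fg by (intro L2_norm_cong_AE) auto
    qed
    note tu = transfer[OF _ meas(1) ae(1)] and tv = transfer[OF _ meas(2) ae(2)]
    have u0': "u\<^sub>0 \<in> L11" and u1': "u\<^sub>1 \<in> L11" using u0 u1 by auto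
    obtain tB where tB: "tB > 0" "\<And>T. T \<ge> tB \<Longrightarrow>
        B * (norm (LINT x|lebesgue. u\<^sub>0 x) + norm (LINT x|lebesgue. u\<^sub>1 x)) * T powr (- real CARD('n) / 4) \<le> L2_norm (u T)"
      using low[rule_format, OF w tu(1,2)[OF u0'] tv(1,2)[OF u1']] unfolding tu(3)[OF u0'] tv(3)[OF u1'] by blast
    show "\<exists>t\<^sub>0>0. \<forall>t\<ge>t\<^sub>0.
       inverse C * (norm (LINT x|lebesgue. u\<^sub>0 x) + norm (LINT x|lebesgue. u\<^sub>1 x)) * t powr (- real CARD('n) / 4) \<le> L2_norm (u t) \<and>
       L2_norm (u t) \<le> C * t powr (- real CARD('n) / 4) * (L1_norm u\<^sub>0 + L1_norm u\<^sub>1 + H1_norm u\<^sub>0 + L2_norm u\<^sub>1)"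
    proof (rule exI[of _ "max tA tB"], intro conjI allI impI)
      show "0 < max tA tB" using tB(1) by simp
      fix t assume "max tA tB \<le> t"
      then have t: "t \<ge> tA" "t \<ge> tB" by auto
      have "inverse C * (norm (LINT x|lebesgue. u\<^sub>0 x) + norm (LINT x|lebesgue. u\<^sub>1 x)) * t powr (- real CARD('n) / 4)
          \<le> B * (norm (LINT x|lebesgue. u\<^sub>0 x) + norm (LINT x|lebesgue. u\<^sub>1 x)) * t powr (- real CARD('n) / 4)"
        by (intro mult_right_mono C(3)) auto
      also note tB(2)[OF t(2)]
      finally show "inverse C * (norm (LINT x|lebesgue. u\<^sub>0 x) + norm (LINT x|lebesgue. u\<^sub>1 x)) * t powr (- real CARD('n) / 4) \<le> L2_norm (u t)" .
      have "L2_norm (u t) \<le> A * t powr (- real CARD('n) / 4) * (L1_norm u\<^sub>0 + L1_norm u\<^sub>1 + L2_norm u\<^sub>0 + L2_norm u\<^sub>1)"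
        using up[rule_format, OF w tu(1)[OF u0'] tv(1)[OF u1'] t(1)] unfolding tu(4,5)[OF u0'] tv(4,5)[OF u1'] .
      \<comment> \<open>The estimate with the L^2 norm of the initial displacement is weakened to
        the H^1 norm of the theorem.\<close>
      also have "\<dots> \<le> C * t powr (- real CARD('n) / 4) * (L1_norm u\<^sub>0 + L1_norm u\<^sub>1 + H1_norm u\<^sub>0 + L2_norm u\<^sub>1)"
        using C(1,2) L2_norm_le_H1_norm[of u\<^sub>0] by (intro mult_mono add_mono) auto
      finally show "L2_norm (u t) \<le> C * t powr (- real CARD('n) / 4) * (L1_norm u\<^sub>0 + L1_norm u\<^sub>1 + H1_norm u\<^sub>0 + L2_norm u\<^sub>1)" .
    qed
  qed
qed

end
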